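(* Let $d\geq 1$, and let $E\subset \mathbb{R}^d$ and $\tilde{\Gamma}\subset \mathbb{R}^d\times(\mathbb{R}_{>0})^d$ be non-empty Borel sets. Let $\tilde{\Gamma}(E)=\{(r_1x_1+z_1,\dots,r_dx_d+z_d): x=(x_1,\dots,x_d)\in E,\ (z,r)=(z_1,\dots,z_d,r_1,\dots,r_d)\in\tilde{\Gamma}\}\subset\mathbb{R}^d$. Then: (i) $\dim_{\mathcal S}\tilde{\Gamma}(E)\geq \dim_{\mathcal H}E+\dim_{\mathcal H}\tilde{\Gamma}-2d+1$. (ii) If $\dim_{\mathcal H}E+\dim_{\mathcal H}\tilde{\Gamma}>3d-1$, then $\mathcal{L}^d(\tilde{\Gamma}(E))>0$. (iii) For $0<u<d$, if $\dim_{\mathcal H}E+\dim_{\mathcal H}\tilde{\Gamma}>2d-1+u$, then $\dim_{\mathcal H}\tilde{\Gamma}(E)\geq u$.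
   Context: $\mathcal{L}^d$ is Lebesgue measure on $\mathbb{R}^d$ and $\dim_{\mathcal H}$ is Hausdorff dimension (for $\tilde{\Gamma}$, with respect to the Euclidean metric of $\mathbb{R}^{2d}$). For $A\subset\mathbb{R}^d$, $\mathcal{M}(A)$ is the set of non-zero Radon measures on $\mathbb{R}^d$ with compact support contained in $A$. The Fourier transform is $\widehat{\mu}(\xi)=\int e^{-2\pi i\xi\cdot x}\,d\mu(x)$. The Sobolev dimension of $\mu\in\mathcal{M}(\mathbb{R}^d)$ is $\dim_{\mathcal S}\mu=\sup\{s\in\mathbb{R}: \int|\widehat{\mu}(x)|^2(1+|x|)^{s-d}\,dx<\infty\}$, and the Sobolev dimension of a set $A$ is $\dim_{\mathcal S}A=\sup\{\dim_{\mathcal S}\mu:\ \mu\in\mathcal{M}(A)\text{ a probability measure}\}$. *)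

theory Defs
  imports "HOL-Analysis.Analysis" "HOL-Probability.Probability_Measure"
begin

section \<open>Hausdorff dimension\<close>

text \<open>The gauge $\mathrm{diam}(A)^s$, with the usual conventions that the empty set
  contributes nothing and that $0^0 = 1$ (so that the case $s = 0$ is counting measure).
  It is only applied to bounded sets, since \<^const>\<open>diameter\<close> is meaningful only there.\<close>

definition diam_powr :: "real \<Rightarrow> 'a::metric_space set \<Rightarrow> ennreal" where
  "diam_powr s A =
    (if A = {} then 0 else if s = 0 then 1 else ennreal (diameter A powr s))"

definition hausdorff_premeasure :: "real \<Rightarrow> real \<Rightarrow> 'a::metric_space set \<Rightarrow> ennreal" where
  "hausdorff_premeasure s \<delta> A =
    (INF U \<in> {U :: nat \<Rightarrow> 'a set. A \<subseteq> (\<Union>i. U i) \<and> (\<forall>i. bounded (U i) \<and> diameter (U i) \<le> \<delta>)}.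
       \<Sum>i. diam_powr s (U i))"

definition hausdorff_measure :: "real \<Rightarrow> 'a::metric_space set \<Rightarrow> ennreal" where
  "hausdorff_measure s A = (SUP \<delta> \<in> {0<..}. hausdorff_premeasure s \<delta> A)"

definition hausdorff_dim :: "'a::metric_space set \<Rightarrow> ereal" where
  "hausdorff_dim A = Inf (ereal ` {s. 0 \<le> s \<and> hausdorff_measure s A = 0})"

section \<open>Compactly supported Radon measures\<close>

definition radon_measure :: "'a::topological_space measure \<Rightarrow> bool" where
  "radon_measure M \<longleftrightarrow>
     sets M = sets borel \<and>
     (\<forall>K. compact K \<longrightarrow> emeasure M K < \<infinity>) \<and>
     (\<forall>B \<in> sets borel. emeasure M B = (SUP K \<in> {K. compact K \<and> K \<subseteq> B}. emeasure M K))"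

definition measure_support :: "'a::topological_space measure \<Rightarrow> 'a set" where
  "measure_support M = {x. \<forall>U. open U \<longrightarrow> x \<in> U \<longrightarrow> emeasure M U > 0}"

definition compact_radon_measures :: "'a::topological_space set \<Rightarrow> 'a measure set" where
  "compact_radon_measures A =
    {M. radon_measure M \<and> emeasure M UNIV \<noteq> 0 \<and>
        compact (measure_support M) \<and> measure_support M \<subseteq> A}"

section \<open>Fourier transform and Sobolev dimension\<close>

definition fourier_transform :: "'a::euclidean_space measure \<Rightarrow> 'a \<Rightarrow> complex" where
  "fourier_transform M \<xi> =
    (LINT x|M. exp (- 2 * complex_of_real pi * \<i> * complex_of_real (\<xi> \<bullet> x)))"

text \<open>Sobolev dimension may be infinite (for instance for a measure with smooth density),
  hence the values in \<^typ>\<open>ereal\<close>.\<close>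

definition sobolev_dim_measure :: "'a::euclidean_space measure \<Rightarrow> ereal" where
  "sobolev_dim_measure M =
    Sup (ereal ` {s. (\<integral>\<^sup>+ x. ennreal ((cmod (fourier_transform M x))\<^sup>2
                        * (1 + norm x) powr (s - real DIM('a))) \<partial>lborel) < \<infinity>})"

definition sobolev_dim :: "'a::euclidean_space set \<Rightarrow> ereal" where
  "sobolev_dim A =
    (SUP M \<in> {M \<in> compact_radon_measures A. prob_space M}. sobolev_dim_measure M)"

section \<open>Images under families of coordinatewise dilations and translations\<close>

definition dilation_image ::
  "((real ^ 'n) \<times> (real ^ 'n)) set \<Rightarrow> (real ^ 'n) set \<Rightarrow> (real ^ 'n) set" where
  "dilation_image \<Gamma> E = {(\<chi> i. r $ i * x $ i + z $ i) | x z r. x \<in> E \<and> (z, r) \<in> \<Gamma>}"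

end

theory Submission
  imports Defs "HOL-Probability.Probability"
begin

text \<open>Choose Frostman measures \<open>\<mu>\<close> on \<open>E\<close> and \<open>\<nu>\<close> on \<open>\<Gamma>\<close> with exponents \<open>s < dim E\<close> and
  \<open>t < dim \<Gamma>\<close>, and let \<open>M\<close> be the image of \<open>\<mu> \<times> \<nu>\<close> under \<open>(x, (z, r)) \<mapsto> r x + z\<close>. Its Fourier
  transform at \<open>\<xi>\<close> is the \<open>\<mu>\<close>-average of that of \<open>\<nu>\<close> at \<open>(\<xi>, \<xi> x)\<close>. The transform of \<open>\<nu>\<close> is constant at
  unit scale, and for \<open>|\<xi>| \<approx> R\<close> only those \<open>x\<close> in a slab of width \<open>1/R\<close> bring \<open>(\<xi>, \<xi> x)\<close> near a given
  point; the slab has \<open>\<mu>\<close>-measure at most \<open>R^(d-1-s)\<close>. As the squared transform of \<open>\<nu>\<close> has integral at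
  most \<open>R^(2d-t)\<close> over the ball of radius \<open>R\<close>, that of \<open>M\<close> has integral at most \<open>R^(3d-1-s-t)\<close> over the
  shell \<open>|\<xi>| \<approx> R\<close>, so that the Sobolev integral of order \<open>\<sigma>\<close> converges for \<open>\<sigma> < s + t - 2d + 1\<close>.

  Frostman measures on Borel sets, and the Lebesgue measurability of the image, which is only an
  analytic set, both come from Choquet's capacitability argument, applied to the dyadic Hausdorff
  content and to the Lebesgue outer measure.\<close>

section \<open>Laminar families and their contents\<close>

text \<open>The obstacle to a Frostman measure is that \<open>E\<close> and \<open>\<Gamma>\<close>
  are merely Borel: distributing mass needs a compact set, and extracting one needs a set function
  that is continuous along increasing sequences of arbitrary sets. Contents built from dyadic cells
  have this property because two cells are nested or disjoint, which makes the cost of covers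
  strongly subadditive. A cover by half-open cells does not extend to a neighbourhood, so the
  capacity argument speaks only of open neighbourhoods of the compact set. Gaussians serve as
  cutoffs throughout: they factor over the coordinates and are their own transforms up to scale.
  Claims (ii) and (iii) are read off from the correlation integral of \<open>M (cball x r)\<close>
  against \<open>M\<close>, which a convergent Sobolev integral of order \<open>\<sigma>\<close>, at
  most the dimension, bounds by a multiple of \<open>r powr \<sigma>\<close>; neither a density of
  \<open>M\<close> nor a Riesz energy is formed.\<close>

definition family_content :: "'a set set \<Rightarrow> 'a set measure \<Rightarrow> 'a set \<Rightarrow> ennreal" where
  "family_content \<Q> m A = (INF \<C> \<in> {\<C>. \<C> \<subseteq> \<Q> \<and> A \<subseteq> \<Union>\<C>}. emeasure m \<C>)"

definition max_members :: "'a set set \<Rightarrow> 'a set set" where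
  "max_members \<C> = {Q \<in> \<C>. \<forall>P\<in>\<C>. Q \<subseteq> P \<longrightarrow> Q = P}"

lemma max_members_subset:
  "Q \<in> max_members \<C> \<Longrightarrow> \<C>' \<subseteq> \<C> \<Longrightarrow> Q \<in> \<C>' \<Longrightarrow> Q \<in> max_members \<C>'"
  by (auto simp: max_members_def)

lemma family_content_le:
  "\<C> \<subseteq> \<Q> \<Longrightarrow> A \<subseteq> \<Union>\<C> \<Longrightarrow> family_content \<Q> m A \<le> emeasure m \<C>"
  unfolding family_content_def by (rule INF_lower) auto

lemma family_content_mono: "A \<subseteq> B \<Longrightarrow> family_content \<Q> m A \<le> family_content \<Q> m B"
  unfolding family_content_def by (rule INF_superset_mono) auto

lemma family_content_approx:
  assumes "family_content \<Q> m A < \<infinity>" "0 < \<epsilon>"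
  shows "\<exists>\<C>. \<C> \<subseteq> \<Q> \<and> A \<subseteq> \<Union>\<C> \<and> emeasure m \<C> \<le> family_content \<Q> m A + \<epsilon>"
proof -
  have "family_content \<Q> m A < family_content \<Q> m A + \<epsilon>"
    using assms ennreal_add_left_cancel_less[of "family_content \<Q> m A" 0 \<epsilon>] by auto
  then obtain \<C> where "\<C> \<subseteq> \<Q>" "A \<subseteq> \<Union>\<C>" "emeasure m \<C> < family_content \<Q> m A + \<epsilon>"
    unfolding family_content_def[of \<Q> m A] INF_less_iff by auto
  then show ?thesis using less_imp_le by blast
qed

lemma family_content_subadditive:
  assumes "finite J" "sets m = UNIV" "A \<subseteq> (\<Union>j\<in>J. B j)"
  shows "family_content \<Q> m A \<le> (\<Sum>j\<in>J. family_content \<Q> m (B j))"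
proof (cases "\<forall>j\<in>J. family_content \<Q> m (B j) < \<infinity>")
  case False
  then obtain j where "j \<in> J" "family_content \<Q> m (B j) = \<infinity>"
    by (metis infinity_ennreal_def top.not_eq_extremum)
  moreover have "family_content \<Q> m (B j) \<le> (\<Sum>j\<in>J. family_content \<Q> m (B j))"
    using assms(1) \<open>j \<in> J\<close> by (intro member_le_sum) auto
  ultimately show ?thesis by (metis infinity_ennreal_def top_greatest top_unique)
next
  case True
  show ?thesis
  proof (rule ennreal_le_epsilon)
    fix e :: real assume e: "e > 0"
    \<comment> \<open>The summand 1 keeps \<open>d\<close> positive when \<open>J\<close> is
      empty.\<close>
    define d where "d = e / (card J + 1)"
    have d: "d > 0" using e by (simp add: d_def)
    have "\<forall>j\<in>J. \<exists>\<C>. \<C> \<subseteq> \<Q> \<and> B j \<subseteq> \<Union>\<C> \<and> emeasure m \<C> \<le> family_content \<Q> m (B j) + ennreal d"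
      by (intro ballI family_content_approx) (use True d in auto)
    then obtain \<C> where C: "\<And>j. j \<in> J \<Longrightarrow> \<C> j \<subseteq> \<Q>" "\<And>j. j \<in> J \<Longrightarrow> B j \<subseteq> \<Union>(\<C> j)"
      "\<And>j. j \<in> J \<Longrightarrow> emeasure m (\<C> j) \<le> family_content \<Q> m (B j) + ennreal d"
      by metis
    have "family_content \<Q> m A \<le> emeasure m (\<Union>j\<in>J. \<C> j)"
    proof (rule family_content_le)
      show "(\<Union>j\<in>J. \<C> j) \<subseteq> \<Q>" using C(1) by (rule UN_least)
      have "B j \<subseteq> \<Union>(\<Union>j\<in>J. \<C> j)" if "j \<in> J" for j
        by (rule subset_trans[OF C(2)[OF that]]) (use that in auto)
      then have "(\<Union>j\<in>J. B j) \<subseteq> \<Union>(\<Union>j\<in>J. \<C> j)" by (rule UN_least)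
      with assms(3) show "A \<subseteq> \<Union>(\<Union>j\<in>J. \<C> j)" by (rule subset_trans)
    qed
    also have "\<dots> \<le> (\<Sum>j\<in>J. emeasure m (\<C> j))"
      using assms by (intro emeasure_subadditive_finite) auto
    also have "\<dots> \<le> (\<Sum>j\<in>J. family_content \<Q> m (B j) + ennreal d)"
      by (intro sum_mono C)
    also have "\<dots> = (\<Sum>j\<in>J. family_content \<Q> m (B j)) + ennreal (card J * d)"
      using d by (simp add: sum.distrib ennreal_mult ennreal_of_nat_eq_real_of_nat)
    also have "card J * d \<le> e"
      using e by (simp add: d_def field_simps)
    then have "(\<Sum>j\<in>J. family_content \<Q> m (B j)) + ennreal (card J * d) \<le> (\<Sum>j\<in>J. family_content \<Q> m (B j)) + ennreal e"
      by (intro add_left_mono ennreal_leI) simp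
    finally show "family_content \<Q> m A \<le> (\<Sum>j\<in>J. family_content \<Q> m (B j)) + ennreal e" .
  qed
qed

text \<open>Dyadic cells are the model. \<open>finite_above\<close> guarantees that every member of
  a subfamily lies below a maximal one. Since \<open>m\<close> is a measure on sets of cells, the
  cost of a cover obeys additivity and continuity from below.\<close>

locale laminar_family =
  fixes \<Q> :: "'a set set" and m :: "'a set measure"
  assumes laminar: "\<And>P Q. P \<in> \<Q> \<Longrightarrow> Q \<in> \<Q> \<Longrightarrow> P \<inter> Q \<noteq> {} \<Longrightarrow> P \<subseteq> Q \<or> Q \<subseteq> P"
    and finite_above: "\<And>Q. Q \<in> \<Q> \<Longrightarrow> finite {P \<in> \<Q>. Q \<subseteq> P}"
    and sets_m[simp, measurable_cong]: "sets m = UNIV"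
begin

lemma max_members_above:
  assumes "\<C> \<subseteq> \<Q>" "Q \<in> \<C>"
  obtains P where "P \<in> max_members \<C>" "Q \<subseteq> P"
proof -
  have "finite {P \<in> \<C>. Q \<subseteq> P}"
    by (rule finite_subset[OF _ finite_above[of Q]]) (use assms in auto)
  from finite_has_maximal2[OF this, of Q] assms(2)
  obtain P where "P \<in> \<C>" "Q \<subseteq> P" "\<forall>P'\<in>{P \<in> \<C>. Q \<subseteq> P}. P \<subseteq> P' \<longrightarrow> P = P'"
    by auto
  then show thesis
    by (intro that[of P]) (auto simp: max_members_def)
qed

lemma Union_max_members:
  assumes "\<C> \<subseteq> \<Q>"
  shows "\<Union>(max_members \<C>) = \<Union>\<C>"
proof
  show "\<Union>(max_members \<C>) \<subseteq> \<Union>\<C>" by (auto simp: max_members_def)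
  show "\<Union>\<C> \<subseteq> \<Union>(max_members \<C>)"
  proof
    fix x assume "x \<in> \<Union>\<C>"
    then obtain Q where Q: "Q \<in> \<C>" "x \<in> Q" by (rule UnionE)
    obtain P where "P \<in> max_members \<C>" "Q \<subseteq> P"
      using max_members_above[OF assms Q(1)] .
    with Q(2) show "x \<in> \<Union>(max_members \<C>)" by (intro UnionI[of P]) auto
  qed
qed

text \<open>Where a cell of one cover meets a cell of the other they are nested, and the smaller
  ones already cover \<open>A\<close>. The maximal cells and these smaller ones together use each
  cell at most as often as the two given covers do.\<close>

lemma content_strong_subadditive:
  assumes D: "\<D> \<subseteq> \<Q>" "A \<subseteq> \<Union>\<D>" and C: "\<C> \<subseteq> \<Q>" "A \<subseteq> \<Union>\<C>"
  shows "emeasure m (max_members (\<D> \<union> \<C>)) + family_content \<Q> m A \<le> emeasure m \<D> + emeasure m \<C>"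
proof -
  let ?max = "max_members (\<D> \<union> \<C>)"
  define low where "low = {Q \<in> \<D>. \<exists>P\<in>\<C>. Q \<subseteq> P} \<union> {Q \<in> \<C>. \<exists>P\<in>\<D>. Q \<subseteq> P}"
  have "A \<subseteq> \<Union>low"
  proof
    fix x assume "x \<in> A"
    with D C obtain P Q where "x \<in> P" "P \<in> \<D>" "x \<in> Q" "Q \<in> \<C>" by blast
    then show "x \<in> \<Union>low"
      using laminar[of P Q] D C unfolding low_def by blast
  qed
  then have "family_content \<Q> m A \<le> emeasure m low"
    using D C by (intro family_content_le) (auto simp: low_def)
  then have "emeasure m ?max + family_content \<Q> m A \<le> emeasure m ?max + emeasure m low"
    by (rule add_left_mono)
  also have "\<dots> = emeasure m (?max \<union> low) + emeasure m (?max \<inter> low)"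
    by (rule emeasure_Un_Int) auto
  \<comment> \<open>A cell that is maximal in the union and also lies inside a cell of the other
    cover equals that cell, hence belongs to both covers.\<close>
  also have "\<dots> \<le> emeasure m (\<D> \<union> \<C>) + emeasure m (\<D> \<inter> \<C>)"
    by (intro add_mono emeasure_mono) (auto simp: max_members_def low_def)
  also have "\<dots> = emeasure m \<D> + emeasure m \<C>"
    by (rule emeasure_Un_Int[symmetric]) auto
  finally show ?thesis .
qed

text \<open>Near-optimal covers of the \<open>A n\<close> need not fit together. Merging them one by
  one and keeping maximal cells costs, by strong subadditivity, only the sum of the individual
  errors; the merged covers have a limit family, which covers the union.\<close>

lemma content_SUP_incseq:
  assumes A: "incseq A"
  shows "family_content \<Q> m (\<Union>n. A n) = (SUP n. family_content \<Q> m (A n))"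
proof (rule antisym)
  let ?M = "family_content \<Q> m"
  show "(SUP n. ?M (A n)) \<le> ?M (\<Union>n. A n)"
    by (intro SUP_least family_content_mono) auto
  show "?M (\<Union>n. A n) \<le> (SUP n. ?M (A n))"
  proof (cases "(SUP n. ?M (A n)) < \<infinity>")
    case False
    then have "(SUP n. ?M (A n)) = top" by (metis infinity_ennreal_def top.not_eq_extremum)
    then show ?thesis by (metis top_greatest)
  next
    case True
    have fin: "?M (A n) < \<infinity>" for n
      using True by (meson SUP_upper UNIV_I le_less_trans)
    show ?thesis
    proof (rule ennreal_le_epsilon)
      fix e :: real assume e: "e > 0"
      define h where "h n = e * (1/2)^(Suc n)" for n
      have h: "h n > 0" for n using e by (simp add: h_def)
      have "\<forall>n. \<exists>\<C>. \<C> \<subseteq> \<Q> \<and> A n \<subseteq> \<Union>\<C> \<and> emeasure m \<C> \<le> ?M (A n) + ennreal (h n)"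
        by (intro allI family_content_approx) (use fin h in auto)
      then obtain \<C> where C: "\<And>n. \<C> n \<subseteq> \<Q>" "\<And>n. A n \<subseteq> \<Union>(\<C> n)"
        "\<And>n. emeasure m (\<C> n) \<le> ?M (A n) + ennreal (h n)"
        by metis
      define \<D> where "\<D> = rec_nat (\<C> 0) (\<lambda>n D. max_members (D \<union> \<C> (Suc n)))"
      have D0: "\<D> 0 = \<C> 0" and DS: "\<D> (Suc n) = max_members (\<D> n \<union> \<C> (Suc n))" for n
        by (simp_all add: \<D>_def)
      have D_sub: "\<D> n \<subseteq> (\<Union>k. \<C> k)" for n
        by (induction n) (auto simp: D0 DS max_members_def)
      then have DQ: "\<D> n \<subseteq> \<Q>" for n using C(1) by blast
      have D_cover: "A n \<subseteq> \<Union>(\<D> n)" for n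
      proof (induction n)
        case 0 then show ?case by (simp add: D0 C)
      next
        case (Suc n)
        have "\<Union>(\<D> (Suc n)) = \<Union>(\<D> n \<union> \<C> (Suc n))"
          unfolding DS using DQ C(1) by (intro Union_max_members) auto
        then show ?case using C(2)[of "Suc n"] by auto
      qed
      have cost: "emeasure m (\<D> n) \<le> ?M (A n) + ennreal (\<Sum>k\<le>n. h k)" for n
      proof (induction n)
        case 0 then show ?case using C(3)[of 0] by (simp add: D0)
      next
        case (Suc n)
        have "A n \<subseteq> A (Suc n)" using A by (simp add: incseqD)
        \<comment> \<open>Both \<open>\<D> n\<close> and \<open>\<C> (Suc n)\<close> cover
          \<open>A n\<close>, so its content is gained back on the left; being finite it cancels,
          and the excess grows only by \<open>h (Suc n)\<close>.\<close>
        then have "emeasure m (\<D> (Suc n)) + ?M (A n) \<le> emeasure m (\<D> n) + emeasure m (\<C> (Suc n))"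
          unfolding DS using DQ D_cover C by (intro content_strong_subadditive) blast+
        also have "\<dots> \<le> (?M (A n) + ennreal (\<Sum>k\<le>n. h k)) + (?M (A (Suc n)) + ennreal (h (Suc n)))"
          by (intro add_mono Suc C)
        also have "\<dots> = (?M (A (Suc n)) + ennreal (\<Sum>k\<le>Suc n. h k)) + ?M (A n)"
          using h by (simp add: ac_simps sum_nonneg less_imp_le)
        finally show ?case
          using fin[of n] unfolding add.commute[of _ "?M (A n)"] ennreal_add_left_cancel_le by auto
      qed
      have hs: "(\<Sum>k\<le>n. h k) \<le> e" for n
      proof -
        have "(\<Sum>k\<le>n. h k) = e * (1 - (1/2)^(Suc n))"
          by (induction n) (auto simp: h_def field_simps)
        also have "\<dots> \<le> e * 1" using e by (intro mult_left_mono) auto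
        finally show ?thesis by simp
      qed
      \<comment> \<open>The limit family. A cell of \<open>\<C> k\<close> that is maximal among all
        cells ever used is never displaced, so it stays in every \<open>\<D> n\<close> with
        \<open>n \<ge> k\<close>.\<close>
      define \<E> where "\<E> = max_members (\<Union>k. \<C> k)"
      have E_in: "Q \<in> \<D> n" if "Q \<in> \<E>" "Q \<in> \<C> k" "k \<le> n" for Q k n
        using \<open>k \<le> n\<close>
      proof (induction n rule: dec_induct)
        case base
        show ?case
        proof (cases k)
          case 0 then show ?thesis using that by (simp add: D0)
        next
          case (Suc j)
          show ?thesis
            unfolding Suc DS
            by (rule max_members_subset[OF that(1)[unfolded \<E>_def]]) (use that Suc D_sub in auto)
        qed
      next
        case (step n)
        then show ?case
          unfolding DS
          by (intro max_members_subset[OF that(1)[unfolded \<E>_def]]) (use D_sub in auto)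
      qed
      \<comment> \<open>The cells that are present from stage \<open>N\<close> on. These families
        increase, so continuity from below transfers the bound for each \<open>\<D> N\<close> to
        \<open>\<E>\<close>.\<close>
      define B where "B N = (\<Inter>n\<in>{N..}. \<D> n)" for N
      have "incseq B" by (auto simp: incseq_def B_def)
      have "\<E> \<subseteq> (\<Union>N. B N)"
      proof
        fix Q assume Q: "Q \<in> \<E>"
        then obtain k where "Q \<in> \<C> k" by (auto simp: \<E>_def max_members_def)
        then have "Q \<in> B k" using E_in[OF Q] by (auto simp: B_def)
        then show "Q \<in> (\<Union>N. B N)" by blast
      qed
      then have "emeasure m \<E> \<le> emeasure m (\<Union>N. B N)" by (intro emeasure_mono) auto
      also have "\<dots> = (SUP N. emeasure m (B N))"
        using \<open>incseq B\<close> by (intro SUP_emeasure_incseq[symmetric]) auto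
      also have "\<dots> \<le> (SUP n. ?M (A n)) + ennreal e"
      proof (rule SUP_least)
        fix N
        have "emeasure m (B N) \<le> emeasure m (\<D> N)"
          by (intro emeasure_mono) (auto simp: B_def)
        also have "\<dots> \<le> ?M (A N) + ennreal (\<Sum>k\<le>N. h k)" by (rule cost)
        also have "\<dots> \<le> (SUP n. ?M (A n)) + ennreal e"
          by (intro add_mono SUP_upper ennreal_leI hs) auto
        finally show "emeasure m (B N) \<le> (SUP n. ?M (A n)) + ennreal e" .
      qed
      finally have "emeasure m \<E> \<le> (SUP n. ?M (A n)) + ennreal e" .
      moreover have "?M (\<Union>n. A n) \<le> emeasure m \<E>"
      proof (rule family_content_le)
        show "\<E> \<subseteq> \<Q>" using C(1) by (auto simp: \<E>_def max_members_def)
        have "\<Union>\<E> = \<Union>(\<Union>k. \<C> k)" unfolding \<E>_def using C(1) by (intro Union_max_members) auto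
        moreover have "A n \<subseteq> \<Union>(\<Union>k. \<C> k)" for n
          by (rule subset_trans[OF C(2)]) auto
        ultimately show "(\<Union>n. A n) \<subseteq> \<Union>\<E>" by (metis UN_least)
      qed
      ultimately show "?M (\<Union>n. A n) \<le> (SUP n. ?M (A n)) + ennreal e" by (rule order_trans[rotated])
    qed
  qed
qed

end

section \<open>Dyadic cells\<close>

definition dyadic_index :: "nat \<Rightarrow> 'a::euclidean_space \<Rightarrow> 'a \<Rightarrow> int" where
  "dyadic_index k x b = \<lfloor>2 ^ k * (x \<bullet> b)\<rfloor>"

text \<open>Half-open cubes of side \<open>1 / 2 ^ k\<close>, named by any of their points rather
  than by an index vector: they are never empty, and the ancestors of a cell are the coarser cells
  at the same point. Since \<open>k\<close> is a natural number, no cell is larger than a unit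
  cube.\<close>

definition dyadic_cell :: "nat \<Rightarrow> 'a::euclidean_space \<Rightarrow> 'a set" where
  "dyadic_cell k x = {y. \<forall>b\<in>Basis. dyadic_index k y b = dyadic_index k x b}"

lemma dyadic_cell_self[simp, intro]: "x \<in> dyadic_cell k x"
  by (simp add: dyadic_cell_def)

lemma dyadic_cell_eq: "y \<in> dyadic_cell k x \<Longrightarrow> dyadic_cell k y = dyadic_cell k x"
  by (auto simp: dyadic_cell_def)

lemma dyadic_index_Suc: "dyadic_index k x b = dyadic_index (Suc k) x b div 2"
proof -
  have "dyadic_index k x b = \<lfloor>(2 ^ Suc k * (x \<bullet> b)) / real_of_int 2\<rfloor>"
    by (simp add: dyadic_index_def)
  also have "\<dots> = dyadic_index (Suc k) x b div 2"
    unfolding dyadic_index_def by (rule floor_divide_real_eq_div) simp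
  finally show ?thesis .
qed

lemma dyadic_cell_antimono: "j \<le> k \<Longrightarrow> dyadic_cell k x \<subseteq> dyadic_cell j x"
proof (induction k rule: dec_induct)
  case (step k)
  have "dyadic_cell (Suc k) x \<subseteq> dyadic_cell k x"
    by (auto simp: dyadic_cell_def dyadic_index_Suc[of k])
  with step show ?case by blast
qed simp

lemma dyadic_index_close:
  assumes "\<bar>(x - y) \<bullet> b\<bar> \<le> real m / 2 ^ k"
  shows "\<bar>dyadic_index k x b - dyadic_index k y b\<bar> \<le> int m + 1"
proof -
  have "\<bar>2 ^ k * (x \<bullet> b) - 2 ^ k * (y \<bullet> b)\<bar> = 2 ^ k * \<bar>(x - y) \<bullet> b\<bar>"
    by (simp add: abs_mult inner_diff_left flip: right_diff_distrib)
  also have "\<dots> \<le> m" using assms by (simp add: field_simps)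
  finally show ?thesis unfolding dyadic_index_def by linarith
qed

lemma dyadic_cell_coordinate:
  assumes "y \<in> dyadic_cell k x" "b \<in> Basis"
  shows "\<bar>(y - x) \<bullet> b\<bar> \<le> 1 / 2 ^ k"
proof -
  have "\<lfloor>2 ^ k * (y \<bullet> b)\<rfloor> = \<lfloor>2 ^ k * (x \<bullet> b)\<rfloor>"
    using assms by (auto simp: dyadic_cell_def dyadic_index_def)
  then have "\<bar>2 ^ k * (y \<bullet> b) - 2 ^ k * (x \<bullet> b)\<bar> \<le> 1" by linarith
  then have "2 ^ k * \<bar>(y - x) \<bullet> b\<bar> \<le> 1"
    by (simp add: abs_mult inner_diff_left flip: right_diff_distrib)
  then show ?thesis by (simp add: field_simps)
qed

lemma dyadic_cell_dist:
  fixes x :: "'a::euclidean_space"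
  assumes "y \<in> dyadic_cell k x" "z \<in> dyadic_cell k x"
  shows "dist y z \<le> real DIM('a) / 2 ^ k"
proof -
  have "z \<in> dyadic_cell k y" using assms dyadic_cell_eq by blast
  then have "dist z y \<le> (\<Sum>b\<in>(Basis::'a set). 1 / 2 ^ k)"
    unfolding dist_norm
    by (intro order_trans[OF norm_le_l1] sum_mono dyadic_cell_coordinate)
  then show ?thesis by (simp add: dist_commute)
qed

lemma bounded_dyadic_cell: "bounded (dyadic_cell k x)"
  unfolding bounded_def using dyadic_cell_dist dyadic_cell_self by blast

lemma diameter_dyadic_cell_le:
  "diameter (dyadic_cell k (x::'a::euclidean_space)) \<le> real DIM('a) / 2 ^ k"
  by (rule diameter_le) (use dyadic_cell_dist[of _ k x] dyadic_cell_self in \<open>auto simp: dist_norm\<close>)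

text \<open>The lower bound comes from the midpoint and the lower endpoint of a cell along one axis.\<close>

lemma diameter_dyadic_cell_ge:
  "1 / 2 ^ Suc k \<le> diameter (dyadic_cell k (x::'a::euclidean_space))"
proof -
  obtain b0 :: 'a where b0: "b0 \<in> Basis" using nonempty_Basis by blast
  define p where "p = (\<Sum>b\<in>Basis. (of_int (dyadic_index k x b) / 2 ^ k) *\<^sub>R b)"
  define q where "q = p + (1 / 2 ^ Suc k) *\<^sub>R b0"
  have pb: "p \<bullet> b = of_int (dyadic_index k x b) / 2 ^ k" if "b \<in> Basis" for b
    using that by (simp add: p_def)
  have "p \<in> dyadic_cell k x"
    by (auto simp: dyadic_cell_def dyadic_index_def[of k p] pb)
  moreover have "q \<in> dyadic_cell k x"
    unfolding dyadic_cell_def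
  proof safe
    fix b :: 'a assume b: "b \<in> Basis"
    have "2 ^ k * (q \<bullet> b) = of_int (dyadic_index k x b) + (if b = b0 then 1 / 2 else 0)"
      using b b0 by (auto simp: q_def inner_add_left pb inner_Basis algebra_simps)
    also have "\<lfloor>\<dots>\<rfloor> = dyadic_index k x b" by (auto simp: floor_eq_iff)
    finally show "dyadic_index k q b = dyadic_index k x b" by (simp add: dyadic_index_def)
  qed
  ultimately have "dist q p \<le> diameter (dyadic_cell k x)"
    by (intro diameter_bounded_bound bounded_dyadic_cell)
  moreover have "dist q p = 1 / 2 ^ Suc k" using b0 by (simp add: q_def dist_norm)
  ultimately show ?thesis by simp
qed

text \<open>A cubical block of cells of one generation, standing in for a ball around
  \<open>x\<close>: a ball of radius \<open>m / 2 ^ k\<close> meets a number of cells that is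
  bounded in terms of \<open>m\<close> and the dimension alone.\<close>

definition near_cells :: "nat \<Rightarrow> nat \<Rightarrow> 'a::euclidean_space \<Rightarrow> 'a set set" where
  "near_cells m k x = dyadic_cell k ` {y. \<forall>b\<in>Basis. \<bar>dyadic_index k y b - dyadic_index k x b\<bar> \<le> int m}"

lemma near_cells_card:
  fixes x :: "'a::euclidean_space"
  shows "finite (near_cells m k x)" "card (near_cells m k x) \<le> (2 * m + 1) ^ DIM('a)"
proof -
  define I where "I b = {dyadic_index k x b - int m .. dyadic_index k x b + int m}" for b
  define f where "f i = {y::'a. \<forall>b\<in>Basis. dyadic_index k y b = i b}" for i
  have fin: "finite (Pi\<^sub>E (Basis::'a set) I)" by (intro finite_PiE) (auto simp: I_def)
  have sub: "near_cells m k x \<subseteq> f ` Pi\<^sub>E Basis I"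
  proof
    fix Q assume "Q \<in> near_cells m k x"
    then obtain y where y: "Q = dyadic_cell k y" "\<And>b. b \<in> Basis \<Longrightarrow> \<bar>dyadic_index k y b - dyadic_index k x b\<bar> \<le> int m"
      by (auto simp: near_cells_def)
    have "Q = f (restrict (dyadic_index k y) Basis)" by (auto simp: y f_def dyadic_cell_def)
    moreover have "restrict (dyadic_index k y) Basis \<in> Pi\<^sub>E Basis I"
      using y(2) by (force simp: I_def abs_le_iff)
    ultimately show "Q \<in> f ` Pi\<^sub>E Basis I" by blast
  qed
  show "finite (near_cells m k x)" using sub fin by (meson finite_imageI finite_subset)
  have "card (near_cells m k x) \<le> card (Pi\<^sub>E (Basis::'a set) I)"
    using sub fin by (meson card_image_le card_mono finite_imageI order_trans)
  also have "\<dots> = (\<Prod>b\<in>(Basis::'a set). card (I b))" by (simp add: card_PiE)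
  also have "(\<lambda>b. card (I b)) = (\<lambda>b. 2 * m + 1)"
    unfolding I_def card_atLeastAtMost_int by (rule ext) arith
  finally show "card (near_cells m k x) \<le> (2 * m + 1) ^ DIM('a)" by simp
qed

lemma near_cells_dist:
  assumes "dist y x \<le> real m / 2 ^ k"
  shows "dyadic_cell k y \<in> near_cells (m + 1) k x"
proof -
  have "\<bar>dyadic_index k y b - dyadic_index k x b\<bar> \<le> int m + 1" if "b \<in> Basis" for b
  proof (rule dyadic_index_close)
    show "\<bar>(y - x) \<bullet> b\<bar> \<le> real m / 2 ^ k"
      using assms Basis_le_norm[OF that, of "y - x"] by (simp add: dist_norm)
  qed
  then show ?thesis unfolding near_cells_def by (intro imageI) (simp add: add.commute)
qed

definition dyadic_cells :: "'a::euclidean_space set set" where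
  "dyadic_cells = {dyadic_cell k x |k x. True}"

lemma dyadic_cell_in_cells[simp, intro]: "dyadic_cell k x \<in> dyadic_cells"
  by (auto simp: dyadic_cells_def)

lemma near_cells_subset: "near_cells m k x \<subseteq> dyadic_cells"
  by (auto simp: near_cells_def)

lemma dyadic_cells_laminar:
  assumes "P \<in> dyadic_cells" "Q \<in> dyadic_cells" "P \<inter> Q \<noteq> {}"
  shows "P \<subseteq> Q \<or> Q \<subseteq> P"
proof -
  obtain j x where "P = dyadic_cell j x" using assms(1) by (auto simp: dyadic_cells_def)
  moreover obtain k y where "Q = dyadic_cell k y" using assms(2) by (auto simp: dyadic_cells_def)
  moreover obtain z where "z \<in> P" "z \<in> Q" using assms(3) by blast
  ultimately have "P = dyadic_cell j z" "Q = dyadic_cell k z" using dyadic_cell_eq by blast+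
  then show ?thesis using dyadic_cell_antimono nat_le_linear by metis
qed

text \<open>A cell above \<open>Q\<close> contains the base point of \<open>Q\<close>, so its level
  determines it; comparing diameters bounds the level.\<close>

lemma dyadic_cells_finite_above:
  assumes "Q \<in> dyadic_cells"
  shows "finite {P \<in> dyadic_cells. Q \<subseteq> (P :: 'a::euclidean_space set)}"
proof -
  obtain k x where Q: "Q = dyadic_cell k x" using assms by (auto simp: dyadic_cells_def)
  obtain N where N: "real DIM('a) * 2 ^ Suc k < 2 ^ N"
    using real_arch_pow[of 2] by auto
  have "{P \<in> dyadic_cells. Q \<subseteq> P} \<subseteq> (\<lambda>j. dyadic_cell j x) ` {..N}"
  proof safe
    fix P assume "P \<in> dyadic_cells" "Q \<subseteq> P"
    then obtain j where P: "P = dyadic_cell j x"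
      unfolding Q dyadic_cells_def using dyadic_cell_eq dyadic_cell_self by blast
    have "1 / 2 ^ Suc k \<le> diameter Q" unfolding Q by (rule diameter_dyadic_cell_ge)
    also have "\<dots> \<le> diameter P" using \<open>Q \<subseteq> P\<close> bounded_dyadic_cell unfolding P by (rule diameter_subset)
    also have "\<dots> \<le> real DIM('a) / 2 ^ j" unfolding P by (rule diameter_dyadic_cell_le)
    finally have "2 ^ j \<le> real DIM('a) * 2 ^ Suc k" by (simp add: field_simps)
    also note N
    finally have "j < N" by simp
    then show "P \<in> (\<lambda>j. dyadic_cell j x) ` {..N}" unfolding P by auto
  qed
  then show ?thesis by (rule finite_subset) simp
qed

lemma countable_dyadic_cells: "countable (dyadic_cells :: 'a::euclidean_space set set)"
proof -
  define f where "f k i = {y::'a. \<forall>b\<in>Basis. dyadic_index k y b = i b}" for k i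
  have "dyadic_cells \<subseteq> (\<Union>k. f k ` (Basis \<rightarrow>\<^sub>E UNIV))"
  proof
    fix Q :: "'a set" assume "Q \<in> dyadic_cells"
    then obtain k x where "Q = dyadic_cell k x" by (auto simp: dyadic_cells_def)
    then have "Q = f k (restrict (dyadic_index k x) Basis)" by (auto simp: f_def dyadic_cell_def)
    moreover have "restrict (dyadic_index k x) Basis \<in> (Basis \<rightarrow>\<^sub>E UNIV)" by simp
    ultimately have "Q \<in> f k ` (Basis \<rightarrow>\<^sub>E UNIV)" by (rule image_eqI)
    then show "Q \<in> (\<Union>k. f k ` (Basis \<rightarrow>\<^sub>E UNIV))" by (rule UN_I[OF UNIV_I])
  qed
  moreover have "countable (\<Union>k. f k ` (Basis \<rightarrow>\<^sub>E UNIV))"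
    by (intro countable_UN countable_image countable_PiE) auto
  ultimately show ?thesis by (rule countable_subset)
qed

section \<open>Dyadic Hausdorff content\<close>

definition dyadic_cost :: "real \<Rightarrow> 'a::euclidean_space set measure" where
  "dyadic_cost s = density (count_space UNIV) (\<lambda>Q. ennreal (diameter Q powr s))"

lemma sets_dyadic_cost[simp]: "sets (dyadic_cost s) = UNIV"
  by (simp add: dyadic_cost_def)

interpretation dyadic: laminar_family "dyadic_cells :: 'a::euclidean_space set set" "dyadic_cost s"
  by standard (rule dyadic_cells_laminar dyadic_cells_finite_above sets_dyadic_cost; assumption)+

abbreviation dyadic_content :: "real \<Rightarrow> 'a::euclidean_space set \<Rightarrow> ennreal" where
  "dyadic_content s \<equiv> family_content dyadic_cells (dyadic_cost s)"

lemma emeasure_dyadic_cost: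
  "emeasure (dyadic_cost s) \<C> = (\<integral>\<^sup>+Q\<in>\<C>. ennreal (diameter Q powr s) \<partial>count_space UNIV)"
  by (simp add: dyadic_cost_def emeasure_density)

lemma emeasure_dyadic_cost_finite:
  "finite \<C> \<Longrightarrow> emeasure (dyadic_cost s) \<C> = (\<Sum>Q\<in>\<C>. ennreal (diameter Q powr s))"
  by (simp add: emeasure_dyadic_cost nn_integral_count_space_indicator[symmetric]
      nn_integral_count_space_finite)

lemma diameter_cell_powr_le:
  assumes "s \<ge> 0"
  shows "diameter (dyadic_cell k (x::'a::euclidean_space)) powr s \<le> real DIM('a) powr s * (1 / 2 ^ k) powr s"
proof -
  have "diameter (dyadic_cell k x) powr s \<le> (real DIM('a) / 2 ^ k) powr s"
    using diameter_dyadic_cell_le assms bounded_dyadic_cell by (intro powr_mono2 diameter_ge_0) auto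
  also have "\<dots> = real DIM('a) powr s * (1 / 2 ^ k) powr s"
    by (subst powr_mult[symmetric]) auto
  finally show ?thesis .
qed

text \<open>The cell covers its own intersection with \<open>A\<close>. This simple bound is where
  the exponent of the Frostman measure comes from.\<close>

lemma dyadic_content_cell_le:
  assumes "s \<ge> 0"
  shows "dyadic_content s (A \<inter> dyadic_cell k (x::'a::euclidean_space)) \<le> ennreal (real DIM('a) powr s * (1 / 2 ^ k) powr s)"
proof -
  have "dyadic_content s (A \<inter> dyadic_cell k x) \<le> emeasure (dyadic_cost s) {dyadic_cell k x}"
    by (intro family_content_le) auto
  also have "\<dots> = ennreal (diameter (dyadic_cell k x) powr s)"
    by (simp add: emeasure_dyadic_cost_finite)
  also have "\<dots> \<le> ennreal (real DIM('a) powr s * (1 / 2 ^ k) powr s)"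
    using assms by (intro ennreal_leI diameter_cell_powr_le)
  finally show ?thesis .
qed

text \<open>A cover by half-open cells is turned into a cover by open sets at the cost of a constant
  factor: replace each cell by its neighbours.\<close>

lemma dyadic_content_zero_open:
  fixes K :: "'a::euclidean_space set"
  assumes s: "s > 0" and zero: "dyadic_content s K = 0" and t: "t > 0"
  obtains U where "open U" "K \<subseteq> U" "dyadic_content s U \<le> ennreal t"
proof -
  \<comment> \<open>Each cell is replaced by at most \<open>5 ^ DIM('a)\<close> neighbours (index
    distance at most 2), each of diameter at most \<open>2 * DIM('a)\<close> times that of the
    original cell.\<close>
  define c where "c = real (5 ^ DIM('a)) * ((2 * real DIM('a)) powr s)"
  have c: "c > 0" by (auto simp: c_def)
  have "\<exists>\<C>. \<C> \<subseteq> dyadic_cells \<and> K \<subseteq> \<Union>\<C> \<and> emeasure (dyadic_cost s) \<C> \<le> dyadic_content s K + ennreal (t / c)"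
    using zero t c by (intro family_content_approx) auto
  then obtain \<C> where C: "\<C> \<subseteq> dyadic_cells" "K \<subseteq> \<Union>\<C>" "emeasure (dyadic_cost s) \<C> \<le> ennreal (t / c)"
    using zero by auto
  have "\<forall>Q\<in>\<C>. \<exists>k x. Q = dyadic_cell k x" using C(1) by (auto simp: dyadic_cells_def)
  then obtain k x where kx: "\<And>Q. Q \<in> \<C> \<Longrightarrow> Q = dyadic_cell (k Q) (x Q)" by metis
  define \<N> where "\<N> Q = near_cells 2 (k Q) (x Q)" for Q
  define U where "U = (\<Union>Q\<in>\<C>. \<Union>y\<in>Q. ball y (1 / 2 ^ k Q))"
  have "open U" by (auto simp: U_def)
  moreover have "K \<subseteq> U"
  proof
    fix y assume "y \<in> K"
    then obtain Q where "Q \<in> \<C>" "y \<in> Q" using C by blast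
    then show "y \<in> U" by (auto simp: U_def intro!: bexI[of _ Q] bexI[of _ y])
  qed
  moreover have "dyadic_content s U \<le> ennreal t"
  proof -
    have "U \<subseteq> \<Union>(\<Union>Q\<in>\<C>. \<N> Q)"
    proof
      fix z assume "z \<in> U"
      then obtain Q y where Q: "Q \<in> \<C>" "y \<in> Q" "dist y z < 1 / 2 ^ k Q" by (auto simp: U_def)
      have "dyadic_cell (k Q) z \<in> near_cells (1 + 1) (k Q) y"
        using Q(3) by (intro near_cells_dist) (auto simp: dist_commute)
      moreover have "near_cells (1 + 1) (k Q) y = near_cells (1 + 1) (k Q) (x Q)"
      proof -
        have "dyadic_index (k Q) y b = dyadic_index (k Q) (x Q) b" if "b \<in> Basis" for b
          using Q(2) kx[OF Q(1)] that unfolding dyadic_cell_def by blast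
        then show ?thesis by (simp add: near_cells_def)
      qed
      ultimately have "dyadic_cell (k Q) z \<in> \<N> Q" by (simp add: \<N>_def numeral_2_eq_2)
      then show "z \<in> \<Union>(\<Union>Q\<in>\<C>. \<N> Q)" using Q(1) dyadic_cell_self by blast
    qed
    then have "dyadic_content s U \<le> emeasure (dyadic_cost s) (\<Union>Q\<in>\<C>. \<N> Q)"
      unfolding \<N>_def by (intro family_content_le UN_least near_cells_subset)
    also have "\<dots> = (\<integral>\<^sup>+P. ennreal (diameter P powr s) * indicator (\<Union>Q\<in>\<C>. \<N> Q) P \<partial>count_space UNIV)"
      by (simp add: emeasure_dyadic_cost)
    \<comment> \<open>A neighbour shared by several cells is counted once for each of them, which
      turns the sum over a union into a double sum; the order of summation is then
      exchanged.\<close>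
    also have "\<dots> \<le> (\<integral>\<^sup>+P. (\<integral>\<^sup>+Q. ennreal (diameter P powr s) * indicator (\<N> Q) P * indicator \<C> Q \<partial>count_space UNIV) \<partial>count_space UNIV)"
    proof (intro nn_integral_mono)
      fix P :: "'a set"
      show "ennreal (diameter P powr s) * indicator (\<Union>Q\<in>\<C>. \<N> Q) P \<le>
        (\<integral>\<^sup>+Q. ennreal (diameter P powr s) * indicator (\<N> Q) P * indicator \<C> Q \<partial>count_space UNIV)"
      proof (cases "P \<in> (\<Union>Q\<in>\<C>. \<N> Q)")
        case True
        then obtain Q where Q: "Q \<in> \<C>" "P \<in> \<N> Q" by auto
        have "ennreal (diameter P powr s) * indicator (\<Union>Q\<in>\<C>. \<N> Q) P =
          ennreal (diameter P powr s) * indicator (\<N> Q) P * indicator \<C> Q"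
          using Q True by simp
        also have "\<dots> \<le> (\<integral>\<^sup>+Q. ennreal (diameter P powr s) * indicator (\<N> Q) P * indicator \<C> Q \<partial>count_space UNIV)"
          by (rule nn_integral_ge_point) simp
        finally show ?thesis .
      qed simp
    qed
    also have "\<dots> = (\<integral>\<^sup>+Q. (\<integral>\<^sup>+P. ennreal (diameter P powr s) * indicator (\<N> Q) P * indicator \<C> Q \<partial>count_space UNIV) \<partial>count_space UNIV)"
      using nn_integral_fst_count_space[of "\<lambda>(P, Q). ennreal (diameter P powr s) * indicator (\<N> Q) P * indicator \<C> Q"]
        nn_integral_snd_count_space[of "\<lambda>(P, Q). ennreal (diameter P powr s) * indicator (\<N> Q) P * indicator \<C> Q"]
      by simp
    also have "\<dots> \<le> (\<integral>\<^sup>+Q. ennreal c * (ennreal (diameter Q powr s) * indicator \<C> Q) \<partial>count_space UNIV)"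
    proof (intro nn_integral_mono)
      fix Q :: "'a set"
      show "(\<integral>\<^sup>+P. ennreal (diameter P powr s) * indicator (\<N> Q) P * indicator \<C> Q \<partial>count_space UNIV)
        \<le> ennreal c * (ennreal (diameter Q powr s) * indicator \<C> Q)"
      proof (cases "Q \<in> \<C>")
        case True
        have fin: "finite (\<N> Q)" and card: "card (\<N> Q) \<le> 5 ^ DIM('a)"
          using near_cells_card[of 2 "k Q" "x Q"] by (auto simp: \<N>_def)
        have "(\<integral>\<^sup>+P. ennreal (diameter P powr s) * indicator (\<N> Q) P * indicator \<C> Q \<partial>count_space UNIV)
           = (\<Sum>P\<in>\<N> Q. ennreal (diameter P powr s))"
          using True fin by (simp add: nn_integral_count_space_indicator[symmetric]
            nn_integral_count_space_finite)
        also have "\<dots> \<le> (\<Sum>P\<in>\<N> Q. ennreal ((2 * real DIM('a)) powr s * diameter Q powr s))"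
        proof (intro sum_mono ennreal_leI)
          fix P assume "P \<in> \<N> Q"
          then obtain y where "P = dyadic_cell (k Q) y" by (auto simp: \<N>_def near_cells_def)
          then have "diameter P \<le> real DIM('a) / 2 ^ k Q" using diameter_dyadic_cell_le by blast
          also have "\<dots> = 2 * real DIM('a) * (1 / 2 ^ Suc (k Q))" by simp
          also have "\<dots> \<le> 2 * real DIM('a) * diameter Q"
            using diameter_dyadic_cell_ge[of "k Q" "x Q"] kx[OF True] by (intro mult_left_mono) auto
          finally have "diameter P powr s \<le> (2 * real DIM('a) * diameter Q) powr s"
            using s \<open>P = _\<close> by (intro powr_mono2 diameter_ge_0) (auto simp: bounded_dyadic_cell)
          also have "\<dots> = (2 * real DIM('a)) powr s * diameter Q powr s"
            using kx[OF True] bounded_dyadic_cell by (intro powr_mult) 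
          finally show "diameter P powr s \<le> (2 * real DIM('a)) powr s * diameter Q powr s" .
        qed
        also have "\<dots> = ennreal (real (card (\<N> Q)) * ((2 * real DIM('a)) powr s * diameter Q powr s))"
          by (simp add: ennreal_mult ennreal_of_nat_eq_real_of_nat)
        also have "\<dots> \<le> ennreal (real (5 ^ DIM('a)) * ((2 * real DIM('a)) powr s * diameter Q powr s))"
          using card by (intro ennreal_leI mult_right_mono of_nat_mono) auto
        also have "\<dots> = ennreal c * ennreal (diameter Q powr s)"
          using c by (simp add: c_def ennreal_mult'' mult.assoc)
        finally show ?thesis using True by simp
      qed simp
    qed
    also have "\<dots> = ennreal c * emeasure (dyadic_cost s) \<C>"
      by (simp add: nn_integral_cmult emeasure_dyadic_cost)
    also have "\<dots> \<le> ennreal c * ennreal (t / c)" by (intro mult_left_mono C) auto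
    also have "\<dots> = ennreal t" using c t by (simp flip: ennreal_mult)
    finally show ?thesis .
  qed
  ultimately show thesis by (rule that)
qed

text \<open>The content imposes no small scale on the cells, but a cover of small cost consists of
  small cells: as \<open>s > 0\<close>, each diameter is controlled by its own cost.\<close>

lemma hausdorff_measure_zero_if_dyadic_content_zero:
  fixes A :: "'a::euclidean_space set"
  assumes s: "s > 0" and zero: "dyadic_content s A = 0"
  shows "hausdorff_measure s A = 0"
proof -
  have "hausdorff_premeasure s \<delta> A \<le> ennreal e" if \<delta>: "\<delta> > 0" and e: "e > 0" for \<delta> e :: real
  proof -
    \<comment> \<open>The second term of the minimum forces every cell of the cover to have diameter
      at most \<open>\<delta>\<close>.\<close>
    define e' where "e' = min e (\<delta> powr s)"
    have e': "e' > 0" using e \<delta> by (simp add: e'_def)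
    have "\<exists>\<C>. \<C> \<subseteq> dyadic_cells \<and> A \<subseteq> \<Union>\<C> \<and> emeasure (dyadic_cost s) \<C> \<le> dyadic_content s A + ennreal e'"
      using zero e' by (intro family_content_approx) auto
    then obtain \<C> where C: "\<C> \<subseteq> dyadic_cells" "A \<subseteq> \<Union>\<C>" "emeasure (dyadic_cost s) \<C> \<le> ennreal e'"
      using zero by auto
    have diam: "diameter Q \<le> \<delta>" if "Q \<in> \<C>" for Q
    proof (rule ccontr)
      assume "\<not> ?thesis"
      then have "\<delta> powr s < diameter Q powr s" using s \<delta> by (intro powr_less_mono2) auto
      have "ennreal (diameter Q powr s) = emeasure (dyadic_cost s) {Q}"
        by (simp add: emeasure_dyadic_cost_finite)
      also have "\<dots> \<le> emeasure (dyadic_cost s) \<C>" using that by (intro emeasure_mono) auto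
      also note C(3)
      finally have "diameter Q powr s \<le> e'" using e' by simp
      then show False using \<open>\<delta> powr s < diameter Q powr s\<close> by (simp add: e'_def)
    qed
    have cnt: "countable \<C>" using C(1) countable_dyadic_cells by (rule countable_subset)
    define U where "U i = (if i \<in> to_nat_on \<C> ` \<C> then from_nat_into \<C> i else {})" for i
    have U_in: "U i \<in> \<C> \<or> U i = {}" for i using cnt by (auto simp: U_def)
    have "hausdorff_premeasure s \<delta> A \<le> (\<Sum>i. diam_powr s (U i))"
      unfolding hausdorff_premeasure_def
    proof (rule INF_lower, intro CollectI conjI allI)
      show "A \<subseteq> (\<Union>i. U i)"
      proof
        fix x assume "x \<in> A"
        then obtain Q where "Q \<in> \<C>" "x \<in> Q" using C by blast
        then have "x \<in> U (to_nat_on \<C> Q)" using cnt by (simp add: U_def)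
        then show "x \<in> (\<Union>i. U i)" by blast
      qed
      fix i
      show "bounded (U i)"
        using U_in[of i] C(1) by (auto simp: dyadic_cells_def bounded_dyadic_cell)
      show "diameter (U i) \<le> \<delta>"
        using U_in[of i] diam \<delta> by (auto simp: diameter_empty)
    qed
    also have "\<dots> = (\<integral>\<^sup>+i. diam_powr s (U i) \<partial>count_space UNIV)"
      by (simp add: nn_integral_count_space_nat)
    also have "\<dots> = (\<integral>\<^sup>+i. ennreal (diameter (from_nat_into \<C> i) powr s) * indicator (to_nat_on \<C> ` \<C>) i \<partial>count_space UNIV)"
    proof (intro nn_integral_cong)
      fix i
      have "Q \<noteq> {}" if "Q \<in> \<C>" for Q
        using that C(1) dyadic_cell_self by (force simp: dyadic_cells_def)
      then show "diam_powr s (U i) = ennreal (diameter (from_nat_into \<C> i) powr s) * indicator (to_nat_on \<C> ` \<C>) i"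
        using s cnt by (auto simp: U_def diam_powr_def)
    qed
    also have "\<dots> = (\<integral>\<^sup>+i. ennreal (diameter (from_nat_into \<C> i) powr s) \<partial>count_space (to_nat_on \<C> ` \<C>))"
      by (simp add: nn_integral_count_space_indicator)
    also have "\<dots> = (\<integral>\<^sup>+Q. ennreal (diameter (from_nat_into \<C> (to_nat_on \<C> Q)) powr s) \<partial>count_space \<C>)"
      by (rule nn_integral_bij_count_space[symmetric]) (use cnt in \<open>auto simp: bij_betw_def\<close>)
    also have "\<dots> = (\<integral>\<^sup>+Q. ennreal (diameter Q powr s) \<partial>count_space \<C>)"
      using cnt by (intro nn_integral_cong) simp
    also have "\<dots> = emeasure (dyadic_cost s) \<C>"
      by (simp add: emeasure_dyadic_cost nn_integral_count_space_indicator)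
    also have "\<dots> \<le> ennreal e"
      using C(3) by (rule order_trans) (auto simp: e'_def intro!: ennreal_leI)
    finally show ?thesis .
  qed
  then have "hausdorff_premeasure s \<delta> A = 0" if "\<delta> > 0" for \<delta>
    using that by (metis add.left_neutral ennreal_le_epsilon le_zero_eq)
  then show ?thesis by (auto simp: hausdorff_measure_def)
qed

section \<open>Capacitability of continuous images of Borel sets\<close>

text \<open>Projections of closed sets along the Baire space include the closed sets and the open
  sets (countable unions of closed ones), and they are stable under countable unions and
  intersections. They need not be stable under complements, so the induction over the Borel sets
  carries a set together with its complement.\<close>

lemma Borel_projection_closed:
  fixes B :: "'a::metric_space set"
  assumes "B \<in> sets borel"
  obtains F :: "('a \<times> (nat \<Rightarrow> nat)) set" where "closed F" "B = fst ` F"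
proof -
  define Sou where "Sou B \<longleftrightarrow> (\<exists>F :: ('a \<times> (nat \<Rightarrow> nat)) set. closed F \<and> B = fst ` F)" for B :: "'a set"
  have cont_comp: "continuous_on UNIV (\<lambda>p::'a \<times> (nat \<Rightarrow> nat). (fst p, \<lambda>i. snd p (h i)))" for h :: "nat \<Rightarrow> nat"
    by (intro continuous_on_Pair continuous_on_fst continuous_on_id continuous_on_coordinatewise_then_product
        continuous_on_product_then_coordinatewise[OF continuous_on_snd])
  have closedS: "Sou C" if "closed C" for C
    unfolding Sou_def by (rule exI[of _ "C \<times> UNIV"]) (auto intro: closed_Times that)
  have UN: "Sou (\<Union>n. B n)" if S: "\<And>n::nat. Sou (B n)" for B
  proof -
    from S have "\<forall>n. \<exists>F :: ('a \<times> (nat \<Rightarrow> nat)) set. closed F \<and> B n = fst ` F" unfolding Sou_def by blast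
    from choice[OF this] obtain F :: "nat \<Rightarrow> ('a \<times> (nat \<Rightarrow> nat)) set"
      where F: "\<And>n. closed (F n)" "\<And>n. B n = fst ` F n" by blast
    \<comment> \<open>The first entry of the code selects the set \<open>F n\<close>, and the
      shifted remainder is the code used there.\<close>
    define G where "G = {p::'a \<times> (nat \<Rightarrow> nat). (fst p, \<lambda>i. snd p (Suc i)) \<in> F (snd p 0)}"
    have "- G = (\<Union>n. ((\<lambda>p. snd p 0) -` {n}) \<inter> ((\<lambda>p. (fst p, \<lambda>i. snd p (Suc i))) -` (- F n)))"
      by (auto simp: G_def)
    moreover have "open (\<Union>n. ((\<lambda>p::'a \<times> (nat \<Rightarrow> nat). snd p 0) -` {n}) \<inter> ((\<lambda>p. (fst p, \<lambda>i. snd p (Suc i))) -` (- F n)))"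
    proof (intro open_UN ballI open_Int)
      fix n
      show "open ((\<lambda>p::'a \<times> (nat \<Rightarrow> nat). snd p 0) -` {n})"
        by (intro open_vimage discrete_topology_class.open_discrete continuous_on_product_then_coordinatewise[OF continuous_on_snd] continuous_on_id)
      show "open ((\<lambda>p. (fst p, \<lambda>i. snd p (Suc i))) -` (- F n))"
        using F by (intro open_vimage cont_comp) (auto simp: open_closed)
    qed
    ultimately have "closed G" by (simp add: closed_def)
    moreover have "(\<Union>n. B n) = fst ` G"
    proof (rule antisym)
      show "(\<Union>n. B n) \<subseteq> fst ` G"
      proof
        fix x assume "x \<in> (\<Union>n. B n)"
        then obtain n \<sigma> where "(x, \<sigma>) \<in> F n" using F(2) by auto
        then have "(x, case_nat n \<sigma>) \<in> G" by (simp add: G_def)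
        then show "x \<in> fst ` G" by force
      qed
      show "fst ` G \<subseteq> (\<Union>n. B n)"
        using F(2) by (force simp: G_def)
    qed
    ultimately show ?thesis unfolding Sou_def by blast
  qed
  have INT: "Sou (\<Inter>n. B n)" if S: "\<And>n::nat. Sou (B n)" for B
  proof -
    from S have "\<forall>n. \<exists>F :: ('a \<times> (nat \<Rightarrow> nat)) set. closed F \<and> B n = fst ` F" unfolding Sou_def by blast
    from choice[OF this] obtain F :: "nat \<Rightarrow> ('a \<times> (nat \<Rightarrow> nat)) set"
      where F: "\<And>n. closed (F n)" "\<And>n. B n = fst ` F n" by blast
    \<comment> \<open>One code is split by the pairing function into infinitely many, the
      \<open>n\<close>-th of which witnesses membership in \<open>F n\<close>.\<close>
    define G where "G = (\<Inter>n. (\<lambda>p::'a \<times> (nat \<Rightarrow> nat). (fst p, \<lambda>i. snd p (prod_encode (n, i)))) -` F n)"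
    have "closed G"
      unfolding G_def using F by (intro closed_INT ballI closed_vimage cont_comp) auto
    moreover have "(\<Inter>n. B n) = fst ` G"
    proof (rule antisym)
      show "(\<Inter>n. B n) \<subseteq> fst ` G"
      proof
        fix x assume "x \<in> (\<Inter>n. B n)"
        then have "x \<in> fst ` F n" for n using F(2) by auto
        then have "\<forall>n. \<exists>\<sigma>. (x, \<sigma>) \<in> F n" by (metis (no_types) imageE prod.collapse)
        then obtain \<sigma> where s: "\<And>n. (x, \<sigma> n) \<in> F n" by metis
        define \<tau> where "\<tau> k = (case prod_decode k of (n, i) \<Rightarrow> \<sigma> n i)" for k
        have "(x, \<tau>) \<in> G" using s by (simp add: G_def \<tau>_def)
        then show "x \<in> fst ` G" by force
      qed
      show "fst ` G \<subseteq> (\<Inter>n. B n)"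
        using F(2) by (force simp: G_def)
    qed
    ultimately show ?thesis unfolding Sou_def by blast
  qed
  have openS: "Sou U" if U: "open U" for U
  proof -
    have "fsigma_in euclidean U"
      using U by (intro open_imp_fsigma_in metrizable_space_euclidean) auto
    then obtain C :: "nat \<Rightarrow> 'a set" where "\<And>n. closed (C n)" "U = (\<Union>n. C n)"
      unfolding fsigma_in_ascending by auto
    then show ?thesis using UN closedS by metis
  qed
  have "B \<in> sigma_sets UNIV {S::'a set. open S}" using assms by (simp add: borel_def)
  then have "Sou B \<and> Sou (- B)"
  proof induction
    case (Basic a)
    then show ?case using openS closedS by (auto simp: closed_def)
  next
    case Empty
    then show ?case using openS closedS by (metis Compl_empty_eq closed_empty closed_UNIV)
  next
    case (Compl a)
    then show ?case by (simp add: Compl_eq_Diff_UNIV[symmetric])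
  next
    case (Union a)
    then have "Sou (\<Inter>n. - a n)" by (intro INT) auto
    with Union show ?case using UN by (simp add: Compl_UN)
  qed
  then show thesis using that unfolding Sou_def by blast
qed

text \<open>Choquet's capacitability argument: the entries of the sequence that codes a point are bounded one
  after the other, each time without losing the capacity \<open>t\<close>.\<close>

lemma capacity_compact_subset:
  fixes B :: "'a::{heine_borel,real_normed_vector} set" and g :: "'a \<Rightarrow> 'b::metric_space" and c :: "'b set \<Rightarrow> ennreal"
  assumes B: "B \<in> sets borel" and g: "continuous_on UNIV g"
    and mono: "\<And>S T. S \<subseteq> T \<Longrightarrow> c S \<le> c T"
    and SUP: "\<And>A. incseq A \<Longrightarrow> c (\<Union>n. A n) \<le> (SUP n. c (A n))"
    and t: "t < c (g ` B)"
  obtains L where "compact L" "L \<subseteq> B" "\<And>U. open U \<Longrightarrow> g ` L \<subseteq> U \<Longrightarrow> t < c U"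
proof -
  obtain F :: "('a \<times> (nat \<Rightarrow> nat)) set" where F: "closed F" "B = fst ` F"
    using Borel_projection_closed[OF B] .
  \<comment> \<open>Entry 0 bounds the norm of the point and the later entries are those of its
    code, so bounding all entries confines a pair to a compact set.\<close>
  define h :: "'a \<times> (nat \<Rightarrow> nat) \<Rightarrow> nat \<Rightarrow> nat"
    where "h p i = (case i of 0 \<Rightarrow> nat \<lceil>norm (fst p)\<rceil> | Suc j \<Rightarrow> snd p j)" for p i
  define c' where "c' S = c (g ` fst ` S)" for S :: "('a \<times> (nat \<Rightarrow> nat)) set"
  \<comment> \<open>The sets cut out by bounding entry \<open>k\<close> by \<open>m\<close> exhaust
    \<open>S\<close> as \<open>m\<close> grows, so continuity from below finds a bound that keeps
    the capacity above \<open>t\<close>.\<close>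
  have step: "\<exists>m. t < c' (S \<inter> {p. h p k \<le> m})" if "t < c' S" for S k
  proof -
    have "g ` fst ` S = (\<Union>m. g ` fst ` (S \<inter> {p. h p k \<le> m}))" by auto
    moreover have "incseq (\<lambda>m. g ` fst ` (S \<inter> {p. h p k \<le> m}))"
      by (intro monoI image_mono) auto
    ultimately have "t < (SUP m. c' (S \<inter> {p. h p k \<le> m}))"
      using SUP[of "\<lambda>m. g ` fst ` (S \<inter> {p. h p k \<le> m})"] that unfolding c'_def by auto
    then show ?thesis by (auto simp: less_SUP_iff)
  qed
  have "\<exists>T. \<forall>k. (t < c' (T k) \<and> (k = 0 \<longrightarrow> T k = F)) \<and> (\<exists>m. T (Suc k) = T k \<inter> {p. h p k \<le> m})"
  proof (rule dependent_nat_choice)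
    show "\<exists>x. t < c' x \<and> ((0::nat) = 0 \<longrightarrow> x = F)" using t F by (auto simp: c'_def)
    fix x :: "('a \<times> (nat \<Rightarrow> nat)) set" and n :: nat assume "t < c' x \<and> (n = 0 \<longrightarrow> x = F)"
    then show "\<exists>y. (t < c' y \<and> (Suc n = 0 \<longrightarrow> y = F)) \<and> (\<exists>m. y = x \<inter> {p. h p n \<le> m})"
      using step[of x n] by auto
  qed
  then obtain T where T: "\<And>k. t < c' (T k)" "T 0 = F" "\<And>k. \<exists>m. T (Suc k) = T k \<inter> {p. h p k \<le> m}"
    by metis
  then obtain m where m: "\<And>k. T (Suc k) = T k \<inter> {p. h p k \<le> m k}" by metis
  have Teq: "T k = F \<inter> {p. \<forall>i<k. h p i \<le> m i}" for k
    by (induction k) (auto simp: T m less_Suc_eq)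
  define W where "W M = {p. \<forall>i. h p i \<le> M i}" for M
  have Wsub: "W M = cball 0 (real (M 0)) \<times> {\<sigma>. \<forall>i. \<sigma> i \<le> M (Suc i)}" for M
  proof -
    have all: "(\<forall>i. P i) \<longleftrightarrow> P 0 \<and> (\<forall>i. P (Suc i))" for P :: "nat \<Rightarrow> bool"
      by (metis nat.exhaust)
    show ?thesis
      unfolding W_def by (subst all) (auto simp: h_def dist_norm nat_le_iff ceiling_le_iff)
  qed
  have Wc: "compact (W M)" for M
  proof -
    have "{\<sigma>. \<forall>i. \<sigma> i \<le> M (Suc i)} = (\<Pi>\<^sub>E i\<in>UNIV. {..M (Suc i)})" by auto
    moreover have "compactin (product_topology (\<lambda>i. euclidean) UNIV) (\<Pi>\<^sub>E i\<in>(UNIV::nat set). {..M (Suc i)})"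
      by (subst compactin_PiE) (auto intro!: finite_imp_compact)
    ultimately have "compact {\<sigma>. \<forall>i. \<sigma> i \<le> M (Suc i)}"
      by (simp add: euclidean_product_topology flip: compactin_euclidean_iff)
    then show ?thesis unfolding Wsub by (intro compact_Times compact_cball)
  qed
  define L where "L = fst ` (F \<inter> W m)"
  have "compact L"
    unfolding L_def using F Wc
    by (intro compact_continuous_image closed_Int_compact continuous_on_fst continuous_on_id)
  moreover have "L \<subseteq> B" using F by (auto simp: L_def)
  \<comment> \<open>The capacity of the image of \<open>L\<close> itself is not compared with
    \<open>t\<close>, as nothing is assumed about decreasing sequences. Instead, compactness places
    the image of some \<open>T k\<close> inside any open neighbourhood of the image of
    \<open>L\<close>.\<close>
  moreover have "t < c U" if U: "open U" "g ` L \<subseteq> U" for U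
  proof -
    have "\<exists>k. g ` fst ` T k \<subseteq> U"
    proof (rule ccontr)
      assume "\<not> ?thesis"
      then have "\<forall>k. \<exists>p\<in>T k. g (fst p) \<notin> U" by auto
      then obtain p where p: "\<And>k. p k \<in> T k" "\<And>k. g (fst (p k)) \<notin> U" by metis
      \<comment> \<open>\<open>p k\<close> is known to obey the bounds \<open>m i\<close> only for
        \<open>i < k\<close>. For each \<open>i\<close> the finitely many exceptions
        \<open>k \<le> i\<close> are absorbed into \<open>M i\<close>, so the whole sequence lies in
        one compact set.\<close>
      define M where "M i = Max (insert (m i) ((\<lambda>k. h (p k) i) ` {..i}))" for i
      have "p k \<in> W M" for k
      proof -
        have "h (p k) i \<le> M i" for i
        proof (cases "k \<le> i")
          case True
          then show ?thesis unfolding M_def by (intro Max_ge) auto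
        next
          case False
          then have "h (p k) i \<le> m i" using p(1)[of k] by (auto simp: Teq)
          also have "\<dots> \<le> M i" unfolding M_def by (intro Max_ge) auto
          finally show ?thesis .
        qed
        then show ?thesis by (simp add: W_def)
      qed
      moreover have "p k \<in> F" for k using p(1)[of k] by (auto simp: Teq)
      moreover have "compact (F \<inter> W M)" using F Wc by (intro closed_Int_compact)
      ultimately obtain q r where q: "q \<in> F \<inter> W M" "strict_mono r" "(p \<circ> r) \<longlonglongrightarrow> q"
        by (metis (no_types, lifting) Int_iff compact_imp_seq_compact seq_compactE)
      have "closed {p :: 'a \<times> (nat \<Rightarrow> nat). h p i \<le> m i}" for i
      proof (cases i)
        case 0
        then have eq: "{p :: 'a \<times> (nat \<Rightarrow> nat). h p i \<le> m i} = fst -` cball 0 (real (m i))"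
          by (auto simp: h_def nat_le_iff ceiling_le_iff)
        show ?thesis unfolding eq
          by (intro closed_vimage continuous_on_fst continuous_on_id closed_cball)
      next
        case (Suc j)
        then have eq: "{p :: 'a \<times> (nat \<Rightarrow> nat). h p i \<le> m i} = (\<lambda>p. snd p j) -` {..m i}"
          by (auto simp: h_def)
        show ?thesis unfolding eq
          by (intro closed_vimage continuous_on_product_then_coordinatewise[OF continuous_on_snd]
            continuous_on_id closed_atMost)
      qed
      moreover have "eventually (\<lambda>k. (p \<circ> r) k \<in> {p. h p i \<le> m i}) sequentially" for i
        using eventually_gt_at_top[of i]
      proof eventually_elim
        case (elim k)
        then have "i < r k" using seq_suble[OF q(2), of k] by simp
        then show ?case using p(1)[of "r k"] by (auto simp: Teq)
      qed
      ultimately have "q \<in> {p. h p i \<le> m i}" for i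
        by (intro Lim_in_closed_set[of "{p. h p i \<le> m i}" "p \<circ> r" sequentially] q(3)) simp_all
      then have "q \<in> F \<inter> W m" using q(1) by (auto simp: W_def)
      then have "g (fst q) \<in> U" using U by (auto simp: L_def)
      moreover have "(\<lambda>k. g (fst ((p \<circ> r) k))) \<longlonglongrightarrow> g (fst q)"
        using q(3) g by (intro continuous_on_tendsto_compose[OF g] tendsto_fst) (auto simp: comp_def)
      ultimately have "eventually (\<lambda>k. g (fst ((p \<circ> r) k)) \<in> U) sequentially"
        using U(1) by (rule topological_tendstoD[rotated 2])
      then show False using p(2) by (auto simp: eventually_sequentially)
    qed
    then obtain k where "g ` fst ` T k \<subseteq> U" ..
    then show ?thesis using T(1)[of k] mono[of "g ` fst ` T k" U] by (auto simp: c'_def)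
  qed
  ultimately show thesis by (rule that)
qed

text \<open>Lebesgue outer measure is continuous from below on arbitrary sets, so the capacity
  argument yields compact subsets of the image whose measures approach its outer measure. A bounded
  image then lies between a countable union of compact sets and a measurable hull of the same
  measure.\<close>

lemma continuous_image_Borel_lebesgue:
  fixes B :: "'a::{heine_borel,real_normed_vector} set" and g :: "'a \<Rightarrow> 'b::euclidean_space"
  assumes B: "B \<in> sets borel" and g: "continuous_on UNIV g"
  shows "g ` B \<in> sets lebesgue"
proof -
  let ?o = "outer_measure_of (lborel :: 'b measure)"
  \<comment> \<open>Boundedness makes the outer measure finite, so that equal measures leave a null
    difference.\<close>
  have bounded_case: "g ` B \<in> sets lebesgue" if B: "B \<in> sets borel" and bdd: "bounded (g ` B)" for B
  proof -
    let ?A = "g ` B"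
    obtain r where r: "?A \<subseteq> cball 0 r" using bdd by (meson bounded_subset_ballD ball_subset_cball subset_trans)
    obtain H where H: "H \<in> sets lborel" "?A \<subseteq> H" "?o ?A = emeasure lborel H"
      using outer_measure_of_attain[of ?A lborel] by auto
    have fin: "?o ?A < \<infinity>"
    proof -
      have "?o ?A \<le> ?o (cball 0 r)" by (rule outer_measure_of_mono[OF r])
      also have "\<dots> < \<infinity>" using emeasure_lborel_cball_finite[of 0 r] by simp
      finally show ?thesis .
    qed
    have ex: "\<exists>K. compact K \<and> K \<subseteq> ?A \<and> t \<le> emeasure lborel K" if t: "t < ?o ?A" for t
    proof -
      obtain L where L: "compact L" "L \<subseteq> B" "\<And>U. open U \<Longrightarrow> g ` L \<subseteq> U \<Longrightarrow> t < ?o U"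
      proof (rule capacity_compact_subset[OF B g, of ?o t])
        show "?o (\<Union>n. A n) \<le> (SUP n. ?o (A n))" if "incseq A" for A :: "nat \<Rightarrow> 'b set"
          using that by (subst SUP_outer_measure_of_incseq) auto
      qed (use t in \<open>auto intro: outer_measure_of_mono\<close>)
      let ?K = "g ` L"
      have K: "compact ?K" using L g by (meson compact_continuous_image continuous_on_subset subset_UNIV)
      have "t \<le> emeasure lborel ?K"
      proof (rule ccontr)
        assume "\<not> ?thesis"
        then have "emeasure lborel ?K < t" by simp
        then obtain e :: real where e: "e > 0" "emeasure lborel ?K + e < t"
        proof -
          have "t < top" using t fin by (auto simp: less_trans)
          then obtain t' where t': "t = ennreal t'" "t' \<ge> 0" by (metis ennreal_cases not_less_iff_gr_or_eq)
          moreover have "emeasure lborel ?K < top" using \<open>emeasure lborel ?K < t\<close> \<open>t < top\<close> by simp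
          then obtain k' where k': "emeasure lborel ?K = ennreal k'" "k' \<ge> 0" by (metis ennreal_cases not_less_iff_gr_or_eq)
          ultimately have "k' < t'" using \<open>emeasure lborel ?K < t\<close> by (simp add: ennreal_less_iff)
          then show thesis
            using t' k' by (intro that[of "(t' - k') / 2"]) (auto simp: ennreal_less_iff field_simps simp flip: ennreal_plus)
        qed
        \<comment> \<open>Outer regularity at the compact image turns the bound for all its open
          neighbourhoods into one for the compact image itself.\<close>
        obtain U where U: "open U" "?K \<subseteq> U" "emeasure lborel (U - ?K) < ennreal e"
          using outer_regular_lborel[of ?K e] K e(1) borel_compact by blast
        have "emeasure lborel U \<le> emeasure lborel ?K + emeasure lborel (U - ?K)"
          using U(1,2) emeasure_subadditive[of ?K lborel "U - ?K"] borel_compact[OF K]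
          by (simp add: Un_absorb1)
        also have "\<dots> \<le> emeasure lborel ?K + e" using U(3) by (intro add_left_mono) auto
        also have "\<dots> < t" by (rule e)
        finally show False using L(3)[OF U(1,2)] U(1) by simp
      qed
      then show ?thesis using K L by blast
    qed
    show ?thesis
    proof (cases "?o ?A = 0")
      case True
      then have "H \<in> null_sets lborel" using H by auto
      then show ?thesis using H(2) by (meson null_sets_completion_subset null_setsD2 null_sets_completionI)
    next
      case False
      define a where "a = enn2real (?o ?A)"
      have a: "?o ?A = ennreal a" "a > 0"
        using fin False by (auto simp: a_def enn2real_positive_iff less_top zero_less_iff_neq_zero)
      \<comment> \<open>Values strictly below \<open>a\<close> that tend to \<open>a\<close>; the
        compact sets are obtained only for such values.\<close>
      define tt where "tt n = ennreal (a * (1 - 1 / (real n + 1)))" for n :: nat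
      have "tt n < ?o ?A" for n
        unfolding tt_def a using a by (intro ennreal_lessI) (auto simp: field_simps)
      then have "\<forall>n. \<exists>K. compact K \<and> K \<subseteq> ?A \<and> tt n \<le> emeasure lborel K"
        using ex by blast
      then obtain K where K: "\<And>n. compact (K n)" "\<And>n. K n \<subseteq> ?A" "\<And>n. tt n \<le> emeasure lborel (K n)"
        by metis
      define L where "L = (\<Union>n. K n)"
      have L: "L \<in> sets lborel" "L \<subseteq> ?A" using K by (auto simp: L_def borel_compact)
      have le: "tt n \<le> emeasure lborel L" for n
        using L(1) by (intro order_trans[OF K(3)] emeasure_mono) (auto simp: L_def)
      have "tt \<longlonglongrightarrow> ennreal (a * (1 - 0))"
        unfolding tt_def
        by (intro tendsto_ennrealI tendsto_mult tendsto_diff tendsto_const)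
           (use LIMSEQ_inverse_real_of_nat in \<open>simp add: inverse_eq_divide add.commute\<close>)
      then have "ennreal a \<le> emeasure lborel L"
        using le by (intro LIMSEQ_le_const2[of tt]) auto
      then have "emeasure lborel (H - L) = 0"
      proof (subst emeasure_Diff)
        have "emeasure lborel L \<le> emeasure lborel H" using H L by (intro emeasure_mono) auto
        also have "emeasure lborel H < top" using H fin by simp
        finally show "emeasure lborel L \<noteq> \<infinity>" by simp
        show "emeasure lborel H - emeasure lborel L = 0"
          using \<open>ennreal a \<le> emeasure lborel L\<close> a H fin by (intro diff_eq_0_ennreal) auto
      qed (use H L in auto)
      then have "H - L \<in> null_sets lborel" using H L by auto
      then have "?A - L \<in> null_sets lebesgue"
        using H(2) by (intro null_sets_completion_subset[of "?A - L" "H - L"]) (auto simp: null_sets_completionI)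
      then have "L \<union> (?A - L) \<in> sets lebesgue" using L by (intro sets.Un) auto
      then show ?thesis using L(2) by (simp add: Un_absorb1)
    qed
  qed
  have "g ` B = (\<Union>n::nat. g ` (B \<inter> g -` cball 0 (real n)))"
  proof (intro equalityI subsetI)
    fix y assume "y \<in> g ` B"
    then obtain x where x: "x \<in> B" "y = g x" by auto
    obtain n where "norm y \<le> real n" using real_arch_simple by blast
    with x have "y \<in> g ` (B \<inter> g -` cball 0 (real n))" by (intro image_eqI[of _ _ x]) auto
    then show "y \<in> (\<Union>n::nat. g ` (B \<inter> g -` cball 0 (real n)))" by blast
  qed auto
  also have "\<dots> \<in> sets lebesgue"
  proof (rule sets.countable_UN'', simp)
    fix n
    have "closed (g -` cball 0 (real n))" by (intro closed_vimage g closed_cball)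
    then have "B \<inter> g -` cball 0 (real n) \<in> sets borel" using B by auto
    moreover have "bounded (g ` (B \<inter> g -` cball 0 (real n)))"
      by (rule bounded_subset[OF bounded_cball[of 0 "real n"]]) auto
    ultimately show "g ` (B \<inter> g -` cball 0 (real n)) \<in> sets lebesgue" by (rule bounded_case)
  qed
  finally show ?thesis .
qed

section \<open>Frostman measures\<close>

text \<open>Half-open intervals \<open>[p j, p j + w j)\<close> that partition
  \<open>[0, sum w J)\<close>; an index of weight zero owns the empty interval.\<close>

definition interval_split :: "('i \<Rightarrow> real) \<Rightarrow> ('i \<Rightarrow> real) \<Rightarrow> 'i set \<Rightarrow> bool" where
  "interval_split p w J \<longleftrightarrow> (\<forall>j\<in>J. 0 \<le> p j \<and> p j + w j \<le> sum w J) \<and>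
    (\<forall>t. 0 \<le> t \<and> t < sum w J \<longrightarrow> (\<exists>j\<in>J. p j \<le> t \<and> t < p j + w j)) \<and>
    (\<forall>i\<in>J. \<forall>j\<in>J. \<forall>t. p i \<le> t \<and> t < p i + w i \<and> p j \<le> t \<and> t < p j + w j \<longrightarrow> i = j)"

lemma interval_split_exists:
  assumes "finite J" "\<And>j. j \<in> J \<Longrightarrow> 0 \<le> w j"
  shows "\<exists>p. interval_split p w J"
  using assms
proof (induction J rule: finite_induct)
  case empty
  then show ?case by (auto simp: interval_split_def)
next
  case (insert i J)
  then obtain p where "interval_split p w J" by blast
  note p = this[unfolded interval_split_def, THEN conjunct1]
    this[unfolded interval_split_def, THEN conjunct2, THEN conjunct1]
    this[unfolded interval_split_def, THEN conjunct2, THEN conjunct2]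
  have w0: "0 \<le> w i" "0 \<le> sum w J" using insert by (auto intro: sum_nonneg)
  define q where "q = p(i := sum w J)"
  have qi: "q i = sum w J" and qj: "\<And>j. j \<in> J \<Longrightarrow> q j = p j"
    using insert.hyps by (auto simp: q_def)
  have S: "sum w (insert i J) = w i + sum w J" using insert by simp
  show ?case
    unfolding interval_split_def
  proof (intro exI[of _ q] conjI ballI allI impI)
    fix j assume "j \<in> insert i J"
    then show "0 \<le> q j" "q j + w j \<le> sum w (insert i J)"
      using p(1)[rule_format, of j] w0 by (auto simp: qi qj S)
  next
    fix t assume t: "0 \<le> t \<and> t < sum w (insert i J)"
    show "\<exists>j\<in>insert i J. q j \<le> t \<and> t < q j + w j"
    proof (cases "t < sum w J")
      case True
      then obtain j where "j \<in> J" "p j \<le> t \<and> t < p j + w j" using p(2)[rule_format, of t] t by auto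
      then show ?thesis using qj[of j] by (intro bexI[of _ j]) auto
    next
      case False
      then show ?thesis using t by (intro bexI[of _ i]) (auto simp: qi S)
    qed
  next
    fix a b t assume ab: "a \<in> insert i J" "b \<in> insert i J" and t: "q a \<le> t \<and> t < q a + w a \<and> q b \<le> t \<and> t < q b + w b"
    have below: "t < sum w J" if "j \<in> J" "t < q j + w j" for j
      using p(1)[rule_format, OF that(1)] that qj by auto
    show "a = b"
    proof (cases "a = i"; cases "b = i")
      assume "a \<noteq> i" "b \<noteq> i"
      then show ?thesis using ab t p(3)[rule_format, of a b t] qj[of a] qj[of b] by auto
    next
      assume "a = i" "b \<noteq> i"
      then show ?thesis using below[of b] ab t qi by auto
    next
      assume "a \<noteq> i" "b = i"
      then show ?thesis using below[of a] ab t qi by auto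
    qed auto
  qed
qed

definition child_cells :: "nat \<Rightarrow> 'a::euclidean_space \<Rightarrow> 'a set set" where
  "child_cells k x = dyadic_cell (Suc k) ` dyadic_cell k x"

lemma finite_descendants: "finite (dyadic_cell (k + n) ` dyadic_cell k (x::'a::euclidean_space))"
proof -
  have "dyadic_cell (k + n) ` dyadic_cell k x \<subseteq> near_cells (DIM('a) * 2 ^ n + 1) (k + n) x"
  proof safe
    fix y assume "y \<in> dyadic_cell k x"
    then have "dist y x \<le> real DIM('a) / 2 ^ k" by (intro dyadic_cell_dist) auto
    then have "dist y x \<le> real (DIM('a) * 2 ^ n) / 2 ^ (k + n)" by (simp add: power_add)
    then show "dyadic_cell (k + n) y \<in> near_cells (DIM('a) * 2 ^ n + 1) (k + n) x"
      by (rule near_cells_dist)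
  qed
  then show ?thesis using near_cells_card(1) finite_subset by blast
qed

text \<open>A subadditive weight on cells is turned into an additive one from the top downwards, by
  distributing the mass of each cell among its children proportionally. The resulting measure is the
  image of Lebesgue measure on an interval that is subdivided along with the cells.\<close>

locale mass_distribution =
  fixes v :: "'a::euclidean_space set \<Rightarrow> real" and x0 :: 'a and K :: "'a set"
  assumes v_nonneg: "\<And>Q. 0 \<le> v Q"
    and v_sub: "\<And>k x. v (dyadic_cell k x) \<le> (\<Sum>P\<in>child_cells k x. v P)"
    and v_pos: "0 < v (dyadic_cell 0 x0)"
    and v_K: "\<And>k x. 0 < v (dyadic_cell k x) \<Longrightarrow> K \<inter> dyadic_cell k x \<noteq> {}"
    and K: "closed K"
begin

lemma finite_child_cells: "finite (child_cells k (x::'a))"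
  using finite_descendants[of k 1 x] by (simp add: child_cells_def)

lemma child_cells_eq: "y \<in> dyadic_cell k x \<Longrightarrow> child_cells k y = child_cells k x"
  by (simp add: child_cells_def dyadic_cell_eq)

text \<open>The mass that proportional distribution gives to the level-\<open>k\<close> cell of
  \<open>x\<close>. A vanishing denominator yields 0 by the convention for division.\<close>

primrec weight :: "nat \<Rightarrow> 'a \<Rightarrow> real" where
  "weight 0 x = v (dyadic_cell 0 x)"
| "weight (Suc k) x = weight k x * v (dyadic_cell (Suc k) x) / (\<Sum>P\<in>child_cells k x. v P)"

definition child_weight :: "nat \<Rightarrow> 'a \<Rightarrow> 'a set \<Rightarrow> real" where
  "child_weight k x P = weight k x * v P / (\<Sum>P\<in>child_cells k x. v P)"

lemma weight_Suc: "weight (Suc k) x = child_weight k x (dyadic_cell (Suc k) x)"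
  by (simp add: child_weight_def)

lemma weight_nonneg: "0 \<le> weight k x"
  by (induction k) (auto intro!: mult_nonneg_nonneg divide_nonneg_nonneg sum_nonneg v_nonneg)

text \<open>The ratio of \<open>weight\<close> to \<open>v\<close> cannot grow from parent to child,
  because by subadditivity the values of \<open>v\<close> on the children sum to at least that of
  the parent.\<close>

lemma weight_le: "weight k x \<le> v (dyadic_cell k x)"
proof (induction k)
  case (Suc k)
  let ?S = "\<Sum>P\<in>child_cells k x. v P"
  have S: "weight k x \<le> ?S" using Suc v_sub[of k x] by simp
  have "weight (Suc k) x = (weight k x / ?S) * v (dyadic_cell (Suc k) x)" by simp
  also have "\<dots> \<le> 1 * v (dyadic_cell (Suc k) x)"
    using S weight_nonneg[of k x] by (intro mult_right_mono v_nonneg) (auto simp: divide_le_eq_1)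
  finally show ?case by simp
qed simp

lemma sum_child_weight: "(\<Sum>P\<in>child_cells k x. child_weight k x P) = weight k x"
proof -
  let ?S = "\<Sum>P\<in>child_cells k x. v P"
  have "(\<Sum>P\<in>child_cells k x. child_weight k x P) = weight k x * ?S / ?S"
    by (simp add: child_weight_def sum_divide_distrib sum_distrib_left)
  \<comment> \<open>If \<open>v\<close> vanishes on all children, subadditivity forces
    \<open>v\<close>, and hence the weight, of the parent to vanish, so the convention
    \<open>0 / 0 = 0\<close> loses no mass.\<close>
  moreover have "weight k x = 0" if "?S = 0"
    using weight_le[of k x] v_sub[of k x] weight_nonneg[of k x] that by simp
  ultimately show ?thesis by (cases "?S = 0") auto
qed

text \<open>The position of each child's interval relative to that of the parent. The choice is made
  from data that depend only on the cell, so all points of a cell agree on it.\<close>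

definition offset :: "nat \<Rightarrow> 'a \<Rightarrow> 'a set \<Rightarrow> real" where
  "offset k x = (SOME p. interval_split p (child_weight k x) (child_cells k x))"

lemma offset:
  shows offset_bounds: "P \<in> child_cells k x \<Longrightarrow> 0 \<le> offset k x P \<and> offset k x P + child_weight k x P \<le> weight k x"
    and offset_exists: "0 \<le> t \<Longrightarrow> t < weight k x \<Longrightarrow>
      \<exists>P\<in>child_cells k x. offset k x P \<le> t \<and> t < offset k x P + child_weight k x P"
    and offset_unique: "P \<in> child_cells k x \<Longrightarrow> Q \<in> child_cells k x \<Longrightarrow>
      offset k x P \<le> t \<Longrightarrow> t < offset k x P + child_weight k x P \<Longrightarrow>
      offset k x Q \<le> t \<Longrightarrow> t < offset k x Q + child_weight k x Q \<Longrightarrow> P = Q"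
proof -
  have "\<exists>p. interval_split p (child_weight k x) (child_cells k x)"
    by (rule interval_split_exists[OF finite_child_cells])
       (auto simp: child_weight_def intro!: mult_nonneg_nonneg divide_nonneg_nonneg sum_nonneg v_nonneg weight_nonneg)
  from someI_ex[OF this, folded offset_def]
  have split: "interval_split (offset k x) (child_weight k x) (child_cells k x)" .
  note * = split[unfolded interval_split_def sum_child_weight, THEN conjunct1]
    split[unfolded interval_split_def sum_child_weight, THEN conjunct2, THEN conjunct1]
    split[unfolded interval_split_def sum_child_weight, THEN conjunct2, THEN conjunct2]
  show "P \<in> child_cells k x \<Longrightarrow> 0 \<le> offset k x P \<and> offset k x P + child_weight k x P \<le> weight k x"
    using *(1) by blast
  show "0 \<le> t \<Longrightarrow> t < weight k x \<Longrightarrow>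
      \<exists>P\<in>child_cells k x. offset k x P \<le> t \<and> t < offset k x P + child_weight k x P"
    using *(2) by blast
  show "P \<in> child_cells k x \<Longrightarrow> Q \<in> child_cells k x \<Longrightarrow>
      offset k x P \<le> t \<Longrightarrow> t < offset k x P + child_weight k x P \<Longrightarrow>
      offset k x Q \<le> t \<Longrightarrow> t < offset k x Q + child_weight k x Q \<Longrightarrow> P = Q"
    using *(3) by blast
qed

primrec left :: "nat \<Rightarrow> 'a \<Rightarrow> real" where
  "left 0 x = 0"
| "left (Suc k) x = left k x + offset k x (dyadic_cell (Suc k) x)"

lemma weight_cong: "y \<in> dyadic_cell k x \<Longrightarrow> weight k y = weight k x"
proof (induction k)
  case (Suc k)
  then have "y \<in> dyadic_cell k x" using dyadic_cell_antimono[of k "Suc k" x] by auto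
  then show ?case using Suc by (simp add: child_cells_eq dyadic_cell_eq)
qed (simp add: dyadic_cell_eq)

lemma offset_cong: "y \<in> dyadic_cell k x \<Longrightarrow> offset k y = offset k x"
  unfolding offset_def child_weight_def by (simp add: weight_cong child_cells_eq)

lemma left_cong: "y \<in> dyadic_cell k x \<Longrightarrow> left k y = left k x"
proof (induction k)
  case (Suc k)
  then have "y \<in> dyadic_cell k x" using dyadic_cell_antimono[of k "Suc k" x] by auto
  then show ?case using Suc by (simp add: offset_cong dyadic_cell_eq)
qed simp

text \<open>The interval of parameters \<open>t\<close> that are routed to the
  level-\<open>k\<close> cell of \<open>x\<close>; for cells inside the root cell these intervals
  refine from level to level.\<close>

definition slot :: "nat \<Rightarrow> 'a \<Rightarrow> real set" where
  "slot k x = {left k x ..< left k x + weight k x}"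

lemma slot_cong: "y \<in> dyadic_cell k x \<Longrightarrow> slot k y = slot k x"
  by (simp add: slot_def left_cong weight_cong)

lemma dyadic_cell_Suc_child: "dyadic_cell (Suc k) x \<in> child_cells k x"
  by (auto simp: child_cells_def)

lemma slot_Suc:
  "t \<in> slot (Suc k) x \<longleftrightarrow> offset k x (dyadic_cell (Suc k) x) \<le> t - left k x \<and>
    t - left k x < offset k x (dyadic_cell (Suc k) x) + child_weight k x (dyadic_cell (Suc k) x)"
  unfolding slot_def weight_Suc by (auto simp del: weight.simps)

lemma slot_parent: "t \<in> slot (Suc k) x \<Longrightarrow> t \<in> slot k x"
  using offset_bounds[OF dyadic_cell_Suc_child, of k x] unfolding slot_Suc by (auto simp: slot_def)

lemma slot_child:
  assumes "t \<in> slot k x"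
  obtains y where "y \<in> dyadic_cell k x" "t \<in> slot (Suc k) y"
proof -
  obtain P where P: "P \<in> child_cells k x" "offset k x P \<le> t - left k x" "t - left k x < offset k x P + child_weight k x P"
    using offset_exists[of "t - left k x" k x] assms by (auto simp: slot_def)
  then obtain y where y: "y \<in> dyadic_cell k x" "P = dyadic_cell (Suc k) y" by (auto simp: child_cells_def)
  have "t \<in> slot (Suc k) y"
    unfolding slot_Suc using P y by (simp add: offset_cong left_cong child_weight_def weight_cong child_cells_eq)
  with y show thesis using that by blast
qed

lemma slot_unique:
  assumes "x \<in> dyadic_cell 0 x0" "y \<in> dyadic_cell 0 x0" "t \<in> slot k x" "t \<in> slot k y"
  shows "dyadic_cell k x = dyadic_cell k y"
  using assms(3,4)
proof (induction k)
  case 0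
  then show ?case using assms dyadic_cell_eq by blast
next
  case (Suc k)
  then have eq: "dyadic_cell k x = dyadic_cell k y" using slot_parent by blast
  then have yx: "y \<in> dyadic_cell k x" by simp
  show ?case
  proof (rule offset_unique[of _ k x _ "t - left k x"])
    show "dyadic_cell (Suc k) x \<in> child_cells k x" by (rule dyadic_cell_Suc_child)
    show "dyadic_cell (Suc k) y \<in> child_cells k x" using yx by (auto simp: child_cells_def)
  qed (use Suc(2,3) yx in \<open>auto simp: slot_Suc offset_cong left_cong child_weight_def weight_cong child_cells_eq\<close>)
qed

definition total :: real where "total = v (dyadic_cell 0 x0)"

lemma slot_exists:
  assumes "t \<in> {0..<total}"
  shows "\<exists>y\<in>dyadic_cell 0 x0. t \<in> slot k y"
proof (induction k)
  case 0
  show ?case using assms by (intro bexI[of _ x0]) (auto simp: slot_def total_def)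
next
  case (Suc k)
  then obtain y z where yz: "y \<in> dyadic_cell 0 x0" "z \<in> dyadic_cell k y" "t \<in> slot (Suc k) z"
    using slot_child by blast
  moreover have "z \<in> dyadic_cell 0 y" using yz(2) dyadic_cell_antimono[of 0 k y] by auto
  ultimately show ?case using dyadic_cell_eq by blast
qed

definition cells :: "nat \<Rightarrow> 'a set set" where
  "cells k = dyadic_cell k ` dyadic_cell 0 x0"

lemma finite_cells: "finite (cells k)"
  using finite_descendants[of 0 k x0] by (simp add: cells_def)

definition rep :: "'a set \<Rightarrow> 'a" where "rep Q = (SOME x. x \<in> Q)"

lemma rep_in: "x \<in> Q \<Longrightarrow> rep Q \<in> Q"
  unfolding rep_def by (rule someI)

text \<open>The representative of the level-\<open>k\<close> cell that owns \<open>t\<close>,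
  written as a finite sum of indicators so that measurability is immediate.\<close>

definition approx :: "nat \<Rightarrow> real \<Rightarrow> 'a" where
  "approx k t = (\<Sum>Q\<in>cells k. indicator (slot k (rep Q)) t *\<^sub>R rep Q)"

lemma approx_eq:
  assumes "y \<in> dyadic_cell 0 x0" "t \<in> slot k y"
  shows "approx k t = rep (dyadic_cell k y)"
proof -
  have "indicator (slot k (rep Q)) t = (if Q = dyadic_cell k y then 1 else (0::real))" if "Q \<in> cells k" for Q
  proof -
    obtain z where z: "z \<in> dyadic_cell 0 x0" "Q = dyadic_cell k z" using \<open>Q \<in> cells k\<close> by (auto simp: cells_def)
    have "slot k (rep Q) = slot k z" using z rep_in[of z Q] by (intro slot_cong) auto
    moreover have "t \<in> slot k z \<longleftrightarrow> Q = dyadic_cell k y"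
      using slot_unique[of z y t k] assms z slot_cong[of y k z] by auto
    ultimately show ?thesis by auto
  qed
  then have "approx k t = (\<Sum>Q\<in>cells k. (if Q = dyadic_cell k y then 1 else 0) *\<^sub>R rep Q)"
    unfolding approx_def by (intro sum.cong) auto
  also have "\<dots> = (\<Sum>Q\<in>cells k. if Q = dyadic_cell k y then rep Q else 0)"
    by (intro sum.cong) auto
  also have "\<dots> = rep (dyadic_cell k y)"
    using assms finite_cells by (subst sum.delta) (auto simp: cells_def)
  finally show ?thesis .
qed

lemma approx_measurable[measurable]: "approx k \<in> borel_measurable borel"
  unfolding approx_def[abs_def] slot_def by measurable

definition point :: "real \<Rightarrow> 'a" where "point t = lim (\<lambda>k. approx k t)"

lemma point_measurable[measurable]: "point \<in> borel_measurable borel"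
  unfolding point_def[abs_def] by (intro borel_measurable_lim_metric) simp

text \<open>All later approximations stay in the cell of \<open>y\<close>, but their limit may leave
  a half-open cell through its boundary. Hence the conclusion concerns distance and not
  membership.\<close>

lemma point_near:
  assumes t: "t \<in> {0..<total}" and y: "y \<in> dyadic_cell 0 x0" "t \<in> slot k y" and z: "z \<in> dyadic_cell k y"
  shows "dist (point t) z \<le> real DIM('a) / 2 ^ k"
proof -
  have later: "approx j t \<in> dyadic_cell k y" if y: "y \<in> dyadic_cell 0 x0" "t \<in> slot k y" and "k \<le> j" for j k y
  proof -
    obtain c where c: "c \<in> dyadic_cell 0 x0" "t \<in> slot j c" using slot_exists[OF t] by blast
    have "t \<in> slot k c" using \<open>k \<le> j\<close> c(2)
      by (induction j rule: dec_induct) (auto dest: slot_parent)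
    then have "dyadic_cell k c = dyadic_cell k y" using slot_unique c y by blast
    moreover have "approx j t \<in> dyadic_cell j c" unfolding approx_eq[OF c] by (rule rep_in[of c]) simp
    ultimately show ?thesis using dyadic_cell_antimono[OF \<open>k \<le> j\<close>, of c] by blast
  qed
  have "Cauchy (\<lambda>k. approx k t)"
  proof (rule metric_CauchyI)
    fix e :: real assume e: "e > 0"
    obtain n where "real DIM('a) / e < 2 ^ n" using real_arch_pow[of 2] by auto
    then have n: "real DIM('a) / 2 ^ n < e" using e by (simp add: field_simps)
    obtain c where c: "c \<in> dyadic_cell 0 x0" "t \<in> slot n c" using slot_exists[OF t] by blast
    have "dist (approx i t) (approx j t) < e" if "n \<le> i" "n \<le> j" for i j
      using dyadic_cell_dist[OF later[OF c that(1)] later[OF c that(2)]] n by simp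
    then show "\<exists>M. \<forall>m\<ge>M. \<forall>n\<ge>M. dist (approx m t) (approx n t) < e" by blast
  qed
  then have "(\<lambda>k. approx k t) \<longlonglongrightarrow> point t"
    unfolding point_def by (simp add: Cauchy_convergent_iff convergent_LIMSEQ_iff)
  moreover have "eventually (\<lambda>j. approx j t \<in> cball z (real DIM('a) / 2 ^ k)) sequentially"
    using eventually_ge_at_top[of k]
    by eventually_elim (use later[OF y] dyadic_cell_dist[OF z] in auto)
  ultimately have "point t \<in> cball z (real DIM('a) / 2 ^ k)"
    by (intro Lim_in_closed_set[of _ "\<lambda>k. approx k t" sequentially]) auto
  then show ?thesis by (simp add: dist_commute)
qed

text \<open>Every cell that owns a parameter has positive weight, hence positive \<open>v\<close>,
  and so meets \<open>K\<close>; the cells owning \<open>t\<close> shrink to its point, and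
  \<open>K\<close> is closed.\<close>

lemma point_in_K:
  assumes t: "t \<in> {0..<total}"
  shows "point t \<in> K"
proof -
  have "point t \<in> closure K"
    unfolding closure_approachable
  proof safe
    fix e :: real assume e: "e > 0"
    obtain n where "real DIM('a) / e < 2 ^ n" using real_arch_pow[of 2] by auto
    then have n: "real DIM('a) / 2 ^ n < e" using e by (simp add: field_simps)
    obtain c where c: "c \<in> dyadic_cell 0 x0" "t \<in> slot n c" using slot_exists[OF t] by blast
    have "0 < v (dyadic_cell n c)" using c(2) weight_le[of n c] by (auto simp: slot_def)
    then obtain z where "z \<in> K" "z \<in> dyadic_cell n c" using v_K by blast
    then show "\<exists>y\<in>K. dist y (point t) < e"
      using point_near[OF t c, of z] n by (auto simp: dist_commute intro!: bexI[of _ z])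
  qed
  then show ?thesis using K by simp
qed

definition mass :: "'a measure" where
  "mass = distr (uniform_measure lborel {0..<total}) borel point"

lemma total_pos: "0 < total"
  using v_pos by (simp add: total_def)

lemma sets_mass[simp]: "sets mass = sets borel"
  by (simp add: mass_def)

lemma prob_space_mass: "prob_space mass"
  unfolding mass_def
  by (intro prob_space.prob_space_distr prob_space_uniform_measure) (use total_pos in auto)

lemma emeasure_mass:
  assumes "A \<in> sets borel"
  shows "emeasure mass A = emeasure lborel ({0..<total} \<inter> point -` A) / total"
proof -
  have [measurable]: "point -` A \<in> sets borel"
    using measurable_sets[OF point_measurable assms] by simp
  show ?thesis
    using assms total_pos unfolding mass_def by (subst emeasure_distr) auto
qed

lemma emeasure_mass_K: "emeasure mass K = 1"
proof -
  have "{0..<total} \<inter> point -` K = {0..<total}" using point_in_K by auto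
  then show ?thesis
    using K total_pos by (subst emeasure_mass) (auto simp: divide_ennreal)
qed

text \<open>A parameter sent into the ball is owned by the cell of a point within
  \<open>DIM('a) + 1\<close> side lengths of \<open>x\<close>: one for the radius, and
  \<open>DIM('a)\<close> for the distance between that point and the image of the parameter. The
  passage to index distances in \<open>near_cells_dist\<close> adds one more.\<close>

lemma emeasure_mass_cball:
  "emeasure mass (cball x (1 / 2 ^ k)) \<le> ennreal ((\<Sum>Q\<in>near_cells (DIM('a) + 2) k x. v Q) / total)"
proof -
  let ?N = "near_cells (DIM('a) + 2) k x"
  have fin: "finite ?N" by (rule near_cells_card)
  have "{0..<total} \<inter> point -` cball x (1 / 2 ^ k) \<subseteq> (\<Union>Q\<in>?N. slot k (rep Q))"
  proof
    fix t assume "t \<in> {0..<total} \<inter> point -` cball x (1 / 2 ^ k)"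
    then have t: "t \<in> {0..<total}" "dist (point t) x \<le> 1 / 2 ^ k" by (auto simp: dist_commute)
    obtain c where c: "c \<in> dyadic_cell 0 x0" "t \<in> slot k c" using slot_exists[OF t(1)] by blast
    have "dist c x \<le> dist (point t) c + dist (point t) x" by (metis dist_commute dist_triangle)
    also have "\<dots> \<le> real DIM('a) / 2 ^ k + 1 / 2 ^ k"
      by (intro add_mono t point_near[OF t(1) c]) simp
    also have "\<dots> = real (DIM('a) + 1) / 2 ^ k" by (simp add: add_divide_distrib)
    finally have "dyadic_cell k c \<in> near_cells (DIM('a) + 1 + 1) k x" by (rule near_cells_dist)
    moreover have "slot k (rep (dyadic_cell k c)) = slot k c"
      by (rule slot_cong, rule rep_in[of c]) simp
    ultimately show "t \<in> (\<Union>Q\<in>?N. slot k (rep Q))" using c(2) by auto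
  qed
  then have "emeasure lborel ({0..<total} \<inter> point -` cball x (1 / 2 ^ k)) \<le> emeasure lborel (\<Union>Q\<in>?N. slot k (rep Q))"
    using fin by (intro emeasure_mono) (auto simp: slot_def)
  also have "\<dots> \<le> (\<Sum>Q\<in>?N. emeasure lborel (slot k (rep Q)))"
    using fin by (intro emeasure_subadditive_finite) (auto simp: slot_def)
  also have "\<dots> \<le> (\<Sum>Q\<in>?N. ennreal (v Q))"
  proof (rule sum_mono)
    fix Q assume "Q \<in> ?N"
    then obtain y where y: "Q = dyadic_cell k y" by (auto simp: near_cells_def)
    then have "weight k (rep Q) = weight k y" using rep_in[of y Q] by (intro weight_cong) auto
    then have "weight k (rep Q) \<le> v Q" using weight_le[of k y] y by simp
    then show "emeasure lborel (slot k (rep Q)) \<le> ennreal (v Q)"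
      using weight_nonneg by (simp add: slot_def ennreal_leI)
  qed
  also have "\<dots> = ennreal (\<Sum>Q\<in>?N. v Q)" by (simp add: v_nonneg)
  finally have "emeasure lborel ({0..<total} \<inter> point -` cball x (1 / 2 ^ k)) / total \<le> ennreal (\<Sum>Q\<in>?N. v Q) / total"
    by (rule divide_right_mono_ennreal)
  then show ?thesis
    using total_pos by (simp add: emeasure_mass divide_ennreal sum_nonneg v_nonneg)
qed

end

text \<open>For \<open>s \<le> 0\<close> a Dirac measure works, so no lower bound on \<open>s\<close> is imposed.\<close>

theorem frostman:
  fixes B :: "'a::euclidean_space set"
  assumes B: "B \<in> sets borel" "B \<noteq> {}" and s: "ereal s < hausdorff_dim B"
  obtains K M C where "compact K" "K \<subseteq> B" "prob_space M" "sets M = sets borel" "emeasure M K = 1"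
    "C > 0" "\<And>x r. 0 < r \<Longrightarrow> r \<le> 1 \<Longrightarrow> emeasure M (cball x r) \<le> ennreal (C * r powr s)"
proof (cases "s \<le> 0")
  case True
  obtain x where x: "x \<in> B" using B by blast
  show thesis
  proof (rule that[of "{x}" "return borel x" 1])
    show "prob_space (return borel x)" by (rule prob_space_return) simp
    fix y r assume r: "0 < r" "r \<le> (1::real)"
    have "emeasure (return borel x) (cball y r) \<le> 1"
      by (simp add: indicator_def)
    also have "(1::ennreal) \<le> ennreal (1 * r powr s)"
      using r True powr_mono'[of s 0 r] by simp
    finally show "emeasure (return borel x) (cball y r) \<le> ennreal (1 * r powr s)" .
  qed (use x in auto)
next
  case False
  then have s0: "s > 0" by simp
  have "hausdorff_measure s B \<noteq> 0"
  proof
    assume "hausdorff_measure s B = 0"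
    then have "hausdorff_dim B \<le> ereal s" unfolding hausdorff_dim_def using s0 by (intro Inf_lower) auto
    then show False using s by simp
  qed
  then have "dyadic_content s B \<noteq> 0" using hausdorff_measure_zero_if_dyadic_content_zero[OF s0] by blast
  then have "0 < dyadic_content s (id ` B)" by (simp add: zero_less_iff_neq_zero)
  then obtain t where t: "0 < t" "t < dyadic_content s (id ` B)" using dense by blast
  obtain K where K: "compact K" "K \<subseteq> B" "\<And>U. open U \<Longrightarrow> id ` K \<subseteq> U \<Longrightarrow> t < dyadic_content s U"
  proof (rule capacity_compact_subset[where B = B and g = id and c = "dyadic_content s" and t = t])
    show "dyadic_content s (\<Union>n. A n) \<le> (SUP n. dyadic_content s (A n))" if "incseq A" for A :: "nat \<Rightarrow> 'a set"
      using dyadic.content_SUP_incseq[OF that] by simp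
  qed (use B t in \<open>auto intro: family_content_mono simp: continuous_on_id' id_def\<close>)
  \<comment> \<open>The capacity argument bounds only the content of open neighbourhoods of
    \<open>K\<close>. If \<open>K\<close> had content zero, an open neighbourhood of content at most
    \<open>t\<close> would contradict this.\<close>
  have pos: "dyadic_content s K \<noteq> 0"
  proof
    assume z: "dyadic_content s K = 0"
    obtain t' where t': "0 < t'" "ennreal t' \<le> t"
    proof (cases t)
      case (real r)
      then show ?thesis using t(1) by (intro that[of r]) auto
    next
      case top
      then show ?thesis by (intro that[of 1]) auto
    qed
    obtain U where "open U" "K \<subseteq> U" "dyadic_content s U \<le> ennreal t'"
      using dyadic_content_zero_open[OF s0 z t'(1)] .
    then show False using K(3)[of U] t'(2) by auto
  qed
  define v where "v Q = enn2real (dyadic_content s (K \<inter> Q))" for Q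
  define D where "D = real DIM('a) powr s"
  have fin: "dyadic_content s (K \<inter> dyadic_cell k x) < \<infinity>" for k x
    by (rule order_le_less_trans[OF dyadic_content_cell_le]) (use s0 in auto)
  have vle: "v (dyadic_cell k x) \<le> D * (1 / 2 ^ k) powr s" for k x
    unfolding v_def using dyadic_content_cell_le[of s K k x] s0
    by (intro enn2real_leI) (auto simp: D_def)
  \<comment> \<open>Finitely many unit cells cover the compact set, so by subadditivity one of them
    carries positive content.\<close>
  obtain x0 where x0: "0 < v (dyadic_cell 0 x0)"
  proof -
    obtain R where R: "K \<subseteq> ball 0 R" using K(1) compact_imp_bounded bounded_subset_ballD by metis
    define N where "N = near_cells (nat \<lceil>R\<rceil> + 1) 0 (0::'a)"
    have "K \<subseteq> (\<Union>Q\<in>N. K \<inter> Q)"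
    proof
      fix y assume y: "y \<in> K"
      then have "dist y 0 \<le> R" using R by (auto simp: dist_norm)
      then have "dist y 0 \<le> real (nat \<lceil>R\<rceil>) / 2 ^ 0" using real_nat_ceiling_ge[of R] by (simp del: of_nat_nat)
      then have "dyadic_cell 0 y \<in> N" unfolding N_def by (rule near_cells_dist)
      then show "y \<in> (\<Union>Q\<in>N. K \<inter> Q)" using y by blast
    qed
    then have "dyadic_content s K \<le> (\<Sum>Q\<in>N. dyadic_content s (K \<inter> Q))"
      by (intro family_content_subadditive) (auto simp: N_def near_cells_card)
    then have "(\<Sum>Q\<in>N. dyadic_content s (K \<inter> Q)) \<noteq> 0" using pos by auto
    then obtain Q where Q: "Q \<in> N" "dyadic_content s (K \<inter> Q) \<noteq> 0" by (meson sum.neutral)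
    then obtain x where "Q = dyadic_cell 0 x" by (auto simp: N_def near_cells_def)
    then have "0 < v (dyadic_cell 0 x)"
      using Q fin[of 0 x] by (simp add: v_def enn2real_positive_iff zero_less_iff_neq_zero)
    then show thesis by (rule that)
  qed
  interpret mass_distribution v x0 K
  proof
    show "0 \<le> v Q" for Q by (simp add: v_def)
    show "closed K" using K(1) by (rule compact_imp_closed)
    show "0 < v (dyadic_cell 0 x0)" by (rule x0)
    fix k and x :: 'a
    show "K \<inter> dyadic_cell k x \<noteq> {}" if "0 < v (dyadic_cell k x)"
    proof
      assume "K \<inter> dyadic_cell k x = {}"
      then have "dyadic_content s (K \<inter> dyadic_cell k x) \<le> emeasure (dyadic_cost s) ({} :: 'a set set)"
        by (intro family_content_le) auto
      then show False using that by (simp add: v_def)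
    qed
    have finc: "finite (child_cells k x)"
      using finite_descendants[of k 1 x] by (simp add: child_cells_def)
    have "ennreal (v (dyadic_cell k x)) = dyadic_content s (K \<inter> dyadic_cell k x)"
      using fin[of k x] by (simp add: v_def)
    also have "\<dots> \<le> (\<Sum>P\<in>child_cells k x. dyadic_content s (K \<inter> P))"
      using finc by (intro family_content_subadditive) (force simp: child_cells_def)+
    also have "\<dots> = (\<Sum>P\<in>child_cells k x. ennreal (v P))"
      using fin by (intro sum.cong) (auto simp: v_def child_cells_def)
    also have "\<dots> = ennreal (\<Sum>P\<in>child_cells k x. v P)" by (simp add: v_def)
    finally show "v (dyadic_cell k x) \<le> (\<Sum>P\<in>child_cells k x. v P)"
      by (subst (asm) ennreal_le_iff) (auto simp: v_def intro!: sum_nonneg)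
  qed
  define c where "c = real ((2 * (DIM('a) + 2) + 1) ^ DIM('a))"
  \<comment> \<open>The number of cells in a block, the bound for \<open>v\<close> on one cell, and
    the loss from rounding the radius to a power of two, normalised by the total mass.\<close>
  define C where "C = c * D * 2 powr s / total"
  have C: "C > 0" using total_pos by (simp add: C_def c_def D_def)
  show thesis
  proof (rule that[of K mass C])
    fix x :: 'a and r :: real assume r: "0 < r" "r \<le> 1"
    \<comment> \<open>The generation with \<open>r \<le> 1 / 2 ^ k \<le> 2 * r\<close>.\<close>
    define k where "k = nat \<lfloor>log 2 (1 / r)\<rfloor>"
    have lr: "0 \<le> log 2 (1 / r)" using r by simp
    have k: "real k \<le> log 2 (1 / r)" "log 2 (1 / r) < real k + 1"
      using lr by (auto simp: k_def)
    have "2 powr real k \<le> 1 / r" using k(1) r by (simp add: le_log_iff[symmetric])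
    then have rk: "r \<le> 1 / 2 ^ k" using r by (simp add: powr_realpow field_simps)
    have "1 / r < 2 powr (real k + 1)" using k(2) r by (simp add: log_less_iff)
    then have kr: "1 / 2 ^ k \<le> 2 * r" using r by (simp add: powr_add powr_realpow field_simps)
    have "emeasure mass (cball x r) \<le> emeasure mass (cball x (1 / 2 ^ k))"
      using rk by (intro emeasure_mono) auto
    also have "\<dots> \<le> ennreal ((\<Sum>Q\<in>near_cells (DIM('a) + 2) k x. v Q) / total)"
      by (rule emeasure_mass_cball)
    also have "\<dots> \<le> ennreal (C * r powr s)"
    proof (rule ennreal_leI)
      have "(\<Sum>Q\<in>near_cells (DIM('a) + 2) k x. v Q) \<le> (\<Sum>Q\<in>near_cells (DIM('a) + 2) k x. D * (1 / 2 ^ k) powr s)"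
        by (rule sum_mono) (auto simp: near_cells_def vle)
      also have "\<dots> \<le> c * (D * (1 / 2 ^ k) powr s)"
        unfolding sum_constant c_def
        by (intro mult_right_mono of_nat_mono near_cells_card) (auto simp: D_def)
      also have "\<dots> \<le> c * (D * (2 * r) powr s)"
        using kr s0 by (intro mult_left_mono powr_mono2) (auto simp: c_def D_def)
      also have "\<dots> = C * r powr s * total"
        using r total_pos by (simp add: C_def powr_mult)
      finally show "(\<Sum>Q\<in>near_cells (DIM('a) + 2) k x. v Q) / total \<le> C * r powr s"
        using total_pos by (simp add: divide_le_eq)
    qed
    finally show "emeasure mass (cball x r) \<le> ennreal (C * r powr s)" .
  qed (use \<open>compact K\<close> \<open>K \<subseteq> B\<close> C prob_space_mass emeasure_mass_K in auto)
qed

section \<open>Gaussians and Fourier transforms\<close>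

abbreviation ee :: "real \<Rightarrow> complex" where
  "ee t \<equiv> exp (- 2 * complex_of_real pi * \<i> * complex_of_real t)"

lemma norm_ee[simp]: "norm (ee t) = 1"
  by (simp add: norm_exp_eq_Re)

lemma ee_add: "ee (s + t) = ee s * ee t"
  by (simp add: ring_distribs flip: exp_add)

lemma ee_sum: "finite A \<Longrightarrow> ee (\<Sum>i\<in>A. f i) = (\<Prod>i\<in>A. ee (f i))"
  by (simp add: sum_distrib_left flip: exp_sum)

lemma cnj_ee: "cnj (ee t) = ee (- t)"
  by (simp add: exp_cnj)

text \<open>An affine change of variables reduces this to the characteristic function of the
  standard normal distribution.\<close>

lemma gaussian_fourier_1d:
  assumes a: "a > 0"
  shows "has_bochner_integral lborel (\<lambda>t::real. complex_of_real (exp (- pi * a * (t - c)\<^sup>2)) * ee (t * y))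
    (complex_of_real (1 / sqrt a * exp (- pi * y\<^sup>2 / a)) * ee (c * y))"
proof -
  \<comment> \<open>With this factor the exponent \<open>(\<kappa> * (t - c))\<^sup>2 / 2\<close> of
    the normal density becomes \<open>pi * a * (t - c)\<^sup>2\<close>; the \<open>s\<close> defined
    below is the frequency in the new variable.\<close>
  define \<kappa> where "\<kappa> = sqrt (2 * pi * a)"
  have \<kappa>: "\<kappa> > 0" "\<kappa>\<^sup>2 = 2 * pi * a" using a by (auto simp: \<kappa>_def)
  define s where "s = - 2 * pi * y / \<kappa>"
  define f where "f x = std_normal_density x *\<^sub>R iexp (s * x)" for x
  have int: "integrable lborel f"
    unfolding f_def
    by (rule Bochner_Integration.integrable_bound[OF integrable_normal_density[of 1 0]])
       (auto simp: normal_density_nonneg norm_exp_eq_Re)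
  have "integral\<^sup>L lborel f = char std_normal_distribution s"
    unfolding char_def f_def by (subst integral_density) (auto simp: normal_density_nonneg)
  then have "has_bochner_integral lborel f (complex_of_real (exp (- s\<^sup>2 / 2)))"
    using int by (simp add: has_bochner_integral_iff char_std_normal_distribution)
  then have "has_bochner_integral lborel (\<lambda>t. f (- \<kappa> * c + \<kappa> * t)) (complex_of_real (exp (- s\<^sup>2 / 2)) /\<^sub>R \<bar>\<kappa>\<bar>)"
    using \<kappa> by (subst (asm) lborel_has_bochner_integral_real_affine_iff[of \<kappa> _ _ "- \<kappa> * c"]) auto
  then have "has_bochner_integral lborel (\<lambda>t. (complex_of_real (sqrt (2 * pi)) * ee (c * y)) * f (- \<kappa> * c + \<kappa> * t))
    ((complex_of_real (sqrt (2 * pi)) * ee (c * y)) * (complex_of_real (exp (- s\<^sup>2 / 2)) /\<^sub>R \<bar>\<kappa>\<bar>))"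
    by (rule has_bochner_integral_mult_right) 
  moreover have "(complex_of_real (sqrt (2 * pi)) * ee (c * y)) * f (- \<kappa> * c + \<kappa> * t)
    = complex_of_real (exp (- pi * a * (t - c)\<^sup>2)) * ee (t * y)" for t
  proof -
    have 1: "- \<kappa> * c + \<kappa> * t = \<kappa> * (t - c)" by (simp add: algebra_simps)
    have "- (\<kappa> * (t - c))\<^sup>2 / 2 = - pi * a * (t - c)\<^sup>2" by (simp add: power_mult_distrib \<kappa>)
    moreover have "s * (\<kappa> * (t - c)) = - 2 * pi * (y * (t - c))" using \<kappa> by (simp add: s_def)
    ultimately have "f (\<kappa> * (t - c)) = complex_of_real (1 / sqrt (2 * pi) * exp (- pi * a * (t - c)\<^sup>2)) * ee (y * (t - c))"
      unfolding f_def std_normal_density_def by (simp add: scaleR_conv_of_real mult_ac)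
    moreover have "ee (c * y) * ee (y * (t - c)) = ee (t * y)"
      by (subst ee_add[symmetric]) (simp add: algebra_simps)
    moreover have "(complex_of_real r * z) * (complex_of_real (1 / r * G) * w) = complex_of_real G * (z * w)" if "r \<noteq> 0" for r G z w
      using that by simp
    ultimately show ?thesis unfolding 1 by simp
  qed
  moreover have "(complex_of_real (sqrt (2 * pi)) * ee (c * y)) * (complex_of_real (exp (- s\<^sup>2 / 2)) /\<^sub>R \<bar>\<kappa>\<bar>)
    = complex_of_real (1 / sqrt a * exp (- pi * y\<^sup>2 / a)) * ee (c * y)"
  proof -
    have "- s\<^sup>2 / 2 = - pi * y\<^sup>2 / a"
    proof -
      have "s\<^sup>2 = (2 * pi * y)\<^sup>2 / \<kappa>\<^sup>2" by (simp add: s_def power_divide power_mult_distrib)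
      also have "\<dots> = 2 * pi * y\<^sup>2 / a" unfolding \<kappa>(2) using a by (simp add: field_simps power2_eq_square)
      finally show ?thesis by simp
    qed
    moreover have "sqrt (2 * pi) / \<kappa> = 1 / sqrt a" using a by (simp add: \<kappa>_def real_sqrt_mult)
    moreover have "(complex_of_real r * z) * (complex_of_real X /\<^sub>R \<bar>\<kappa>\<bar>) = complex_of_real (r / \<kappa> * X) * z" for r X z
      using \<kappa> by (simp add: scaleR_conv_of_real field_simps)
    ultimately show ?thesis by (simp only:)
  qed
  ultimately show ?thesis by simp
qed

lemma has_bochner_integral_lborel_prod:
  fixes f :: "'a::euclidean_space \<Rightarrow> real \<Rightarrow> complex"
  assumes f: "\<And>b. b \<in> Basis \<Longrightarrow> has_bochner_integral lborel (f b) (I b)"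
  shows "has_bochner_integral lborel (\<lambda>x. \<Prod>b\<in>Basis. f b (x \<bullet> b)) (\<Prod>b\<in>Basis. I b)"
proof -
  interpret product_sigma_finite "\<lambda>b::'a. lborel :: real measure" ..
  have fm[measurable]: "f b \<in> borel_measurable borel" if "b \<in> Basis" for b
    using f[OF that] by (auto dest: has_bochner_integral_integrable borel_measurable_integrable)
  have int: "\<And>b. b \<in> Basis \<Longrightarrow> integrable lborel (f b)" and val: "\<And>b. b \<in> Basis \<Longrightarrow> integral\<^sup>L lborel (f b) = I b"
    using f by (auto simp: has_bochner_integral_iff)
  have eq: "(\<Prod>b\<in>Basis. f b ((\<Sum>b\<in>Basis. x b *\<^sub>R b) \<bullet> b)) = (\<Prod>b\<in>Basis. f b (x b))" for x
    by (intro prod.cong) auto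
  show ?thesis
    unfolding has_bochner_integral_iff
  proof
    show "integrable lborel (\<lambda>x. \<Prod>b\<in>Basis. f b (x \<bullet> b))"
      by (subst lborel_eq, subst integrable_distr_eq) (use product_integrable_prod[OF finite_Basis int] in \<open>auto simp: eq\<close>)
    show "(\<integral>x. (\<Prod>b\<in>Basis. f b (x \<bullet> b)) \<partial>lborel) = (\<Prod>b\<in>Basis. I b)"
      by (subst lborel_eq, subst integral_distr) (use product_integral_prod[OF finite_Basis int] in \<open>auto simp: eq val\<close>)
  qed
qed

text \<open>A separate width for each axis is what the slab estimate uses, where one direction is
  thin and the others are not.\<close>

lemma gaussian_fourier_aniso:
  fixes c y :: "'a::euclidean_space"
  assumes a: "\<And>b. b \<in> Basis \<Longrightarrow> a b > 0"
  shows "has_bochner_integral lborel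
    (\<lambda>x::'a. complex_of_real (exp (- pi * (\<Sum>b\<in>Basis. a b * (x \<bullet> b - c \<bullet> b)\<^sup>2))) * ee (x \<bullet> y))
    (complex_of_real ((\<Prod>b\<in>Basis. 1 / sqrt (a b)) * exp (- pi * (\<Sum>b\<in>Basis. (y \<bullet> b)\<^sup>2 / a b))) * ee (c \<bullet> y))"
proof -
  have "has_bochner_integral lborel
    (\<lambda>x::'a. \<Prod>b\<in>Basis. complex_of_real (exp (- pi * a b * (x \<bullet> b - c \<bullet> b)\<^sup>2)) * ee ((x \<bullet> b) * (y \<bullet> b)))
    (\<Prod>b\<in>Basis. complex_of_real (1 / sqrt (a b) * exp (- pi * (y \<bullet> b)\<^sup>2 / a b)) * ee ((c \<bullet> b) * (y \<bullet> b)))"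
    by (rule has_bochner_integral_lborel_prod) (rule gaussian_fourier_1d[OF a])
  moreover have "ee (x \<bullet> y) = (\<Prod>b\<in>Basis. ee ((x \<bullet> b) * (y \<bullet> b)))" for x :: 'a
    unfolding euclidean_inner[of x y] by (rule ee_sum) simp
  moreover have "exp (- pi * (\<Sum>b\<in>Basis. a b * (x \<bullet> b - c \<bullet> b)\<^sup>2)) = (\<Prod>b\<in>Basis. exp (- pi * a b * (x \<bullet> b - c \<bullet> b)\<^sup>2))" for x :: 'a
    by (simp add: sum_distrib_left mult.assoc flip: exp_sum sum_negf)
  moreover have "exp (- pi * (\<Sum>b\<in>Basis. (y \<bullet> b)\<^sup>2 / a b)) = (\<Prod>b\<in>Basis. exp (- pi * (y \<bullet> b)\<^sup>2 / a b))"
    by (simp add: sum_distrib_left flip: exp_sum sum_negf)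
  ultimately show ?thesis
    by (simp only: of_real_mult of_real_prod prod.distrib)
qed

lemma sum_Basis_square: "(\<Sum>b\<in>Basis. (x \<bullet> b)\<^sup>2) = (norm (x::'a::euclidean_space))\<^sup>2"
  using euclidean_inner[of x x] by (simp add: dot_square_norm flip: power2_eq_square)

lemma gaussian_fourier:
  fixes c y :: "'a::euclidean_space"
  assumes a: "a > 0"
  shows "has_bochner_integral lborel
    (\<lambda>x::'a. complex_of_real (exp (- pi * a * (norm (x - c))\<^sup>2)) * ee (x \<bullet> y))
    (complex_of_real (a powr (- real DIM('a) / 2) * exp (- pi * (norm y)\<^sup>2 / a)) * ee (c \<bullet> y))"
proof -
  have "(\<Sum>b\<in>Basis. a * (x \<bullet> b - c \<bullet> b)\<^sup>2) = a * (norm (x - c))\<^sup>2" for x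
    by (simp add: sum_Basis_square flip: sum_distrib_left inner_diff_left)
  moreover have "(\<Sum>b\<in>Basis. (y \<bullet> b)\<^sup>2 / a) = (norm y)\<^sup>2 / a"
    by (simp add: sum_Basis_square flip: sum_divide_distrib)
  moreover have "(\<Prod>b\<in>(Basis::'a set). 1 / sqrt a) = a powr (- real DIM('a) / 2)"
  proof -
    have "1 / sqrt a = a powr (- (1 / 2))" using a by (simp add: powr_minus_divide powr_half_sqrt)
    then have "(\<Prod>b\<in>(Basis::'a set). 1 / sqrt a) = (a powr (- (1 / 2))) ^ DIM('a)" by simp
    also have "\<dots> = a powr (- real DIM('a) / 2)"
      using a by (simp add: powr_powr flip: powr_realpow)
    finally show ?thesis .
  qed
  ultimately show ?thesis
    using gaussian_fourier_aniso[where a = "\<lambda>_. a" and c = c and y = y] a by (simp add: mult.assoc)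
qed

lemma nn_integral_gaussian_aniso:
  fixes c :: "'a::euclidean_space"
  assumes a: "\<And>b. b \<in> Basis \<Longrightarrow> a b > 0"
  shows "(\<integral>\<^sup>+x. ennreal (exp (- pi * (\<Sum>b\<in>Basis. a b * (x \<bullet> b - c \<bullet> b)\<^sup>2))) \<partial>lborel) = ennreal (\<Prod>b\<in>Basis. 1 / sqrt (a b))"
proof -
  have "has_bochner_integral lborel
    (\<lambda>x::'a. complex_of_real (exp (- pi * (\<Sum>b\<in>Basis. a b * (x \<bullet> b - c \<bullet> b)\<^sup>2)))) (complex_of_real (\<Prod>b\<in>Basis. 1 / sqrt (a b)))"
    using gaussian_fourier_aniso[where a = a and c = c and y = 0, OF a] by simp
  then have "has_bochner_integral lborel
    (\<lambda>x::'a. exp (- pi * (\<Sum>b\<in>Basis. a b * (x \<bullet> b - c \<bullet> b)\<^sup>2))) (\<Prod>b\<in>Basis. 1 / sqrt (a b))"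
    unfolding has_bochner_integral_iff by (simp only: complex_of_real_integrable_eq integral_complex_of_real of_real_eq_iff)
  then show ?thesis
    by (subst nn_integral_eq_integral) (auto simp: has_bochner_integral_iff)
qed

lemma nn_integral_gaussian:
  fixes c :: "'a::euclidean_space"
  assumes a: "a > 0"
  shows "(\<integral>\<^sup>+x. ennreal (exp (- pi * a * (norm (x - c))\<^sup>2)) \<partial>lborel) = ennreal (a powr (- real DIM('a) / 2))"
proof -
  have "has_bochner_integral lborel
    (\<lambda>x::'a. complex_of_real (exp (- pi * a * (norm (x - c))\<^sup>2))) (complex_of_real (a powr (- real DIM('a) / 2)))"
    using gaussian_fourier[OF a, where c = c and y = 0] by simp
  then have "has_bochner_integral lborel (\<lambda>x::'a. exp (- pi * a * (norm (x - c))\<^sup>2)) (a powr (- real DIM('a) / 2))"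
    unfolding has_bochner_integral_iff by (simp only: complex_of_real_integrable_eq integral_complex_of_real of_real_eq_iff)
  then show ?thesis
    by (subst nn_integral_eq_integral) (auto simp: has_bochner_integral_iff)
qed

text \<open>Jensen's inequality, obtained from the nonnegativity of the variance of the norm of
  \<open>f\<close>.\<close>

lemma (in prob_space) norm_expectation_square:
  fixes f :: "'a \<Rightarrow> complex"
  assumes [measurable]: "f \<in> borel_measurable M" and bd: "\<And>x. norm (f x) \<le> B"
  shows "ennreal ((norm (\<integral>x. f x \<partial>M))\<^sup>2) \<le> (\<integral>\<^sup>+x. ennreal ((norm (f x))\<^sup>2) \<partial>M)"
proof -
  have B: "0 \<le> B" using bd[of undefined] norm_ge_zero order_trans by blast
  have i1: "integrable M (\<lambda>x. norm (f x))" by (rule integrable_const_bound[of _ B]) (auto simp: bd)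
  have i2: "integrable M (\<lambda>x. (norm (f x))\<^sup>2)"
    by (rule integrable_const_bound[of _ "B\<^sup>2"]) (auto simp: bd power_mono)
  have "norm (\<integral>x. f x \<partial>M) \<le> expectation (\<lambda>x. norm (f x))" by (rule integral_norm_bound)
  then have "(norm (\<integral>x. f x \<partial>M))\<^sup>2 \<le> (expectation (\<lambda>x. norm (f x)))\<^sup>2" by (intro power_mono) auto
  also have "\<dots> \<le> expectation (\<lambda>x. (norm (f x))\<^sup>2)"
    using variance_positive[of "\<lambda>x. norm (f x)"] variance_eq[OF i1 i2] by simp
  finally show ?thesis
    using i2 by (subst nn_integral_eq_integral) (auto intro: ennreal_leI)
qed

section \<open>Fourier transforms of finite measures\<close>

lemma fourier_transform_measurable[measurable]:
  fixes M :: "'a::euclidean_space measure"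
  assumes "finite_measure M" and M[measurable_cong]: "sets M = sets borel"
  shows "fourier_transform M \<in> borel_measurable borel"
proof -
  interpret finite_measure M by fact
  show ?thesis
    unfolding fourier_transform_def[abs_def] by measurable
qed

lemma fourier_transform_bound:
  assumes "finite_measure M"
  shows "norm (fourier_transform M \<xi>) \<le> measure M (space M)"
proof -
  interpret finite_measure M by fact
  have "norm (fourier_transform M \<xi>) \<le> (LINT x|M. norm (ee (\<xi> \<bullet> x)))"
    unfolding fourier_transform_def by (rule integral_norm_bound)
  then show ?thesis by simp
qed

lemma fourier_transform_integrable:
  fixes M :: "'a::euclidean_space measure"
  assumes "finite_measure M" and M[measurable_cong]: "sets M = sets borel"
  shows "integrable M (\<lambda>x. ee (\<xi> \<bullet> x))"
proof -
  interpret finite_measure M by fact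
  show ?thesis by (rule integrable_const_bound[of _ 1]) auto
qed

lemma norm_fourier_transform_square:
  fixes M :: "'a::euclidean_space measure"
  assumes fin: "finite_measure M" and M[measurable_cong]: "sets M = sets borel"
  shows "complex_of_real ((norm (fourier_transform M \<xi>))\<^sup>2) = (LINT p|(M \<Otimes>\<^sub>M M). ee (\<xi> \<bullet> (fst p - snd p)))"
proof -
  interpret finite_measure M by fact
  interpret P: pair_sigma_finite M M ..
  interpret PF: finite_measure "M \<Otimes>\<^sub>M M" by (rule finite_measure_pair_measure) fact+
  have int: "integrable (M \<Otimes>\<^sub>M M) (\<lambda>p. ee (\<xi> \<bullet> (fst p - snd p)))"
    by (rule PF.integrable_const_bound[of _ 1]) auto
  have "complex_of_real ((norm (fourier_transform M \<xi>))\<^sup>2) = fourier_transform M \<xi> * cnj (fourier_transform M \<xi>)"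
    by (rule complex_norm_square)
  also have "\<dots> = (LINT x|M. ee (\<xi> \<bullet> x)) * (LINT y|M. ee (- (\<xi> \<bullet> y)))"
  proof -
    have "cnj (LINT x|M. ee (\<xi> \<bullet> x)) = (LINT x|M. cnj (ee (\<xi> \<bullet> x)))"
      by (rule integral_bounded_linear[OF bounded_linear_cnj fourier_transform_integrable[OF fin M], symmetric])
    then show ?thesis unfolding fourier_transform_def by (simp only: cnj_ee)
  qed
  also have "\<dots> = (LINT x|M. (LINT y|M. ee (\<xi> \<bullet> x) * ee (- (\<xi> \<bullet> y))))"
    by simp
  also have "\<dots> = (LINT x|M. (LINT y|M. ee (\<xi> \<bullet> (fst (x, y) - snd (x, y)))))"
  proof -
    have "ee (\<xi> \<bullet> x) * ee (- (\<xi> \<bullet> y)) = ee (\<xi> \<bullet> (x - y))" for x y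
      by (subst ee_add[symmetric]) (simp add: inner_diff_right)
    then show ?thesis by (simp only: fst_conv snd_conv)
  qed
  also have "\<dots> = (LINT p|(M \<Otimes>\<^sub>M M). ee (\<xi> \<bullet> (fst p - snd p)))"
    by (rule P.integral_fst'[OF int])
  finally show ?thesis .
qed

text \<open>Expand the square as a double integral of \<open>ee (\<zeta> \<bullet> (x - y))\<close>
  and integrate over \<zeta> before \<open>x\<close> and \<open>y\<close>. The identity serves in
  both directions: with \<open>a\<close> of order \<open>1 / R\<^sup>2\<close> it bounds the
  transform of a Frostman measure on a ball of radius \<open>R\<close>, and with
  \<open>a = r\<^sup>2\<close> it bounds correlations at scale \<open>r\<close> by the
  transform.\<close>

lemma gaussian_energy:
  fixes M :: "'a::euclidean_space measure"
  assumes fin: "finite_measure M" and M[measurable_cong]: "sets M = sets borel" and a: "a > 0"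
  shows "(\<integral>\<^sup>+\<zeta>. ennreal (exp (- pi * a * (norm \<zeta>)\<^sup>2) * (norm (fourier_transform M \<zeta>))\<^sup>2) \<partial>lborel)
    = ennreal (a powr (- real DIM('a) / 2)) * (\<integral>\<^sup>+x. \<integral>\<^sup>+y. ennreal (exp (- pi * (norm (x - y))\<^sup>2 / a)) \<partial>M \<partial>M)"
proof -
  interpret finite_measure M by fact
  interpret PF: finite_measure "M \<Otimes>\<^sub>M M" by (rule finite_measure_pair_measure) fact+
  interpret Q: pair_sigma_finite "lborel :: 'a measure" "M \<Otimes>\<^sub>M M" ..
  note [measurable] = fourier_transform_measurable[OF fin M]
  define g where "g \<zeta> = exp (- pi * a * (norm \<zeta>)\<^sup>2)" for \<zeta> :: 'a
  have gm[measurable]: "g \<in> borel_measurable borel" unfolding g_def[abs_def] by measurable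
  have gint: "integrable lborel g"
    unfolding g_def[abs_def] integrable_iff_bounded
    using nn_integral_gaussian[OF a, where c = "0::'a"] by auto
  define F where "F = (\<lambda>(\<zeta>, p::'a \<times> 'a). complex_of_real (g \<zeta>) * ee (\<zeta> \<bullet> (fst p - snd p)))"
  have Fm[measurable]: "F \<in> borel_measurable (lborel \<Otimes>\<^sub>M (M \<Otimes>\<^sub>M M))"
    unfolding F_def by measurable
  have nF: "norm (F (\<zeta>, p)) = g \<zeta>" for \<zeta> p by (simp add: F_def norm_mult g_def)
  have Fint: "integrable (lborel \<Otimes>\<^sub>M (M \<Otimes>\<^sub>M M)) F"
  proof (rule Q.Fubini_integrable)
    show "integrable lborel (\<lambda>\<zeta>. LINT p|(M \<Otimes>\<^sub>M M). norm (F (\<zeta>, p)))"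
      unfolding nF using gint by simp
    show "AE \<zeta> in lborel. integrable (M \<Otimes>\<^sub>M M) (\<lambda>p. F (\<zeta>, p))"
      by (intro AE_I2 PF.integrable_const_bound[of _ "g _"]) (auto simp: nF)
  qed measurable
  let ?c = "a powr (- real DIM('a) / 2)"
  have A: "(LINT \<zeta>|lborel. F (\<zeta>, p)) = complex_of_real (?c * exp (- pi * (norm (fst p - snd p))\<^sup>2 / a))" for p
    using has_bochner_integral_integral_eq[OF gaussian_fourier[OF a, where c = 0 and y = "fst p - snd p"]]
    by (simp add: F_def g_def)
  have B: "(LINT p|(M \<Otimes>\<^sub>M M). F (\<zeta>, p)) = complex_of_real (g \<zeta> * (norm (fourier_transform M \<zeta>))\<^sup>2)" for \<zeta>
    unfolding of_real_mult norm_fourier_transform_square[OF fin M] F_def by simp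
  have "(LINT \<zeta>|lborel. (LINT p|(M \<Otimes>\<^sub>M M). F (\<zeta>, p))) = (LINT p|(M \<Otimes>\<^sub>M M). (LINT \<zeta>|lborel. F (\<zeta>, p)))"
    using Q.Fubini_integral[of "\<lambda>\<zeta> p. F (\<zeta>, p)"] Fint by simp
  then have eq: "(LINT \<zeta>|lborel. g \<zeta> * (norm (fourier_transform M \<zeta>))\<^sup>2)
      = (LINT p|(M \<Otimes>\<^sub>M M). ?c * exp (- pi * (norm (fst p - snd p))\<^sup>2 / a))"
    unfolding A B by (simp only: integral_complex_of_real of_real_eq_iff)
  have i1: "integrable lborel (\<lambda>\<zeta>. g \<zeta> * (norm (fourier_transform M \<zeta>))\<^sup>2)"
  proof (rule Bochner_Integration.integrable_bound)
    show "integrable lborel (\<lambda>\<zeta>. (measure M (space M))\<^sup>2 * g \<zeta>)" using gint by simp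
    show "AE \<zeta> in lborel. norm (g \<zeta> * (norm (fourier_transform M \<zeta>))\<^sup>2) \<le> norm ((measure M (space M))\<^sup>2 * g \<zeta>)"
      using fourier_transform_bound[OF fin]
      by (intro AE_I2) (auto simp: g_def norm_mult mult.commute intro!: mult_right_mono power_mono)
  qed measurable
  have i2: "integrable (M \<Otimes>\<^sub>M M) (\<lambda>p. ?c * exp (- pi * (norm (fst p - snd p))\<^sup>2 / a))"
    using a by (intro PF.integrable_const_bound[of _ ?c]) (auto simp: mult_le_cancel_left1)
  have "(\<integral>\<^sup>+\<zeta>. ennreal (g \<zeta> * (norm (fourier_transform M \<zeta>))\<^sup>2) \<partial>lborel)
     = (\<integral>\<^sup>+p. ennreal (?c * exp (- pi * (norm (fst p - snd p))\<^sup>2 / a)) \<partial>(M \<Otimes>\<^sub>M M))"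
    using eq i1 i2 by (subst (1 2) nn_integral_eq_integral) (auto simp: g_def)
  also have "\<dots> = (\<integral>\<^sup>+x. \<integral>\<^sup>+y. ennreal ?c * ennreal (exp (- pi * (norm (x - y))\<^sup>2 / a)) \<partial>M \<partial>M)"
    by (subst nn_integral_fst[symmetric]) (auto simp: ennreal_mult)
  also have "\<dots> = ennreal ?c * (\<integral>\<^sup>+x. \<integral>\<^sup>+y. ennreal (exp (- pi * (norm (x - y))\<^sup>2 / a)) \<partial>M \<partial>M)"
    by (simp add: nn_integral_cmult)
  finally show ?thesis by (simp add: g_def)
qed

text \<open>The weight \<open>exp (\<pi> |y|\<^sup>2)\<close> is compensated by a Gaussian, whose Fourier transform is a Gaussian
  again; hence the transform of \<open>M\<close> is a Gaussian average of that of the weighted measure.\<close>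

lemma fourier_transform_locally_constant:
  fixes M :: "'a::euclidean_space measure"
  assumes fin: "finite_measure M" and M[measurable_cong]: "sets M = sets borel"
    and N_def: "N = density M (\<lambda>y. ennreal (exp (pi * (norm y)\<^sup>2)))" and finN: "finite_measure N"
  shows "ennreal ((norm (fourier_transform M \<eta>))\<^sup>2)
    \<le> (\<integral>\<^sup>+\<zeta>. ennreal (exp (- pi * (norm (\<zeta> - \<eta>))\<^sup>2) * (norm (fourier_transform N \<zeta>))\<^sup>2) \<partial>lborel)"
proof -
  interpret M: finite_measure M by fact
  interpret N: finite_measure N by fact
  have N[measurable_cong]: "sets N = sets borel" by (simp add: N_def M)
  interpret Q: pair_sigma_finite "lborel :: 'a measure" N ..
  note [measurable] = fourier_transform_measurable[OF finN N]
  define g where "g \<zeta> = exp (- pi * (norm (\<zeta> - \<eta>))\<^sup>2)" for \<zeta> :: 'a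
  have gm[measurable]: "g \<in> borel_measurable borel" unfolding g_def[abs_def] by measurable
  have g1: "(\<integral>\<^sup>+\<zeta>. ennreal (g \<zeta>) \<partial>lborel) = 1"
    using nn_integral_gaussian[where a = 1 and c = \<eta>] by (simp add: g_def)
  have gint: "integrable lborel g"
    unfolding integrable_iff_bounded using g1 by (auto simp: g_def)
  define F where "F = (\<lambda>(\<zeta>, y). complex_of_real (g \<zeta>) * ee (\<zeta> \<bullet> y))"
  have Fm[measurable]: "F \<in> borel_measurable (lborel \<Otimes>\<^sub>M N)"
    unfolding F_def by measurable
  have nF: "norm (F (\<zeta>, y)) = g \<zeta>" for \<zeta> y by (simp add: F_def norm_mult g_def)
  have Fint: "integrable (lborel \<Otimes>\<^sub>M N) F"
  proof (rule Q.Fubini_integrable)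
    show "integrable lborel (\<lambda>\<zeta>. LINT y|N. norm (F (\<zeta>, y)))"
      unfolding nF using gint by simp
    show "AE \<zeta> in lborel. integrable N (\<lambda>y. F (\<zeta>, y))"
      by (intro AE_I2 N.integrable_const_bound[of _ "g _"]) (auto simp: nF)
  qed measurable
  have "fourier_transform M \<eta> = (LINT y|M. exp (pi * (norm y)\<^sup>2) *\<^sub>R (complex_of_real (exp (- pi * (norm y)\<^sup>2)) * ee (\<eta> \<bullet> y)))"
    unfolding fourier_transform_def
    by (intro Bochner_Integration.integral_cong)
       (auto simp: scaleR_conv_of_real mult.assoc[symmetric] simp flip: of_real_mult exp_add)
  also have "\<dots> = (LINT y|N. complex_of_real (exp (- pi * (norm y)\<^sup>2)) * ee (\<eta> \<bullet> y))"
    unfolding N_def by (subst integral_density) auto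
  also have "\<dots> = (LINT y|N. (LINT \<zeta>|lborel. F (\<zeta>, y)))"
  proof (intro Bochner_Integration.integral_cong refl)
    fix y
    show "complex_of_real (exp (- pi * (norm y)\<^sup>2)) * ee (\<eta> \<bullet> y) = (LINT \<zeta>|lborel. F (\<zeta>, y))"
      using has_bochner_integral_integral_eq[OF gaussian_fourier[where a = 1 and c = \<eta> and y = y]]
      by (simp add: F_def g_def)
  qed
  also have "\<dots> = (LINT \<zeta>|lborel. (LINT y|N. F (\<zeta>, y)))"
    using Q.Fubini_integral[of "\<lambda>\<zeta> y. F (\<zeta>, y)"] Fint by simp
  also have "\<dots> = (LINT \<zeta>|lborel. g \<zeta> *\<^sub>R fourier_transform N \<zeta>)"
    by (simp add: F_def fourier_transform_def scaleR_conv_of_real)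
  also have "\<dots> = (LINT \<zeta>|density lborel g. fourier_transform N \<zeta>)"
    by (subst integral_density) (auto simp: g_def)
  finally have eq: "fourier_transform M \<eta> = (LINT \<zeta>|density lborel g. fourier_transform N \<zeta>)" .
  \<comment> \<open>The Gaussian centred at \<eta> has integral 1, so Jensen's inequality applies to
    the average.\<close>
  interpret P: prob_space "density lborel g"
    by standard (simp add: emeasure_density g1)
  have "ennreal ((norm (fourier_transform M \<eta>))\<^sup>2) \<le> (\<integral>\<^sup>+\<zeta>. ennreal ((norm (fourier_transform N \<zeta>))\<^sup>2) \<partial>density lborel g)"
    unfolding eq by (rule P.norm_expectation_square[OF _ fourier_transform_bound[OF finN]]) simp
  also have "\<dots> = (\<integral>\<^sup>+\<zeta>. ennreal (g \<zeta> * (norm (fourier_transform N \<zeta>))\<^sup>2) \<partial>lborel)"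
    by (subst nn_integral_density) (auto simp: g_def ennreal_mult)
  finally show ?thesis by (simp add: g_def)
qed

section \<open>Gaussian integrals against Frostman measures\<close>

lemma ennreal_mult3:
  "0 \<le> a \<Longrightarrow> 0 \<le> b \<Longrightarrow> 0 \<le> c \<Longrightarrow> ennreal a * (ennreal b * ennreal c) = ennreal (a * (b * c))"
  by (simp add: ennreal_mult)

lemma square_add_le: "(a + b)\<^sup>2 \<le> 2 * a\<^sup>2 + 2 * (b::real)\<^sup>2"
  using sum_squares_bound[of a b] by (simp add: power2_sum)

lemma norm_diff_square_le:
  fixes u x y :: "'a::real_normed_vector"
  assumes "dist x u \<le> r"
  shows "(norm (u - y))\<^sup>2 \<le> 2 * (norm (x - y))\<^sup>2 + 2 * r\<^sup>2"
proof -
  have "norm (u - y) \<le> norm (x - y) + norm (u - x)"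
    using norm_triangle_ineq[of "x - y" "u - x"] by simp
  also have "\<dots> \<le> norm (x - y) + r" using assms by (simp add: dist_norm norm_minus_commute)
  finally have "(norm (u - y))\<^sup>2 \<le> (norm (x - y) + r)\<^sup>2" by (intro power_mono) auto
  also note square_add_le
  finally show ?thesis .
qed

text \<open>Replacing a point by the average over a ball of radius \<open>r\<close> trades \<open>M\<close> for Lebesgue measure.\<close>

lemma nn_integral_le_lborel:
  fixes M :: "'a::euclidean_space measure" and f g :: "'a \<Rightarrow> ennreal"
  assumes fin: "finite_measure M" and M[measurable_cong]: "sets M = sets borel" and r: "r > 0" and A: "0 \<le> A"
    and ball: "\<And>x. emeasure M (cball x r) \<le> ennreal A"
    and g[measurable]: "g \<in> borel_measurable borel" and fg: "\<And>x u. dist x u \<le> r \<Longrightarrow> f x \<le> g u"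
  shows "(\<integral>\<^sup>+x. f x \<partial>M) \<le> ennreal (A / (unit_ball_vol DIM('a) * r ^ DIM('a))) * (\<integral>\<^sup>+u. g u \<partial>lborel)"
proof -
  interpret finite_measure M by fact
  interpret Q: pair_sigma_finite M "lborel :: 'a measure" ..
  define V where "V = unit_ball_vol DIM('a) * r ^ DIM('a)"
  have V: "V > 0" using r by (simp add: V_def)
  have f_le: "f x \<le> ennreal (1 / V) * (\<integral>\<^sup>+u. (if dist x u \<le> r then g u else 0) \<partial>lborel)" for x
  proof -
    have "f x = ennreal (1 / V) * (f x * ennreal V)"
      using V by (simp add: mult.left_commute flip: ennreal_mult)
    also have "f x * ennreal V = f x * emeasure lborel (cball x r)"
      using r by (simp add: emeasure_cball V_def)
    also have "\<dots> = (\<integral>\<^sup>+u. f x * indicator (cball x r) u \<partial>lborel)"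
      by (simp add: nn_integral_cmult_indicator)
    also have "\<dots> \<le> (\<integral>\<^sup>+u. (if dist x u \<le> r then g u else 0) \<partial>lborel)"
      using fg by (intro nn_integral_mono) (auto simp: indicator_def)
    finally show ?thesis by (simp add: mult_left_mono)
  qed
  have "(\<integral>\<^sup>+x. f x \<partial>M) \<le> (\<integral>\<^sup>+x. ennreal (1 / V) * (\<integral>\<^sup>+u. (if dist x u \<le> r then g u else 0) \<partial>lborel) \<partial>M)"
    by (intro nn_integral_mono f_le)
  also have "\<dots> = ennreal (1 / V) * (\<integral>\<^sup>+x. \<integral>\<^sup>+u. (if dist x u \<le> r then g u else 0) \<partial>lborel \<partial>M)"
    by (intro nn_integral_cmult) measurable
  also have "(\<integral>\<^sup>+x. \<integral>\<^sup>+u. (if dist x u \<le> r then g u else 0) \<partial>lborel \<partial>M)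
     = (\<integral>\<^sup>+u. \<integral>\<^sup>+x. (if dist x u \<le> r then g u else 0) \<partial>M \<partial>lborel)"
    by (rule Q.Fubini'[symmetric]) measurable
  also have "\<dots> = (\<integral>\<^sup>+u. g u * emeasure M (cball u r) \<partial>lborel)"
  proof (intro nn_integral_cong)
    fix u
    have "(\<integral>\<^sup>+x. (if dist x u \<le> r then g u else 0) \<partial>M) = (\<integral>\<^sup>+x. g u * indicator (cball u r) x \<partial>M)"
      by (intro nn_integral_cong) (auto simp: indicator_def dist_commute)
    then show "(\<integral>\<^sup>+x. (if dist x u \<le> r then g u else 0) \<partial>M) = g u * emeasure M (cball u r)"
      by (simp add: nn_integral_cmult_indicator M)
  qed
  also have "\<dots> \<le> (\<integral>\<^sup>+u. ennreal A * g u \<partial>lborel)"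
    by (intro nn_integral_mono) (subst mult.commute, intro mult_right_mono ball, simp)
  also have "\<dots> = ennreal A * (\<integral>\<^sup>+u. g u \<partial>lborel)" by (simp add: nn_integral_cmult)
  finally have "(\<integral>\<^sup>+x. f x \<partial>M) \<le> ennreal (1 / V) * (ennreal A * (\<integral>\<^sup>+u. g u \<partial>lborel))"
    by (simp add: mult_left_mono)
  also have "\<dots> = ennreal (A / V) * (\<integral>\<^sup>+u. g u \<partial>lborel)"
    using V A by (simp add: mult.assoc[symmetric] flip: ennreal_mult)
  finally show ?thesis by (simp add: V_def)
qed

lemma powr_half_dim: "0 < x \<Longrightarrow> (1 / x\<^sup>2) powr (- real n / 2) = x ^ n"
  by (simp add: powr_minus powr_divide powr_powr powr_realpow[symmetric] powr_numeral[symmetric] del: powr_numeral)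

locale frostman_measure =
  fixes M :: "'a::euclidean_space measure" and C s :: real
  assumes fin: "finite_measure M" and M[measurable_cong]: "sets M = sets borel" and C: "0 < C"
    and ball: "\<And>x r. 0 < r \<Longrightarrow> r \<le> 1 \<Longrightarrow> emeasure M (cball x r) \<le> ennreal (C * r powr s)"
begin

sublocale finite_measure M by (rule fin)

text \<open>Moving by at most \<open>r\<close> costs the factor \<open>exp pi\<close> and doubles
  the variance of the Gaussian. Its Lebesgue integral is of order \<open>r ^ DIM('a)\<close>, which
  cancels the volume of the ball and leaves \<open>r powr s\<close>.\<close>

lemma gaussian_le:
  "\<exists>C'>0. \<forall>r y. 0 < r \<and> r \<le> 1 \<longrightarrow>
    (\<integral>\<^sup>+x. ennreal (exp (- pi * (norm (x - y))\<^sup>2 / r\<^sup>2)) \<partial>M) \<le> ennreal (C' * r powr s)"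
proof -
  define C' where "C' = C / unit_ball_vol DIM('a) * (exp pi * 2 powr (real DIM('a) / 2))"
  show ?thesis
  proof (intro exI[of _ C'] conjI allI impI)
    show "0 < C'" using C by (simp add: C'_def)
    fix r :: real and y :: 'a assume r: "0 < r \<and> r \<le> 1"
    let ?g = "\<lambda>u. ennreal (exp pi) * ennreal (exp (- pi * (1 / (2 * r\<^sup>2)) * (norm (u - y))\<^sup>2))"
    have "(\<integral>\<^sup>+x. ennreal (exp (- pi * (norm (x - y))\<^sup>2 / r\<^sup>2)) \<partial>M)
      \<le> ennreal (C * r powr s / (unit_ball_vol DIM('a) * r ^ DIM('a))) * (\<integral>\<^sup>+u. ?g u \<partial>lborel)"
    proof (rule nn_integral_le_lborel[OF fin M])
      fix x u :: 'a assume "dist x u \<le> r"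
      from norm_diff_square_le[OF this, of y]
      have "(norm (u - y))\<^sup>2 / (2 * r\<^sup>2) \<le> (2 * (norm (x - y))\<^sup>2 + 2 * r\<^sup>2) / (2 * r\<^sup>2)"
        using r by (intro divide_right_mono) auto
      also have "\<dots> = (norm (x - y))\<^sup>2 / r\<^sup>2 + 1" using r by (simp add: field_simps)
      finally have "pi * ((norm (u - y))\<^sup>2 / (2 * r\<^sup>2)) \<le> pi * ((norm (x - y))\<^sup>2 / r\<^sup>2 + 1)" by (intro mult_left_mono) auto
      then have "- pi * (norm (x - y))\<^sup>2 / r\<^sup>2 \<le> pi + - pi * (1 / (2 * r\<^sup>2)) * (norm (u - y))\<^sup>2"
        by (simp add: algebra_simps)
      then have "exp (- pi * (norm (x - y))\<^sup>2 / r\<^sup>2) \<le> exp pi * exp (- pi * (1 / (2 * r\<^sup>2)) * (norm (u - y))\<^sup>2)"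
        by (simp only: exp_add[symmetric] exp_le_cancel_iff)
      then show "ennreal (exp (- pi * (norm (x - y))\<^sup>2 / r\<^sup>2)) \<le> ?g u"
        by (simp only: ennreal_mult[symmetric] exp_ge_zero ennreal_leI)
    qed (use r C ball in auto)
    also have "(\<integral>\<^sup>+u. ?g u \<partial>lborel) = ennreal (exp pi) * ennreal ((1 / (2 * r\<^sup>2)) powr (- real DIM('a) / 2))"
      by (subst nn_integral_cmult, measurable) (subst nn_integral_gaussian, use r in auto)
    also have "(1 / (2 * r\<^sup>2)) powr (- real DIM('a) / 2) = 2 powr (real DIM('a) / 2) * r ^ DIM('a)"
    proof -
      have "(1 / (2 * r\<^sup>2)) powr (- real DIM('a) / 2) = (1 / 2) powr (- real DIM('a) / 2) * (1 / r\<^sup>2) powr (- real DIM('a) / 2)"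
        by (subst powr_mult[symmetric]) auto
      moreover have "(1 / 2 :: real) powr (- real DIM('a) / 2) = 2 powr (real DIM('a) / 2)"
        by (simp add: powr_minus powr_divide)
      ultimately show ?thesis using r powr_half_dim[of r "DIM('a)"] by (simp only:)
    qed
    also have "ennreal (C * r powr s / (unit_ball_vol DIM('a) * r ^ DIM('a))) * (ennreal (exp pi) * ennreal (2 powr (real DIM('a) / 2) * r ^ DIM('a)))
       = ennreal (C * r powr s / (unit_ball_vol DIM('a) * r ^ DIM('a)) * (exp pi * (2 powr (real DIM('a) / 2) * r ^ DIM('a))))"
      by (rule ennreal_mult3) (use r C in auto)
    also have "C * r powr s / (unit_ball_vol DIM('a) * r ^ DIM('a)) * (exp pi * (2 powr (real DIM('a) / 2) * r ^ DIM('a))) = C' * r powr s"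
      using r by (simp add: C'_def)
    finally show "(\<integral>\<^sup>+x. ennreal (exp (- pi * (norm (x - y))\<^sup>2 / r\<^sup>2)) \<partial>M) \<le> ennreal (C' * r powr s)" .
  qed
qed

text \<open>A slab of width \<open>r\<close> in a fixed ball has volume of order \<open>r\<close>,
  and passing from Lebesgue measure to \<open>M\<close> at scale \<open>r\<close> costs
  \<open>r powr (s - DIM('a))\<close>.\<close>

lemma slab_le:
  assumes L: "AE x in M. norm x \<le> L" "0 \<le> L" and \<beta>: "0 < \<beta>"
  shows "\<exists>C'>0. \<forall>r c b. 0 < r \<and> r \<le> 1 \<and> b \<in> Basis \<longrightarrow>
    (\<integral>\<^sup>+x. ennreal (exp (- pi * \<beta> * (x \<bullet> b - c)\<^sup>2 / r\<^sup>2)) \<partial>M) \<le> ennreal (C' * r powr (s - real DIM('a) + 1))"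
proof -
  \<comment> \<open>\<open>\<beta>\<close> pays for moving by \<open>r\<close> across the slab, and
    \<open>(L + 1)\<^sup>2\<close> for a unit Gaussian in the remaining directions, inserted to make
    the comparison function integrable.\<close>
  define H where "H = exp (pi * (\<beta> + (L + 1)\<^sup>2))"
  define C' where "C' = C / unit_ball_vol DIM('a) * (H * sqrt (2 / \<beta>))"
  show ?thesis
  proof (intro exI[of _ C'] conjI allI impI)
    show "0 < C'" using C \<beta> by (simp add: C'_def H_def)
    fix r c :: real and b0 :: 'a assume r: "0 < r \<and> r \<le> 1 \<and> b0 \<in> Basis"
    define a where "a b = (if b = b0 then \<beta> / (2 * r\<^sup>2) else 1)" for b :: 'a
    have a: "a b > 0" for b using r \<beta> by (auto simp: a_def)
    \<comment> \<open>The indicator changes nothing almost everywhere and confines the comparison to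
      points with \<open>norm u \<le> L + 1\<close>.\<close>
    let ?f = "\<lambda>x. ennreal (exp (- pi * \<beta> * (x \<bullet> b0 - c)\<^sup>2 / r\<^sup>2)) * indicator (cball 0 L) x"
    let ?S = "\<lambda>u. \<Sum>b\<in>Basis. a b * (u \<bullet> b - (c *\<^sub>R b0) \<bullet> b)\<^sup>2"
    let ?g = "\<lambda>u. ennreal H * ennreal (exp (- pi * ?S u))"
    have S_le: "?S u \<le> \<beta> / (2 * r\<^sup>2) * (u \<bullet> b0 - c)\<^sup>2 + (norm u)\<^sup>2" for u
    proof -
      have "?S u = \<beta> / (2 * r\<^sup>2) * (u \<bullet> b0 - c)\<^sup>2 + (\<Sum>b\<in>Basis - {b0}. a b * (u \<bullet> b - (c *\<^sub>R b0) \<bullet> b)\<^sup>2)"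
        using r by (subst sum.remove[of _ b0]) (auto simp: a_def)
      also have "(\<Sum>b\<in>Basis - {b0}. a b * (u \<bullet> b - (c *\<^sub>R b0) \<bullet> b)\<^sup>2) = (\<Sum>b\<in>Basis - {b0}. (u \<bullet> b)\<^sup>2)"
        using r by (intro sum.cong) (auto simp: a_def inner_not_same_Basis)
      also have "\<dots> \<le> (norm u)\<^sup>2"
        unfolding sum_Basis_square[symmetric] by (intro sum_mono2) auto
      finally show ?thesis by simp
    qed
    have "(\<integral>\<^sup>+x. ennreal (exp (- pi * \<beta> * (x \<bullet> b0 - c)\<^sup>2 / r\<^sup>2)) \<partial>M) = (\<integral>\<^sup>+x. ?f x \<partial>M)"
      using L(1) by (intro nn_integral_cong_AE) (auto simp: indicator_def elim!: eventually_mono)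
    also have "\<dots> \<le> ennreal (C * r powr s / (unit_ball_vol DIM('a) * r ^ DIM('a))) * (\<integral>\<^sup>+u. ?g u \<partial>lborel)"
    proof (rule nn_integral_le_lborel[OF fin M])
      fix x u :: 'a assume xu: "dist x u \<le> r"
      show "?f x \<le> ?g u"
      proof (cases "norm x \<le> L")
        case False
        then show ?thesis by (simp add: indicator_def)
      next
        case True
        have "norm u \<le> L + 1"
          using True xu r norm_triangle_sub[of u x] by (simp add: dist_norm norm_minus_commute)
        then have nu: "(norm u)\<^sup>2 \<le> (L + 1)\<^sup>2" by (intro power_mono) auto
        have "\<bar>(x - u) \<bullet> b0\<bar> \<le> r" using Basis_le_norm[of b0 "x - u"] xu r by (simp add: dist_norm)
        then have "dist (x \<bullet> b0) (u \<bullet> b0) \<le> r" by (simp add: dist_real_def inner_diff_left)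
        from norm_diff_square_le[OF this, of c]
        have "(u \<bullet> b0 - c)\<^sup>2 \<le> 2 * (x \<bullet> b0 - c)\<^sup>2 + 2 * r\<^sup>2" by simp
        then have "\<beta> / (2 * r\<^sup>2) * (u \<bullet> b0 - c)\<^sup>2 \<le> \<beta> / (2 * r\<^sup>2) * (2 * (x \<bullet> b0 - c)\<^sup>2 + 2 * r\<^sup>2)"
          using \<beta> by (intro mult_left_mono) auto
        also have "\<dots> = \<beta> * (x \<bullet> b0 - c)\<^sup>2 / r\<^sup>2 + \<beta>" using r by (simp add: field_simps)
        finally have "?S u \<le> \<beta> * (x \<bullet> b0 - c)\<^sup>2 / r\<^sup>2 + (\<beta> + (L + 1)\<^sup>2)" using S_le[of u] nu by linarith
        then have "pi * ?S u \<le> pi * (\<beta> * (x \<bullet> b0 - c)\<^sup>2 / r\<^sup>2 + (\<beta> + (L + 1)\<^sup>2))" by (intro mult_left_mono) auto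
        then have "- pi * \<beta> * (x \<bullet> b0 - c)\<^sup>2 / r\<^sup>2 \<le> pi * (\<beta> + (L + 1)\<^sup>2) + - pi * ?S u"
          by (simp add: distrib_left mult.assoc)
        then have "exp (- pi * \<beta> * (x \<bullet> b0 - c)\<^sup>2 / r\<^sup>2) \<le> H * exp (- pi * ?S u)"
          unfolding H_def exp_add[symmetric] exp_le_cancel_iff .
        then have "ennreal (exp (- pi * \<beta> * (x \<bullet> b0 - c)\<^sup>2 / r\<^sup>2)) \<le> ennreal (H * exp (- pi * ?S u))"
          by (rule ennreal_leI)
        also have "\<dots> = ?g u" by (rule ennreal_mult) (auto simp: H_def)
        finally show ?thesis using True by simp
      qed
    qed (use r C ball in auto)
    also have "(\<integral>\<^sup>+u. ?g u \<partial>lborel) = ennreal H * ennreal (\<Prod>b\<in>Basis. 1 / sqrt (a b))"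
      by (subst nn_integral_cmult, measurable) (subst nn_integral_gaussian_aniso, rule a, rule refl)
    also have "(\<Prod>b\<in>(Basis::'a set). 1 / sqrt (a b)) = (\<Prod>b\<in>(Basis::'a set). if b = b0 then 1 / sqrt (\<beta> / (2 * r\<^sup>2)) else 1)"
      by (intro prod.cong) (auto simp: a_def)
    also have "\<dots> = 1 / sqrt (\<beta> / (2 * r\<^sup>2))" using r by (subst prod.delta) auto
    also have "\<dots> = sqrt (2 / \<beta>) * r" using r by (simp add: real_sqrt_divide real_sqrt_mult)
    also have "ennreal (C * r powr s / (unit_ball_vol DIM('a) * r ^ DIM('a))) * (ennreal H * ennreal (sqrt (2 / \<beta>) * r))
       = ennreal (C * r powr s / (unit_ball_vol DIM('a) * r ^ DIM('a)) * (H * (sqrt (2 / \<beta>) * r)))"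
      by (rule ennreal_mult3) (use r C \<beta> in \<open>auto simp: H_def\<close>)
    also have "C * r powr s / (unit_ball_vol DIM('a) * r ^ DIM('a)) * (H * (sqrt (2 / \<beta>) * r)) = C' * r powr (s - real DIM('a) + 1)"
    proof -
      have "r powr (s - real DIM('a) + 1) = r powr s / r ^ DIM('a) * r"
        using r by (simp add: powr_add powr_diff powr_realpow)
      then show ?thesis by (simp add: C'_def)
    qed
    finally show "(\<integral>\<^sup>+x. ennreal (exp (- pi * \<beta> * (x \<bullet> b0 - c)\<^sup>2 / r\<^sup>2)) \<partial>M)
      \<le> ennreal (C' * r powr (s - real DIM('a) + 1))" .
  qed
qed

end

section \<open>The Fourier transform of the image measure\<close>

definition hadamard :: "real ^ 'n \<Rightarrow> real ^ 'n \<Rightarrow> real ^ 'n" where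
  "hadamard \<xi> x = (\<chi> i. \<xi> $ i * x $ i)"

definition coord_dilation :: "real ^ 'n \<Rightarrow> (real ^ 'n) \<times> (real ^ 'n) \<Rightarrow> real ^ 'n" where
  "coord_dilation x p = (\<chi> i. snd p $ i * x $ i + fst p $ i)"

lemma continuous_on_coord_dilation: "continuous_on UNIV (\<lambda>q. coord_dilation (fst q) (snd q))"
  unfolding coord_dilation_def by (intro continuous_intros)

lemma coord_dilation_measurable[measurable (raw)]:
  assumes "f \<in> borel_measurable M" "g \<in> borel_measurable M"
  shows "(\<lambda>x. coord_dilation (f x) (g x)) \<in> borel_measurable M"
  by (rule borel_measurable_continuous_Pair[OF assms continuous_on_coord_dilation])

lemma hadamard_measurable[measurable (raw)]:
  assumes "f \<in> borel_measurable M" "g \<in> borel_measurable M"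
  shows "(\<lambda>x. hadamard (f x) (g x)) \<in> borel_measurable M"
proof (rule borel_measurable_continuous_Pair[OF assms])
  show "continuous_on UNIV (\<lambda>q::(real^'n) \<times> (real^'n). hadamard (fst q) (snd q))"
    unfolding hadamard_def by (intro continuous_intros)
qed

text \<open>For fixed \<open>x\<close> the map is linear in the parameter \<open>p\<close>, so the
  phase is an inner product with \<open>p\<close> and the transform of \<nu> appears.\<close>

lemma inner_coord_dilation: "\<xi> \<bullet> coord_dilation x p = (\<xi>, hadamard \<xi> x) \<bullet> p"
  by (cases p) (simp add: coord_dilation_def hadamard_def inner_vec_def inner_prod_def algebra_simps sum.distrib)

lemma norm_hadamard_le:
  assumes "norm x \<le> L"
  shows "norm (hadamard \<xi> x) \<le> L * norm \<xi>"
proof -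
  have L: "0 \<le> L" using assms norm_ge_zero order_trans by blast
  have "norm (hadamard \<xi> x) \<le> norm (L *\<^sub>R \<xi>)"
  proof (rule norm_le_componentwise_cart)
    fix i
    have "\<bar>x $ i\<bar> \<le> L" using component_le_norm_cart[of x i] assms by linarith
    then show "norm (hadamard \<xi> x $ i) \<le> norm ((L *\<^sub>R \<xi>) $ i)"
      using L by (simp add: hadamard_def abs_mult mult.commute[of L] mult_left_mono)
  qed
  then show ?thesis using L by simp
qed

text \<open>The coordinate found here supplies the normal direction of the slab.\<close>

lemma large_coordinate:
  fixes \<xi> :: "real ^ 'n"
  obtains j where "norm \<xi> / real CARD('n) \<le> \<bar>\<xi> $ j\<bar>"
proof (rule ccontr)
  assume "\<not> thesis"
  then have "\<And>j. \<bar>\<xi> $ j\<bar> < norm \<xi> / real CARD('n)" by (meson not_le that)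
  then have "(\<Sum>j\<in>UNIV. \<bar>\<xi> $ j\<bar>) < (\<Sum>j\<in>(UNIV::'n set). norm \<xi> / real CARD('n))"
    by (intro sum_strict_mono) auto
  also have "\<dots> = norm \<xi>" by simp
  finally show False using norm_le_l1_cart[of \<xi>] by simp
qed

text \<open>The point \<open>(\<xi>, hadamard \<xi> x)\<close> has norm at most
  \<open>2 * R * (1 + L)\<close>, so half of the exponent can be traded for Gaussian decay of
  \<zeta> at scale \<open>R\<close>; the other half is kept for the slab estimate.\<close>

lemma dilation_kernel_le:
  fixes \<xi> x :: "real ^ 'n"
  assumes R: "1 \<le> R" and \<xi>: "norm \<xi> \<le> 2 * R" and x: "norm x \<le> L"
  shows "exp (- pi * (norm (\<zeta> - (\<xi>, hadamard \<xi> x)))\<^sup>2)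
    \<le> exp (2 * pi * (1 + L)\<^sup>2) * exp (- pi * (1 / (4 * R\<^sup>2)) * (norm \<zeta>)\<^sup>2) * exp (- pi * (1 / 2) * (norm (\<zeta> - (\<xi>, hadamard \<xi> x)))\<^sup>2)"
proof -
  let ?P = "(\<xi>, hadamard \<xi> x)"
  have L: "0 \<le> L" using x norm_ge_zero order_trans by blast
  have "norm ?P \<le> norm \<xi> + norm (hadamard \<xi> x)" by (rule norm_Pair_le)
  also have "\<dots> \<le> 2 * R + L * (2 * R)"
    using \<xi> L by (intro add_mono order_trans[OF norm_hadamard_le[OF x]] mult_left_mono) auto
  finally have "norm ?P \<le> 2 * R * (1 + L)" by (simp add: algebra_simps)
  then have P: "(norm ?P)\<^sup>2 \<le> (2 * R * (1 + L))\<^sup>2" by (intro power_mono) auto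
  have "norm \<zeta> \<le> norm (\<zeta> - ?P) + norm ?P" using norm_triangle_ineq[of "\<zeta> - ?P" ?P] by simp
  then have "(norm \<zeta>)\<^sup>2 \<le> (norm (\<zeta> - ?P) + norm ?P)\<^sup>2" by (intro power_mono) auto
  also note square_add_le
  finally have "(norm \<zeta>)\<^sup>2 \<le> 2 * (norm (\<zeta> - ?P))\<^sup>2 + 2 * (2 * R * (1 + L))\<^sup>2" using P by linarith
  then have "(norm \<zeta>)\<^sup>2 / (4 * R\<^sup>2) \<le> (2 * (norm (\<zeta> - ?P))\<^sup>2 + 2 * (2 * R * (1 + L))\<^sup>2) / (4 * R\<^sup>2)"
    by (intro divide_right_mono) auto
  also have "\<dots> = (norm (\<zeta> - ?P))\<^sup>2 / (2 * R\<^sup>2) + 2 * (1 + L)\<^sup>2"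
    using R by (simp add: field_simps power2_eq_square)
  also have "(norm (\<zeta> - ?P))\<^sup>2 / (2 * R\<^sup>2) \<le> (norm (\<zeta> - ?P))\<^sup>2 / 2"
  proof (rule divide_left_mono)
    show "2 \<le> 2 * R\<^sup>2" using R by (simp add: one_le_power)
  qed (use R in auto)
  finally have "pi * ((norm \<zeta>)\<^sup>2 / (4 * R\<^sup>2)) \<le> pi * ((norm (\<zeta> - ?P))\<^sup>2 / 2 + 2 * (1 + L)\<^sup>2)"
    by (intro mult_left_mono) auto
  then have "- pi * (norm (\<zeta> - ?P))\<^sup>2 \<le> 2 * pi * (1 + L)\<^sup>2 + - pi * (1 / (4 * R\<^sup>2)) * (norm \<zeta>)\<^sup>2 + - pi * (1 / 2) * (norm (\<zeta> - ?P))\<^sup>2"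
    by (simp add: distrib_left)
  then show ?thesis by (simp only: exp_add[symmetric] exp_le_cancel_iff)
qed

locale dilation_measure =
  fixes \<mu> :: "(real ^ 'n) measure" and \<nu> :: "((real ^ 'n) \<times> (real ^ 'n)) measure" and C1 s C2 t L1 L2 :: real
  assumes frost1: "frostman_measure \<mu> C1 s" and frost2: "frostman_measure \<nu> C2 t"
    and prob1: "prob_space \<mu>" and prob2: "prob_space \<nu>"
    and bdd1: "AE x in \<mu>. norm x \<le> L1" and bdd2: "AE y in \<nu>. norm y \<le> L2"
    and L1: "0 \<le> L1" and L2: "0 \<le> L2"
begin

sublocale m: frostman_measure \<mu> C1 s by (rule frost1)
sublocale n: frostman_measure \<nu> C2 t by (rule frost2)
sublocale mp: prob_space \<mu> by (rule prob1)
sublocale np: prob_space \<nu> by (rule prob2)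

lemma sets_mu[measurable_cong, simp]: "sets \<mu> = sets borel" by (rule m.M)
lemma sets_nu[measurable_cong, simp]: "sets \<nu> = sets borel" by (rule n.M)

definition image_measure :: "(real ^ 'n) measure" where
  "image_measure = distr (\<mu> \<Otimes>\<^sub>M \<nu>) borel (\<lambda>q. coord_dilation (fst q) (snd q))"

lemma sets_image[measurable_cong, simp]: "sets image_measure = sets borel"
  by (simp add: image_measure_def)

sublocale pair_prob_space \<mu> \<nu> ..

lemma prob_image: "prob_space image_measure"
  unfolding image_measure_def by (rule P.prob_space_distr) measurable

lemma fourier_nu_measurable[measurable]: "fourier_transform \<nu> \<in> borel_measurable borel"
  by (rule fourier_transform_measurable[OF n.fin sets_nu])

lemma fourier_image: "fourier_transform image_measure \<xi> = (LINT x|\<mu>. fourier_transform \<nu> (\<xi>, hadamard \<xi> x))"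
proof -
  have int: "integrable (\<mu> \<Otimes>\<^sub>M \<nu>) (\<lambda>q. ee (\<xi> \<bullet> coord_dilation (fst q) (snd q)))"
    by (rule P.integrable_const_bound[of _ 1]) auto
  have "fourier_transform image_measure \<xi> = (LINT q|(\<mu> \<Otimes>\<^sub>M \<nu>). ee (\<xi> \<bullet> coord_dilation (fst q) (snd q)))"
    unfolding fourier_transform_def image_measure_def by (rule integral_distr) measurable
  also have "\<dots> = (LINT x|\<mu>. LINT p|\<nu>. ee (\<xi> \<bullet> coord_dilation x p))"
    using integral_fst'[OF int] by simp
  finally show ?thesis by (simp add: inner_coord_dilation fourier_transform_def)
qed

lemma fourier_image_square_le:
  "ennreal ((norm (fourier_transform image_measure \<xi>))\<^sup>2) \<le> (\<integral>\<^sup>+x. ennreal ((norm (fourier_transform \<nu> (\<xi>, hadamard \<xi> x)))\<^sup>2) \<partial>\<mu>)"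
  unfolding fourier_image
  by (rule mp.norm_expectation_square[OF _ fourier_transform_bound[OF n.fin]]) measurable

text \<open>The weight that the local-constancy estimate demands. It is bounded almost everywhere,
  so the Frostman exponent \<open>t\<close> survives.\<close>

definition weighted :: "((real ^ 'n) \<times> (real ^ 'n)) measure" where
  "weighted = density \<nu> (\<lambda>y. ennreal (exp (pi * (norm y)\<^sup>2)))"

lemma sets_weighted[measurable_cong, simp]: "sets weighted = sets borel"
  by (simp add: weighted_def)

lemma emeasure_weighted_le:
  assumes [measurable]: "A \<in> sets borel"
  shows "emeasure weighted A \<le> ennreal (exp (pi * L2\<^sup>2)) * emeasure \<nu> A"
proof -
  have "emeasure weighted A = (\<integral>\<^sup>+y. ennreal (exp (pi * (norm y)\<^sup>2)) * indicator A y \<partial>\<nu>)"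
    unfolding weighted_def by (rule emeasure_density) auto
  also have "\<dots> \<le> (\<integral>\<^sup>+y. ennreal (exp (pi * L2\<^sup>2)) * indicator A y \<partial>\<nu>)"
  proof (rule nn_integral_mono_AE)
    show "AE y in \<nu>. ennreal (exp (pi * (norm y)\<^sup>2)) * indicator A y \<le> ennreal (exp (pi * L2\<^sup>2)) * indicator A y"
      using bdd2 by eventually_elim (auto intro!: mult_right_mono ennreal_leI power_mono)
  qed
  also have "\<dots> = ennreal (exp (pi * L2\<^sup>2)) * emeasure \<nu> A"
    by (simp add: nn_integral_cmult_indicator)
  finally show ?thesis .
qed

lemma finite_weighted: "finite_measure weighted"
proof
  have "emeasure weighted (space weighted) \<le> ennreal (exp (pi * L2\<^sup>2)) * emeasure \<nu> UNIV"
    using emeasure_weighted_le[of UNIV] sets_eq_imp_space_eq[OF sets_weighted] by simp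
  also have "\<dots> \<le> ennreal (exp (pi * L2\<^sup>2)) * 1"
    by (intro mult_left_mono np.measure_le_1) simp
  also have "\<dots> < \<infinity>" by simp
  finally show "emeasure weighted (space weighted) \<noteq> \<infinity>" by simp
qed

sublocale w: frostman_measure weighted "exp (pi * L2\<^sup>2) * C2" t
proof (rule frostman_measure.intro)
  fix x :: "(real ^ 'n) \<times> (real ^ 'n)" and r :: real
  assume r: "0 < r" "r \<le> 1"
  have "emeasure weighted (cball x r) \<le> ennreal (exp (pi * L2\<^sup>2)) * emeasure \<nu> (cball x r)"
    by (rule emeasure_weighted_le) simp
  also have "\<dots> \<le> ennreal (exp (pi * L2\<^sup>2)) * ennreal (C2 * r powr t)"
    by (intro mult_left_mono n.ball r) simp
  also have "\<dots> = ennreal (exp (pi * L2\<^sup>2) * C2 * r powr t)"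
    using n.C by (simp add: ennreal_mult mult.assoc)
  finally show "emeasure weighted (cball x r) \<le> ennreal (exp (pi * L2\<^sup>2) * C2 * r powr t)" .
next
  show "finite_measure weighted" by (rule finite_weighted)
  show "sets weighted = sets borel" by (rule sets_weighted)
  show "0 < exp (pi * L2\<^sup>2) * C2" using n.C by simp
qed

lemma fourier_weighted_measurable[measurable]: "fourier_transform weighted \<in> borel_measurable borel"
  by (rule fourier_transform_measurable[OF finite_weighted sets_weighted])

text \<open>For fixed \<xi> with a large coordinate \<open>j\<close>, closeness of
  \<open>hadamard \<xi> x\<close> to the second component of \<zeta> confines \<open>x $ j\<close>
  to an interval of length of order \<open>1 / R\<close>, which gives the slab factor. Closeness of
  \<xi> to the first component makes the integral over \<xi> bounded independently of the size of
  the shell.\<close>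

lemma kernel_integral_le:
  "\<exists>K>0. \<forall>R \<zeta>. 1 \<le> R \<longrightarrow>
    (\<integral>\<^sup>+\<xi>. \<integral>\<^sup>+x. indicator {\<xi>. R \<le> norm \<xi> \<and> norm \<xi> \<le> 2 * R} \<xi> * ennreal (exp (- pi * (norm (\<zeta> - (\<xi>, hadamard \<xi> x)))\<^sup>2)) \<partial>\<mu> \<partial>lborel)
    \<le> ennreal (K * R powr (real CARD('n) - 1 - s) * exp (- pi * (1 / (4 * R\<^sup>2)) * (norm \<zeta>)\<^sup>2))"
proof -
  let ?d = "real CARD('n)"
  \<comment> \<open>The factor 1/2 is the retained half of the exponent; the square comes from the
    lower bound \<open>R / ?d\<close> for the large coordinate.\<close>
  define \<beta> where "\<beta> = 1 / (2 * ?d\<^sup>2)"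
  have \<beta>: "\<beta> > 0" by (simp add: \<beta>_def)
  obtain C3 where C3: "C3 > 0" and slab: "\<And>r c b. 0 < r \<Longrightarrow> r \<le> 1 \<Longrightarrow> b \<in> Basis \<Longrightarrow>
    (\<integral>\<^sup>+x. ennreal (exp (- pi * \<beta> * (x \<bullet> b - c)\<^sup>2 / r\<^sup>2)) \<partial>\<mu>) \<le> ennreal (C3 * r powr (s - real DIM(real^'n) + 1))"
    using m.slab_le[OF bdd1 L1 \<beta>] by blast
  define H where "H = exp (2 * pi * (1 + L1)\<^sup>2)"
  define G where "G = (1 / 2) powr (- ?d / 2)"
  have H: "H > 0" and G: "G > 0" by (simp_all add: H_def G_def)
  define K where "K = H * C3 * G"
  show ?thesis
  proof (intro exI[of _ K] conjI allI impI)
    show "0 < K" using H G C3 by (simp add: K_def)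
    fix R :: real and \<zeta> :: "(real ^ 'n) \<times> (real ^ 'n)" assume R: "1 \<le> R"
    let ?S = "{\<xi> :: real ^ 'n. R \<le> norm \<xi> \<and> norm \<xi> \<le> 2 * R}"
    let ?e = "exp (- pi * (1 / (4 * R\<^sup>2)) * (norm \<zeta>)\<^sup>2)"
    let ?q = "R powr (?d - 1 - s)"
    have inner: "(\<integral>\<^sup>+x. indicator ?S \<xi> * ennreal (exp (- pi * (norm (\<zeta> - (\<xi>, hadamard \<xi> x)))\<^sup>2)) \<partial>\<mu>)
      \<le> ennreal (H * ?e * (C3 * ?q)) * ennreal (exp (- pi * (1 / 2) * (norm (\<xi> - fst \<zeta>))\<^sup>2))" for \<xi>
    proof (cases "\<xi> \<in> ?S")
      case False
      then show ?thesis by simp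
    next
      case True
      then have \<xi>: "R \<le> norm \<xi>" "norm \<xi> \<le> 2 * R" by auto
      obtain j where j: "norm \<xi> / ?d \<le> \<bar>\<xi> $ j\<bar>" by (rule large_coordinate)
      then have jR: "R / ?d \<le> \<bar>\<xi> $ j\<bar>" using \<xi>(1) by (meson divide_right_mono of_nat_0_le_iff order_trans)
      have j0: "\<xi> $ j \<noteq> 0" using jR R by (auto simp: divide_le_0_iff)
      \<comment> \<open>The centre of the slab: the value of \<open>x $ j\<close> at which
        \<open>hadamard \<xi> x\<close> agrees with \<open>snd \<zeta>\<close> in coordinate
        \<open>j\<close>.\<close>
      define c where "c = snd \<zeta> $ j / \<xi> $ j"
      have bas: "axis j 1 \<in> (Basis :: (real ^ 'n) set)" by (simp add: axis_in_Basis_iff)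
      have split: "exp (- pi * (1 / 2) * (norm (\<zeta> - (\<xi>, hadamard \<xi> x)))\<^sup>2)
        \<le> exp (- pi * (1 / 2) * (norm (\<xi> - fst \<zeta>))\<^sup>2) * exp (- pi * \<beta> * (x \<bullet> axis j 1 - c)\<^sup>2 / (1 / R)\<^sup>2)" for x
      proof -
        have "\<beta> * (x $ j - c)\<^sup>2 * R\<^sup>2 = (R / ?d)\<^sup>2 * (x $ j - c)\<^sup>2 / 2"
          by (simp add: \<beta>_def power_divide mult.commute)
        also have "\<dots> \<le> \<bar>\<xi> $ j\<bar>\<^sup>2 * (x $ j - c)\<^sup>2 / 2"
          using jR R by (intro divide_right_mono mult_right_mono power_mono) auto
        also have "\<bar>\<xi> $ j\<bar>\<^sup>2 * (x $ j - c)\<^sup>2 = (\<xi> $ j * (x $ j - c))\<^sup>2" by (simp add: power_mult_distrib)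
        also have "\<xi> $ j * (x $ j - c) = - ((snd \<zeta> - hadamard \<xi> x) $ j)"
          using j0 by (simp add: c_def hadamard_def algebra_simps)
        also have "(- ((snd \<zeta> - hadamard \<xi> x) $ j))\<^sup>2 \<le> (norm (snd \<zeta> - hadamard \<xi> x))\<^sup>2"
          using component_le_norm_cart[of "snd \<zeta> - hadamard \<xi> x" j]
          by (metis power2_minus power2_abs abs_ge_zero power_mono)
        finally have "\<beta> * (x $ j - c)\<^sup>2 * R\<^sup>2 \<le> (norm (snd \<zeta> - hadamard \<xi> x))\<^sup>2 / 2" by simp
        moreover have "(norm (\<zeta> - (\<xi>, hadamard \<xi> x)))\<^sup>2 = (norm (\<xi> - fst \<zeta>))\<^sup>2 + (norm (snd \<zeta> - hadamard \<xi> x))\<^sup>2"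
          by (cases \<zeta>) (simp add: norm_Pair norm_minus_commute)
        ultimately have "(norm (\<xi> - fst \<zeta>))\<^sup>2 / 2 + \<beta> * (x $ j - c)\<^sup>2 * R\<^sup>2 \<le> (norm (\<zeta> - (\<xi>, hadamard \<xi> x)))\<^sup>2 / 2"
          by simp
        then have "pi * ((norm (\<xi> - fst \<zeta>))\<^sup>2 / 2 + \<beta> * (x $ j - c)\<^sup>2 * R\<^sup>2) \<le> pi * ((norm (\<zeta> - (\<xi>, hadamard \<xi> x)))\<^sup>2 / 2)"
          by (intro mult_left_mono) auto
        then have "- pi * (1 / 2) * (norm (\<zeta> - (\<xi>, hadamard \<xi> x)))\<^sup>2
          \<le> - pi * (1 / 2) * (norm (\<xi> - fst \<zeta>))\<^sup>2 + - pi * \<beta> * (x \<bullet> axis j 1 - c)\<^sup>2 / (1 / R)\<^sup>2"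
          using R by (simp add: inner_axis distrib_left power_divide mult.assoc)
        then show ?thesis by (simp only: exp_add[symmetric] exp_le_cancel_iff)
      qed
      have "(\<integral>\<^sup>+x. indicator ?S \<xi> * ennreal (exp (- pi * (norm (\<zeta> - (\<xi>, hadamard \<xi> x)))\<^sup>2)) \<partial>\<mu>)
        \<le> (\<integral>\<^sup>+x. ennreal (H * ?e * exp (- pi * (1 / 2) * (norm (\<xi> - fst \<zeta>))\<^sup>2))
              * ennreal (exp (- pi * \<beta> * (x \<bullet> axis j 1 - c)\<^sup>2 / (1 / R)\<^sup>2)) \<partial>\<mu>)"
      proof (rule nn_integral_mono_AE)
        show "AE x in \<mu>. indicator ?S \<xi> * ennreal (exp (- pi * (norm (\<zeta> - (\<xi>, hadamard \<xi> x)))\<^sup>2))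
          \<le> ennreal (H * ?e * exp (- pi * (1 / 2) * (norm (\<xi> - fst \<zeta>))\<^sup>2))
              * ennreal (exp (- pi * \<beta> * (x \<bullet> axis j 1 - c)\<^sup>2 / (1 / R)\<^sup>2))"
          using bdd1
        proof eventually_elim
          case (elim x)
          have "exp (- pi * (norm (\<zeta> - (\<xi>, hadamard \<xi> x)))\<^sup>2) \<le> H * ?e * exp (- pi * (1 / 2) * (norm (\<zeta> - (\<xi>, hadamard \<xi> x)))\<^sup>2)"
            unfolding H_def by (rule dilation_kernel_le[OF R \<xi>(2) elim])
          also have "\<dots> \<le> H * ?e * (exp (- pi * (1 / 2) * (norm (\<xi> - fst \<zeta>))\<^sup>2) * exp (- pi * \<beta> * (x \<bullet> axis j 1 - c)\<^sup>2 / (1 / R)\<^sup>2))"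
            using H by (intro mult_left_mono split) auto
          finally show ?case
            using True H by (simp add: ennreal_leI mult.assoc flip: ennreal_mult)
        qed
      qed
      also have "\<dots> = ennreal (H * ?e * exp (- pi * (1 / 2) * (norm (\<xi> - fst \<zeta>))\<^sup>2))
        * (\<integral>\<^sup>+x. ennreal (exp (- pi * \<beta> * (x \<bullet> axis j 1 - c)\<^sup>2 / (1 / R)\<^sup>2)) \<partial>\<mu>)"
        by (rule nn_integral_cmult) measurable
      also have "\<dots> \<le> ennreal (H * ?e * exp (- pi * (1 / 2) * (norm (\<xi> - fst \<zeta>))\<^sup>2)) * ennreal (C3 * (1 / R) powr (s - real DIM(real^'n) + 1))"
        using R bas by (intro mult_left_mono slab) auto
      also have "(1 / R) powr (s - real DIM(real^'n) + 1) = ?q"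
        using R by (simp add: powr_divide powr_minus_divide[symmetric] algebra_simps)
      also have "ennreal (H * ?e * exp (- pi * (1 / 2) * (norm (\<xi> - fst \<zeta>))\<^sup>2)) * ennreal (C3 * ?q)
        = ennreal (H * ?e * (C3 * ?q)) * ennreal (exp (- pi * (1 / 2) * (norm (\<xi> - fst \<zeta>))\<^sup>2))"
        using H C3 by (simp add: mult_ac flip: ennreal_mult)
      finally show ?thesis .
    qed
    have "(\<integral>\<^sup>+\<xi>. \<integral>\<^sup>+x. indicator ?S \<xi> * ennreal (exp (- pi * (norm (\<zeta> - (\<xi>, hadamard \<xi> x)))\<^sup>2)) \<partial>\<mu> \<partial>lborel)
      \<le> (\<integral>\<^sup>+\<xi>. ennreal (H * ?e * (C3 * ?q)) * ennreal (exp (- pi * (1 / 2) * (norm (\<xi> - fst \<zeta>))\<^sup>2)) \<partial>lborel)"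
      by (intro nn_integral_mono inner)
    also have "\<dots> = ennreal (H * ?e * (C3 * ?q)) * ennreal G"
      by (subst nn_integral_cmult, measurable) (subst nn_integral_gaussian, auto simp: G_def)
    also have "\<dots> = ennreal (K * ?q * ?e)"
      using H C3 G by (simp add: K_def mult_ac flip: ennreal_mult)
    finally show "(\<integral>\<^sup>+\<xi>. \<integral>\<^sup>+x. indicator ?S \<xi> * ennreal (exp (- pi * (norm (\<zeta> - (\<xi>, hadamard \<xi> x)))\<^sup>2)) \<partial>\<mu> \<partial>lborel)
      \<le> ennreal (K * ?q * ?e)" .
  qed
qed

text \<open>The kernel bound contributes \<open>R powr (CARD('n) - 1 - s)\<close>. The Gaussian
  energy of \<open>weighted\<close> at scale \<open>1 / (2 * R)\<close> contributes a multiple of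
  \<open>R powr (2 * CARD('n) - t)\<close>, since the parameter space has dimension
  \<open>2 * CARD('n)\<close>.\<close>

lemma shell_le:
  "\<exists>K>0. \<forall>R. 1 \<le> R \<longrightarrow>
    (\<integral>\<^sup>+\<xi>. indicator {\<xi>. R \<le> norm \<xi> \<and> norm \<xi> \<le> 2 * R} \<xi> * ennreal ((norm (fourier_transform image_measure \<xi>))\<^sup>2) \<partial>lborel)
    \<le> ennreal (K * R powr (3 * real CARD('n) - 1 - s - t))"
proof -
  let ?d = "real CARD('n)"
  obtain K where K: "K > 0" and ker: "\<And>R \<zeta>. 1 \<le> R \<Longrightarrow>
    (\<integral>\<^sup>+\<xi>. \<integral>\<^sup>+x. indicator {\<xi>. R \<le> norm \<xi> \<and> norm \<xi> \<le> 2 * R} \<xi> * ennreal (exp (- pi * (norm (\<zeta> - (\<xi>, hadamard \<xi> x)))\<^sup>2)) \<partial>\<mu> \<partial>lborel)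
    \<le> ennreal (K * R powr (?d - 1 - s) * exp (- pi * (1 / (4 * R\<^sup>2)) * (norm \<zeta>)\<^sup>2))"
    using kernel_integral_le by blast
  obtain C4 where C4: "C4 > 0" and gauss: "\<And>r y. 0 < r \<Longrightarrow> r \<le> 1 \<Longrightarrow>
    (\<integral>\<^sup>+x. ennreal (exp (- pi * (norm (x - y))\<^sup>2 / r\<^sup>2)) \<partial>weighted) \<le> ennreal (C4 * r powr t)"
    using w.gaussian_le by blast
  define W where "W = measure weighted (space weighted)"
  \<comment> \<open>\<open>W + 1\<close> in place of \<open>W\<close> makes the positivity of the
    constant immediate.\<close>
  define K' where "K' = K * 2 powr (2 * ?d - t) * C4 * (W + 1)"
  have W: "0 \<le> W" by (simp add: W_def)
  show ?thesis
  proof (intro exI[of _ K'] conjI allI impI)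
    show "0 < K'" using K C4 W by (simp add: K'_def)
    fix R :: real assume R: "1 \<le> R"
    let ?S = "{\<xi> :: real ^ 'n. R \<le> norm \<xi> \<and> norm \<xi> \<le> 2 * R}"
    let ?k = "\<lambda>\<xi> x \<zeta>. ennreal (exp (- pi * (norm (\<zeta> - (\<xi>, hadamard \<xi> x)))\<^sup>2))"
    let ?N = "\<lambda>\<zeta>. ennreal ((norm (fourier_transform weighted \<zeta>))\<^sup>2)"
    let ?q = "R powr (?d - 1 - s)"
    \<comment> \<open>The decay rate left by the kernel bound. It equals
      \<open>(1 / (2 * R))\<^sup>2\<close>, so the energy is evaluated at radius
      \<open>1 / (2 * R) \<le> 1\<close>, where the Frostman bound holds.\<close>
    define \<alpha> where "\<alpha> = 1 / (4 * R\<^sup>2)"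
    have \<alpha>: "\<alpha> > 0" using R by (simp add: \<alpha>_def)
    have [measurable]: "?S \<in> sets borel" by measurable
    interpret Q1: pair_sigma_finite \<mu> "lborel :: ((real^'n) \<times> (real^'n)) measure" ..
    have "(\<integral>\<^sup>+\<xi>. indicator ?S \<xi> * ennreal ((norm (fourier_transform image_measure \<xi>))\<^sup>2) \<partial>lborel)
      \<le> (\<integral>\<^sup>+\<xi>. \<integral>\<^sup>+x. \<integral>\<^sup>+\<zeta>. indicator ?S \<xi> * ?k \<xi> x \<zeta> * ?N \<zeta> \<partial>lborel \<partial>\<mu> \<partial>lborel)"
    proof (rule nn_integral_mono)
      fix \<xi> :: "real ^ 'n"
      have "indicator ?S \<xi> * ennreal ((norm (fourier_transform image_measure \<xi>))\<^sup>2)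
        \<le> indicator ?S \<xi> * (\<integral>\<^sup>+x. ennreal ((norm (fourier_transform \<nu> (\<xi>, hadamard \<xi> x)))\<^sup>2) \<partial>\<mu>)"
        by (intro mult_left_mono fourier_image_square_le) simp
      also have "\<dots> = (\<integral>\<^sup>+x. indicator ?S \<xi> * ennreal ((norm (fourier_transform \<nu> (\<xi>, hadamard \<xi> x)))\<^sup>2) \<partial>\<mu>)"
        by (rule nn_integral_cmult[symmetric]) measurable
      also have "\<dots> \<le> (\<integral>\<^sup>+x. \<integral>\<^sup>+\<zeta>. indicator ?S \<xi> * ?k \<xi> x \<zeta> * ?N \<zeta> \<partial>lborel \<partial>\<mu>)"
      proof (rule nn_integral_mono)
        fix x
        have "indicator ?S \<xi> * ennreal ((norm (fourier_transform \<nu> (\<xi>, hadamard \<xi> x)))\<^sup>2)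
          \<le> indicator ?S \<xi> * (\<integral>\<^sup>+\<zeta>. ennreal (exp (- pi * (norm (\<zeta> - (\<xi>, hadamard \<xi> x)))\<^sup>2) * (norm (fourier_transform weighted \<zeta>))\<^sup>2) \<partial>lborel)"
          by (intro mult_left_mono fourier_transform_locally_constant[OF n.fin sets_nu weighted_def finite_weighted]) simp
        also have "\<dots> = (\<integral>\<^sup>+\<zeta>. indicator ?S \<xi> * ?k \<xi> x \<zeta> * ?N \<zeta> \<partial>lborel)"
          by (subst nn_integral_cmult[symmetric], measurable) (simp add: ennreal_mult mult.assoc)
        finally show "indicator ?S \<xi> * ennreal ((norm (fourier_transform \<nu> (\<xi>, hadamard \<xi> x)))\<^sup>2)
          \<le> (\<integral>\<^sup>+\<zeta>. indicator ?S \<xi> * ?k \<xi> x \<zeta> * ?N \<zeta> \<partial>lborel)" .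
      qed
      finally show "indicator ?S \<xi> * ennreal ((norm (fourier_transform image_measure \<xi>))\<^sup>2)
        \<le> (\<integral>\<^sup>+x. \<integral>\<^sup>+\<zeta>. indicator ?S \<xi> * ?k \<xi> x \<zeta> * ?N \<zeta> \<partial>lborel \<partial>\<mu>)" .
    qed
    \<comment> \<open>The integral over \<zeta> is moved outermost, so that the kernel bound applies
      for each fixed \<zeta>.\<close>
    also have "\<dots> = (\<integral>\<^sup>+\<xi>. \<integral>\<^sup>+\<zeta>. \<integral>\<^sup>+x. indicator ?S \<xi> * ?k \<xi> x \<zeta> * ?N \<zeta> \<partial>\<mu> \<partial>lborel \<partial>lborel)"
      by (intro nn_integral_cong Q1.Fubini'[symmetric]) measurable
    also have "\<dots> = (\<integral>\<^sup>+\<zeta>. \<integral>\<^sup>+\<xi>. \<integral>\<^sup>+x. indicator ?S \<xi> * ?k \<xi> x \<zeta> * ?N \<zeta> \<partial>\<mu> \<partial>lborel \<partial>lborel)"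
      by (intro lborel_pair.Fubini'[symmetric]) measurable
    also have "\<dots> = (\<integral>\<^sup>+\<zeta>. (\<integral>\<^sup>+\<xi>. \<integral>\<^sup>+x. indicator ?S \<xi> * ?k \<xi> x \<zeta> \<partial>\<mu> \<partial>lborel) * ?N \<zeta> \<partial>lborel)"
    proof (intro nn_integral_cong)
      fix \<zeta> :: "(real^'n) \<times> (real^'n)"
      have "(\<integral>\<^sup>+x. indicator ?S \<xi> * ?k \<xi> x \<zeta> * ?N \<zeta> \<partial>\<mu>) = (\<integral>\<^sup>+x. indicator ?S \<xi> * ?k \<xi> x \<zeta> \<partial>\<mu>) * ?N \<zeta>" for \<xi>
        by (rule nn_integral_multc) measurable
      then have "(\<integral>\<^sup>+\<xi>. \<integral>\<^sup>+x. indicator ?S \<xi> * ?k \<xi> x \<zeta> * ?N \<zeta> \<partial>\<mu> \<partial>lborel)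
        = (\<integral>\<^sup>+\<xi>. (\<integral>\<^sup>+x. indicator ?S \<xi> * ?k \<xi> x \<zeta> \<partial>\<mu>) * ?N \<zeta> \<partial>lborel)" by (simp only:)
      also have "\<dots> = (\<integral>\<^sup>+\<xi>. (\<integral>\<^sup>+x. indicator ?S \<xi> * ?k \<xi> x \<zeta> \<partial>\<mu>) \<partial>lborel) * ?N \<zeta>"
        by (rule nn_integral_multc) measurable
      finally show "(\<integral>\<^sup>+\<xi>. \<integral>\<^sup>+x. indicator ?S \<xi> * ?k \<xi> x \<zeta> * ?N \<zeta> \<partial>\<mu> \<partial>lborel)
        = (\<integral>\<^sup>+\<xi>. (\<integral>\<^sup>+x. indicator ?S \<xi> * ?k \<xi> x \<zeta> \<partial>\<mu>) \<partial>lborel) * ?N \<zeta>" .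
    qed
    also have "\<dots> \<le> (\<integral>\<^sup>+\<zeta>. ennreal (K * ?q) * ennreal (exp (- pi * \<alpha> * (norm \<zeta>)\<^sup>2) * (norm (fourier_transform weighted \<zeta>))\<^sup>2) \<partial>lborel)"
    proof (rule nn_integral_mono)
      fix \<zeta> :: "(real^'n) \<times> (real^'n)"
      have "(\<integral>\<^sup>+\<xi>. \<integral>\<^sup>+x. indicator ?S \<xi> * ?k \<xi> x \<zeta> \<partial>\<mu> \<partial>lborel) * ?N \<zeta>
        \<le> ennreal (K * ?q * exp (- pi * \<alpha> * (norm \<zeta>)\<^sup>2)) * ?N \<zeta>"
        using ker[OF R, of \<zeta>] unfolding \<alpha>_def by (rule mult_right_mono) simp
      also have "\<dots> = ennreal (K * ?q) * ennreal (exp (- pi * \<alpha> * (norm \<zeta>)\<^sup>2) * (norm (fourier_transform weighted \<zeta>))\<^sup>2)"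
        using K by (simp add: mult.assoc flip: ennreal_mult)
      finally show "(\<integral>\<^sup>+\<xi>. \<integral>\<^sup>+x. indicator ?S \<xi> * ?k \<xi> x \<zeta> \<partial>\<mu> \<partial>lborel) * ?N \<zeta> \<le> \<dots>" .
    qed
    also have "\<dots> = ennreal (K * ?q) * (ennreal (\<alpha> powr (- real DIM((real^'n) \<times> (real^'n)) / 2))
        * (\<integral>\<^sup>+x. \<integral>\<^sup>+y. ennreal (exp (- pi * (norm (x - y))\<^sup>2 / \<alpha>)) \<partial>weighted \<partial>weighted))"
      by (subst nn_integral_cmult, measurable) (subst gaussian_energy[OF finite_weighted sets_weighted \<alpha>], rule refl)
    also have "\<dots> \<le> ennreal (K * ?q) * (ennreal (\<alpha> powr (- real DIM((real^'n) \<times> (real^'n)) / 2))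
        * (\<integral>\<^sup>+x. ennreal (C4 * (1 / (2 * R)) powr t) \<partial>weighted))"
    proof (intro mult_left_mono nn_integral_mono)
      fix x
      have "\<alpha> = (1 / (2 * R))\<^sup>2" by (simp add: \<alpha>_def power_divide)
      then have "(\<integral>\<^sup>+y. ennreal (exp (- pi * (norm (x - y))\<^sup>2 / \<alpha>)) \<partial>weighted)
        = (\<integral>\<^sup>+y. ennreal (exp (- pi * (norm (y - x))\<^sup>2 / (1 / (2 * R))\<^sup>2)) \<partial>weighted)"
        by (simp add: norm_minus_commute)
      also have "\<dots> \<le> ennreal (C4 * (1 / (2 * R)) powr t)" using R by (intro gauss) auto
      finally show "(\<integral>\<^sup>+y. ennreal (exp (- pi * (norm (x - y))\<^sup>2 / \<alpha>)) \<partial>weighted) \<le> ennreal (C4 * (1 / (2 * R)) powr t)" .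
    qed auto
    also have "(\<integral>\<^sup>+x. ennreal (C4 * (1 / (2 * R)) powr t) \<partial>weighted) = ennreal (C4 * (1 / (2 * R)) powr t) * ennreal W"
      by (simp add: W_def w.emeasure_eq_measure)
    also have "\<alpha> powr (- real DIM((real^'n) \<times> (real^'n)) / 2) = (2 * R) powr (2 * ?d)"
    proof -
      have "\<alpha> = (2 * R) powr (- 2)" using R by (simp add: \<alpha>_def powr_minus_divide power_mult_distrib)
      then show ?thesis using R by (simp only: powr_powr) simp
    qed
    also have "ennreal (K * ?q) * (ennreal ((2 * R) powr (2 * ?d)) * (ennreal (C4 * (1 / (2 * R)) powr t) * ennreal W))
      = ennreal (K * ?q * ((2 * R) powr (2 * ?d) * (C4 * (1 / (2 * R)) powr t * W)))"
      using K C4 W by (simp flip: ennreal_mult)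
    also have "\<dots> \<le> ennreal (K' * R powr (3 * ?d - 1 - s - t))"
    proof (rule ennreal_leI)
      have "(2 * R) powr (2 * ?d) * (1 / (2 * R)) powr t = (2 * R) powr (2 * ?d - t)"
        using R by (simp add: powr_diff powr_divide)
      also have "\<dots> = 2 powr (2 * ?d - t) * R powr (2 * ?d - t)" by (rule powr_mult)
      finally have "K * ?q * ((2 * R) powr (2 * ?d) * (C4 * (1 / (2 * R)) powr t * W))
        = K * 2 powr (2 * ?d - t) * C4 * W * (?q * R powr (2 * ?d - t))"
        by (simp add: mult_ac)
      also have "?q * R powr (2 * ?d - t) = R powr (3 * ?d - 1 - s - t)"
        by (subst powr_add[symmetric]) (simp add: algebra_simps)
      also have "K * 2 powr (2 * ?d - t) * C4 * W * R powr (3 * ?d - 1 - s - t) \<le> K' * R powr (3 * ?d - 1 - s - t)"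
        unfolding K'_def using K C4 W by (intro mult_right_mono mult_left_mono) auto
      finally show "K * ?q * ((2 * R) powr (2 * ?d) * (C4 * (1 / (2 * R)) powr t * W)) \<le> K' * R powr (3 * ?d - 1 - s - t)" .
    qed
    finally show "(\<integral>\<^sup>+\<xi>. indicator ?S \<xi> * ennreal ((norm (fourier_transform image_measure \<xi>))\<^sup>2) \<partial>lborel)
      \<le> ennreal (K' * R powr (3 * ?d - 1 - s - t))" .
  qed
qed

end

section \<open>Sobolev integrals and correlation integrals\<close>

lemma one_plus_powr_le:
  fixes x R p :: real
  assumes R: "1 \<le> R" and x: "R \<le> x" "x \<le> 2 * R"
  shows "(1 + x) powr p \<le> 4 powr \<bar>p\<bar> * R powr p"
proof (cases "0 \<le> p")
  case True
  have "(1 + x) powr p \<le> (4 * R) powr p" using True R x by (intro powr_mono2) auto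
  then show ?thesis using True R by (simp add: powr_mult)
next
  case False
  have "(1 + x) powr p \<le> R powr p" using False R x by (intro powr_mono2') auto
  also have "\<dots> = 1 * R powr p" by simp
  also have "\<dots> \<le> 4 powr \<bar>p\<bar> * R powr p" by (intro mult_right_mono ge_one_powr_ge_zero) auto
  finally show ?thesis .
qed

lemma dyadic_shell:
  fixes x :: real
  assumes "1 \<le> x"
  obtains k :: nat where "2 ^ k \<le> x" "x \<le> 2 * 2 ^ k"
proof -
  define k where "k = nat \<lfloor>log 2 x\<rfloor>"
  have "real k \<le> log 2 x" "log 2 x < real k + 1" using assms by (auto simp: k_def)
  then have "2 powr real k \<le> x" "x < 2 powr (real k + 1)"
    using assms by (auto simp: le_log_iff log_less_iff)
  then show thesis by (intro that[of k]) (auto simp: powr_realpow powr_add)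
qed

text \<open>The unit ball is harmless because the transform of a probability measure is bounded by
  1. The shell of radius \<open>2 ^ k\<close> contributes at most a multiple of
  \<open>(2 powr (p + q)) ^ k\<close>, and the geometric series converges.\<close>

lemma sobolev_integral_finite:
  fixes M :: "'a::euclidean_space measure"
  assumes M: "prob_space M" and sets_M: "sets M = sets borel" and K: "0 \<le> K"
    and shell: "\<And>R. 1 \<le> R \<Longrightarrow> (\<integral>\<^sup>+\<xi>. indicator {\<xi>. R \<le> norm \<xi> \<and> norm \<xi> \<le> 2 * R} \<xi> *
      ennreal ((norm (fourier_transform M \<xi>))\<^sup>2) \<partial>lborel) \<le> ennreal (K * R powr q)"
    and pq: "p + q < 0"
  shows "(\<integral>\<^sup>+x. ennreal ((norm (fourier_transform M x))\<^sup>2 * (1 + norm x) powr p) \<partial>lborel) < \<infinity>"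
proof -
  interpret prob_space M by fact
  have fin: "finite_measure M" by (rule finite_measure_axioms)
  note [measurable] = fourier_transform_measurable[OF fin sets_M]
  let ?f = "\<lambda>x. ennreal ((norm (fourier_transform M x))\<^sup>2)"
  define S where "S k = {\<xi> :: 'a. 2 ^ k \<le> norm \<xi> \<and> norm \<xi> \<le> 2 * 2 ^ k}" for k :: nat
  have [measurable]: "S k \<in> sets borel" for k unfolding S_def by measurable
  define c where "c = 4 powr \<bar>p\<bar>"
  have c: "1 \<le> c" unfolding c_def by (rule ge_one_powr_ge_zero) auto
  define h where "h k x = ennreal (c * (2 ^ k) powr p) * (indicator (S k) x * ?f x)" for k x
  have hm[measurable]: "h k \<in> borel_measurable borel" for k
    unfolding h_def[abs_def] by measurable
  have point: "ennreal ((norm (fourier_transform M x))\<^sup>2 * (1 + norm x) powr p)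
    \<le> ennreal c * indicator (cball 0 1) x + (\<Sum>k. h k x)" for x
  proof (cases "norm x \<le> 1")
    case True
    have "(norm (fourier_transform M x))\<^sup>2 \<le> 1\<^sup>2"
      using fourier_transform_bound[OF fin, of x] prob_space by (intro power_mono) auto
    moreover have "(1 + norm x) powr p \<le> c"
    proof -
      have "(1 + norm x) powr p \<le> (1 + norm x) powr \<bar>p\<bar>" by (intro powr_mono) auto
      also have "\<dots> \<le> c" unfolding c_def using True by (intro powr_mono2) auto
      finally show ?thesis .
    qed
    ultimately have "(norm (fourier_transform M x))\<^sup>2 * (1 + norm x) powr p \<le> 1 * c"
      by (intro mult_mono) auto
    then have "ennreal ((norm (fourier_transform M x))\<^sup>2 * (1 + norm x) powr p) \<le> ennreal c * indicator (cball 0 1) x"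
      using True by (simp add: ennreal_leI)
    then show ?thesis by (simp add: add_increasing2)
  next
    case False
    then obtain k :: nat where k: "2 ^ k \<le> norm x" "norm x \<le> 2 * 2 ^ k" using dyadic_shell[of "norm x"] by auto
    have "(1 + norm x) powr p \<le> c * (2 ^ k) powr p"
      unfolding c_def by (rule one_plus_powr_le) (use k in auto)
    then have "(norm (fourier_transform M x))\<^sup>2 * (1 + norm x) powr p \<le> c * (2 ^ k) powr p * (norm (fourier_transform M x))\<^sup>2"
      by (subst mult.commute) (intro mult_right_mono, auto)
    then have "ennreal ((norm (fourier_transform M x))\<^sup>2 * (1 + norm x) powr p) \<le> h k x"
      using k c by (simp add: h_def S_def ennreal_leI flip: ennreal_mult)
    also have "\<dots> \<le> (\<Sum>k. h k x)"
      using sum_le_suminf[of "\<lambda>k. h k x" "{k}"] by simp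
    finally show ?thesis by (simp add: add_increasing)
  qed
  have "(\<integral>\<^sup>+x. ennreal ((norm (fourier_transform M x))\<^sup>2 * (1 + norm x) powr p) \<partial>lborel)
    \<le> (\<integral>\<^sup>+x. ennreal c * indicator (cball 0 1) x + (\<Sum>k. h k x) \<partial>lborel)"
    by (intro nn_integral_mono point)
  also have "\<dots> = (\<integral>\<^sup>+x. ennreal c * indicator (cball 0 1) (x::'a) \<partial>lborel) + (\<integral>\<^sup>+x. (\<Sum>k. h k x) \<partial>lborel)"
    by (intro nn_integral_add borel_measurable_suminf_order borel_measurable_times_ennreal
        borel_measurable_const borel_measurable_indicator) auto
  also have "(\<integral>\<^sup>+x. (\<Sum>k. h k x) \<partial>lborel) = (\<Sum>k. \<integral>\<^sup>+x. h k x \<partial>lborel)"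
    by (intro nn_integral_suminf) auto
  also have "(\<integral>\<^sup>+x. ennreal c * indicator (cball 0 1) (x::'a) \<partial>lborel) = ennreal c * emeasure lborel (cball 0 1 :: 'a set)"
    by (simp add: nn_integral_cmult_indicator)
  also have "\<dots> + (\<Sum>k. \<integral>\<^sup>+x. h k x \<partial>lborel) < \<infinity>"
  proof -
    have "(\<Sum>k. \<integral>\<^sup>+x. h k x \<partial>lborel) \<le> (\<Sum>k. ennreal (c * K * (2 powr (p + q)) ^ k))"
    proof (intro suminf_le allI)
      fix k
      have "(\<integral>\<^sup>+x. h k x \<partial>lborel) = ennreal (c * (2 ^ k) powr p) * (\<integral>\<^sup>+x. indicator (S k) x * ?f x \<partial>lborel)"
        unfolding h_def by (rule nn_integral_cmult) measurable
      also have "\<dots> \<le> ennreal (c * (2 ^ k) powr p) * ennreal (K * (2 ^ k) powr q)"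
        unfolding S_def by (intro mult_left_mono shell) auto
      also have "\<dots> = ennreal (c * K * ((2 ^ k) powr p * (2 ^ k) powr q))"
        using c K by (simp add: mult_ac flip: ennreal_mult)
      also have "(2 ^ k) powr p * (2 ^ k) powr q = (2 powr (p + q)) ^ k"
        by (simp add: powr_add[symmetric] powr_powr powr_realpow[symmetric] algebra_simps del: powr_realpow)
      finally show "(\<integral>\<^sup>+x. h k x \<partial>lborel) \<le> ennreal (c * K * (2 powr (p + q)) ^ k)" .
    qed auto
    also have "\<dots> < \<infinity>"
    proof -
      have "summable (\<lambda>k. c * K * (2 powr (p + q)) ^ k)"
        using pq powr_less_mono[of "p + q" 0 2] by (intro summable_mult summable_geometric) auto
      then have "(\<Sum>k. ennreal (c * K * (2 powr (p + q)) ^ k)) = ennreal (\<Sum>k. c * K * (2 powr (p + q)) ^ k)"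
        using c K by (intro suminf_ennreal2) auto
      then show ?thesis by simp
    qed
    finally have "(\<Sum>k. \<integral>\<^sup>+x. h k x \<partial>lborel) < \<infinity>" .
    moreover have "ennreal c * emeasure lborel (cball 0 1 :: 'a set) < \<infinity>"
      using emeasure_lborel_cball_finite[of "0::'a" 1] by (simp add: ennreal_mult_less_top)
    ultimately show ?thesis by simp
  qed
  finally show ?thesis .
qed

section \<open>Compactly supported measures as competitors for the Sobolev dimension\<close>

lemma radon_measure_finite:
  fixes M :: "'a::euclidean_space measure"
  assumes "finite_measure M" "sets M = sets borel"
  shows "radon_measure M"
  unfolding radon_measure_def
proof (intro conjI allI impI ballI)
  interpret finite_measure M by fact
  show "sets M = sets borel" by fact
  show "emeasure M K < \<infinity>" for K using emeasure_finite[of K] by (simp add: less_top[symmetric])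
  fix B :: "'a set" assume B: "B \<in> sets borel"
  have "{K. compact K \<and> K \<subseteq> B} = {K. K \<subseteq> B \<and> compact K}" by auto
  then show "emeasure M B = (SUP K\<in>{K. compact K \<and> K \<subseteq> B}. emeasure M K)"
    using inner_regular[OF assms(2) _ B] by simp
qed

text \<open>The complement of \<open>K\<close> is an open null set, so the support lies in
  \<open>K\<close>; being closed, it is compact.\<close>

lemma compact_radon_measuresI:
  fixes M :: "'a::euclidean_space measure"
  assumes M: "prob_space M" "sets M = sets borel" and K: "compact K" "K \<subseteq> A" "emeasure M K = 1"
  shows "M \<in> compact_radon_measures A"
proof -
  interpret prob_space M by fact
  have space: "space M = UNIV" using sets_eq_imp_space_eq[OF M(2)] by simp
  have Km: "K \<in> sets M" using K M by (simp add: borel_compact)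
  have "emeasure M (- K) = 0"
    using emeasure_compl[OF Km] K emeasure_space_1 space by (simp add: Compl_eq_Diff_UNIV)
  moreover have "open (- K)" using compact_imp_closed[OF K(1)] by (rule open_Compl)
  ultimately have sub: "measure_support M \<subseteq> K"
    unfolding measure_support_def by fastforce
  have "- measure_support M = \<Union>{U. open U \<and> emeasure M U = 0}"
    unfolding measure_support_def by (auto simp: zero_less_iff_neq_zero)
  then have "open (- measure_support M)" by auto
  then have "closed (measure_support M)" by (simp add: closed_def)
  then have "compact (measure_support M)"
    using sub K(1) by (metis compact_Int_closed inf.absorb2)
  then show ?thesis
    using sub K radon_measure_finite[OF finite_measure_axioms M(2)] emeasure_space_1 space
    by (auto simp: compact_radon_measures_def)
qed

text \<open>The indicator of a ball of radius \<open>r\<close> is dominated by \<open>exp pi\<close>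
  times a Gaussian at scale \<open>r\<close>. On the frequency side this gives the factor
  \<open>r ^ DIM('a)\<close> and a Gaussian cutoff at \<open>1 / r\<close>, which is at most a
  multiple of \<open>r powr (\<sigma> - DIM('a))\<close> times the Sobolev weight.\<close>

lemma correlation_le:
  fixes M :: "'a::euclidean_space measure"
  assumes M: "prob_space M" and sets_M[measurable_cong]: "sets M = sets borel"
    and \<sigma>: "\<sigma> \<le> real DIM('a)"
    and fin: "(\<integral>\<^sup>+x. ennreal ((norm (fourier_transform M x))\<^sup>2 * (1 + norm x) powr (\<sigma> - real DIM('a))) \<partial>lborel) < \<infinity>"
  shows "\<exists>C>0. \<forall>r. 0 < r \<and> r \<le> 1 \<longrightarrow> (\<integral>\<^sup>+x. emeasure M (cball x r) \<partial>M) \<le> ennreal (C * r powr \<sigma>)"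
proof -
  interpret prob_space M by fact
  have finM: "finite_measure M" by (rule finite_measure_axioms)
  note [measurable] = fourier_transform_measurable[OF finM sets_M]
  let ?F = "\<lambda>x. (norm (fourier_transform M x))\<^sup>2"
  define I where "I = enn2real (\<integral>\<^sup>+x. ennreal (?F x * (1 + norm x) powr (\<sigma> - real DIM('a))) \<partial>lborel)"
  have I: "(\<integral>\<^sup>+x. ennreal (?F x * (1 + norm x) powr (\<sigma> - real DIM('a))) \<partial>lborel) = ennreal I" "0 \<le> I"
    using fin by (auto simp: I_def)
  define e where "e = real DIM('a) - \<sigma>"
  have e: "0 \<le> e" using \<sigma> by (simp add: e_def)
  define C where "C = exp pi * exp (e\<^sup>2) * (I + 1)"
  show ?thesis
  proof (intro exI[of _ C] conjI allI impI)
    show "0 < C" using I by (simp add: C_def)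
    fix r :: real assume r: "0 < r \<and> r \<le> 1"
    \<comment> \<open>Since \<open>r \<le> 1\<close> and \<open>0 \<le> e\<close>, the chain
      \<open>r * (1 + z) \<le> 1 + r * z \<le> exp (r * z)\<close> may be raised to the power
      \<open>e\<close>; the resulting factor \<open>exp (e * (r * z))\<close> is absorbed by
      completing the square.\<close>
    have gauss: "exp (- pi * r\<^sup>2 * z\<^sup>2) \<le> exp (e\<^sup>2) * r powr (- e) * (1 + z) powr (- e)" if z: "0 \<le> z" for z
    proof -
      have "(r * (1 + z)) powr e \<le> (1 + r * z) powr e"
        using r z e by (intro powr_mono2) (auto simp: algebra_simps)
      also have "\<dots> \<le> exp (r * z) powr e"
        using r z e exp_ge_add_one_self[of "r * z"] by (intro powr_mono2) auto
      also have "\<dots> = exp (e * (r * z))" by (simp add: powr_def)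
      finally have "(r * (1 + z)) powr e \<le> exp (e * (r * z))" .
      then have "exp (- pi * r\<^sup>2 * z\<^sup>2) * (r * (1 + z)) powr e \<le> exp (- pi * r\<^sup>2 * z\<^sup>2) * exp (e * (r * z))"
        by (intro mult_left_mono) auto
      also have "\<dots> = exp (e * (r * z) - pi * (r * z)\<^sup>2)"
        by (simp add: exp_add[symmetric] power_mult_distrib)
      also have "\<dots> \<le> exp (e\<^sup>2)"
      proof -
        have "1 * (r * z)\<^sup>2 \<le> pi * (r * z)\<^sup>2" using pi_gt3 by (intro mult_right_mono) auto
        moreover have "0 \<le> (e / 2 - r * z)\<^sup>2" by simp
        then have "e * (r * z) - (r * z)\<^sup>2 \<le> e\<^sup>2 / 4" by (simp add: power2_eq_square algebra_simps)
        moreover have "e\<^sup>2 / 4 \<le> e\<^sup>2" by simp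
        ultimately show ?thesis by (simp only: exp_le_cancel_iff)
      qed
      finally have "exp (- pi * r\<^sup>2 * z\<^sup>2) * (r * (1 + z)) powr e \<le> exp (e\<^sup>2)" .
      then have "exp (- pi * r\<^sup>2 * z\<^sup>2) \<le> exp (e\<^sup>2) / (r * (1 + z)) powr e"
        using r z by (simp add: pos_le_divide_eq)
      also have "\<dots> = exp (e\<^sup>2) * r powr (- e) * (1 + z) powr (- e)"
        using r z by (simp add: powr_mult powr_minus divide_inverse)
      finally show ?thesis .
    qed
    have "(\<integral>\<^sup>+x. emeasure M (cball x r) \<partial>M) \<le> (\<integral>\<^sup>+x. \<integral>\<^sup>+y. ennreal (exp pi) * ennreal (exp (- pi * (norm (x - y))\<^sup>2 / r\<^sup>2)) \<partial>M \<partial>M)"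
    proof (rule nn_integral_mono)
      fix x
      have "emeasure M (cball x r) = (\<integral>\<^sup>+y. indicator (cball x r) y \<partial>M)"
        by (rule nn_integral_indicator[symmetric]) (simp add: sets_M)
      also have "\<dots> \<le> (\<integral>\<^sup>+y. ennreal (exp pi) * ennreal (exp (- pi * (norm (x - y))\<^sup>2 / r\<^sup>2)) \<partial>M)"
      proof (rule nn_integral_mono)
        fix y
        show "indicator (cball x r) y \<le> ennreal (exp pi) * ennreal (exp (- pi * (norm (x - y))\<^sup>2 / r\<^sup>2))"
        proof (cases "y \<in> cball x r")
          case True
          then have "(norm (x - y))\<^sup>2 \<le> r\<^sup>2" by (intro power_mono) (auto simp: dist_norm)
          then have "(norm (x - y))\<^sup>2 / r\<^sup>2 \<le> 1" using r by simp
          then have "pi * ((norm (x - y))\<^sup>2 / r\<^sup>2) \<le> pi * 1" by (intro mult_left_mono) auto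
          then have "exp 0 \<le> exp (pi + - pi * (norm (x - y))\<^sup>2 / r\<^sup>2)" by (subst exp_le_cancel_iff) simp
          then have "1 \<le> exp pi * exp (- pi * (norm (x - y))\<^sup>2 / r\<^sup>2)" by (simp only: exp_add exp_zero)
          then show ?thesis using True by (simp flip: ennreal_mult)
        qed simp
      qed
      finally show "emeasure M (cball x r) \<le> (\<integral>\<^sup>+y. ennreal (exp pi) * ennreal (exp (- pi * (norm (x - y))\<^sup>2 / r\<^sup>2)) \<partial>M)" .
    qed
    also have "\<dots> = ennreal (exp pi) * (\<integral>\<^sup>+x. \<integral>\<^sup>+y. ennreal (exp (- pi * (norm (x - y))\<^sup>2 / r\<^sup>2)) \<partial>M \<partial>M)"
      by (simp add: nn_integral_cmult)
    also have "(\<integral>\<^sup>+x. \<integral>\<^sup>+y. ennreal (exp (- pi * (norm (x - y))\<^sup>2 / r\<^sup>2)) \<partial>M \<partial>M)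
      = ennreal (r ^ DIM('a)) * (\<integral>\<^sup>+\<zeta>. ennreal (exp (- pi * r\<^sup>2 * (norm \<zeta>)\<^sup>2) * ?F \<zeta>) \<partial>lborel)"
    proof -
      have "(r\<^sup>2) powr (- real DIM('a) / 2) = 1 / r ^ DIM('a)"
        using r powr_half_dim[of "1 / r" "DIM('a)"] by (simp add: power_divide)
      then have "ennreal (r ^ DIM('a)) * ennreal ((r\<^sup>2) powr (- real DIM('a) / 2)) = 1"
        using r by (simp flip: ennreal_mult)
      then show ?thesis
        using r by (subst gaussian_energy[OF finM sets_M]) (simp_all add: mult.assoc[symmetric])
    qed
    also have "(\<integral>\<^sup>+\<zeta>. ennreal (exp (- pi * r\<^sup>2 * (norm \<zeta>)\<^sup>2) * ?F \<zeta>) \<partial>lborel)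
      \<le> (\<integral>\<^sup>+\<zeta>. ennreal (exp (e\<^sup>2) * r powr (- e)) * ennreal (?F \<zeta> * (1 + norm \<zeta>) powr (\<sigma> - real DIM('a))) \<partial>lborel)"
    proof (rule nn_integral_mono)
      fix \<zeta> :: 'a
      have "exp (- pi * r\<^sup>2 * (norm \<zeta>)\<^sup>2) * ?F \<zeta> \<le> exp (e\<^sup>2) * r powr (- e) * (1 + norm \<zeta>) powr (- e) * ?F \<zeta>"
        by (intro mult_right_mono gauss) auto
      then have "exp (- pi * r\<^sup>2 * (norm \<zeta>)\<^sup>2) * ?F \<zeta> \<le> exp (e\<^sup>2) * r powr (- e) * (?F \<zeta> * (1 + norm \<zeta>) powr (\<sigma> - real DIM('a)))"
        by (simp add: e_def mult_ac)
      then show "ennreal (exp (- pi * r\<^sup>2 * (norm \<zeta>)\<^sup>2) * ?F \<zeta>)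
        \<le> ennreal (exp (e\<^sup>2) * r powr (- e)) * ennreal (?F \<zeta> * (1 + norm \<zeta>) powr (\<sigma> - real DIM('a)))"
        by (simp add: ennreal_leI flip: ennreal_mult)
    qed
    also have "\<dots> = ennreal (exp (e\<^sup>2) * r powr (- e)) * ennreal I"
      by (subst nn_integral_cmult) (auto simp: I)
    also have "ennreal (exp pi) * (ennreal (r ^ DIM('a)) * (ennreal (exp (e\<^sup>2) * r powr (- e)) * ennreal I))
      = ennreal (exp pi * (r ^ DIM('a) * (exp (e\<^sup>2) * r powr (- e) * I)))"
      using r I by (simp flip: ennreal_mult)
    also have "\<dots> \<le> ennreal (C * r powr \<sigma>)"
    proof (rule ennreal_leI)
      have "r ^ DIM('a) * r powr (- e) = r powr \<sigma>"
        using r by (simp add: powr_realpow[symmetric] powr_add[symmetric] e_def)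
      then have "exp pi * (r ^ DIM('a) * (exp (e\<^sup>2) * r powr (- e) * I)) = exp pi * exp (e\<^sup>2) * I * r powr \<sigma>"
        by (metis (no_types, lifting) mult.assoc mult.commute)
      also have "\<dots> \<le> C * r powr \<sigma>" unfolding C_def using I by (intro mult_right_mono mult_left_mono) auto
      finally show "exp pi * (r ^ DIM('a) * (exp (e\<^sup>2) * r powr (- e) * I)) \<le> C * r powr \<sigma>" .
    qed
    finally show "(\<integral>\<^sup>+x. emeasure M (cball x r) \<partial>M) \<le> ennreal (C * r powr \<sigma>)"
      by (simp add: mult_left_mono)
  qed
qed

section \<open>Lebesgue measure and Hausdorff dimension of the image\<close>

lemma ball_measure_measurable:
  fixes M :: "'a::euclidean_space measure"
  assumes "finite_measure M" and sets_M[measurable_cong]: "sets M = sets borel"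
  shows "(\<lambda>x. emeasure M (cball x r)) \<in> borel_measurable borel"
proof -
  interpret finite_measure M by fact
  have "(\<lambda>x. \<integral>\<^sup>+y. (if dist x y \<le> r then 1 else 0) \<partial>M) \<in> borel_measurable borel" by measurable
  moreover have "(\<integral>\<^sup>+y. (if dist x y \<le> r then 1 else 0) \<partial>M) = emeasure M (cball x r)" for x
  proof -
    have "(\<integral>\<^sup>+y. (if dist x y \<le> r then 1 else 0) \<partial>M) = (\<integral>\<^sup>+y. indicator (cball x r) y \<partial>M)"
      by (intro nn_integral_cong) (auto simp: indicator_def)
    then show ?thesis by (simp add: sets_M)
  qed
  ultimately show ?thesis by simp
qed

text \<open>The ball averages \<open>h u = M (cball u r)\<close> have total integral comparable to \<open>r^d\<close> and square
  integral at most comparable to \<open>r^(2d)\<close>, so by AM-GM they cannot live on a set of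
  small measure.\<close>

lemma lborel_pos_if_correlation:
  fixes M :: "'a::euclidean_space measure"
  assumes M: "prob_space M" and sets_M[measurable_cong]: "sets M = sets borel"
    and K: "compact K" "emeasure M K = 1" and C: "0 < C"
    and corr: "\<And>r. 0 < r \<Longrightarrow> r \<le> 1 \<Longrightarrow> (\<integral>\<^sup>+x. emeasure M (cball x r) \<partial>M) \<le> ennreal (C * r ^ DIM('a))"
  shows "0 < emeasure lborel K"
proof (rule ccontr)
  interpret prob_space M by fact
  have finM: "finite_measure M" by (rule finite_measure_axioms)
  interpret Q: pair_sigma_finite M "lborel :: 'a measure" ..
  have space: "space M = UNIV" using sets_eq_imp_space_eq[OF sets_M] by simp
  \<comment> \<open>With \<open>V\<close> the volume of a ball of radius \<open>r\<close> and
    \<open>A\<close> the correlation bound at radius \<open>2 * r\<close>, the quotient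
    \<open>V / A\<close> equals \<open>c\<close> for every \<open>r\<close>. A null set
    \<open>K\<close> would have an open neighbourhood of measure below \<open>c\<close>.\<close>
  define c where "c = unit_ball_vol (real DIM('a)) / (C * 2 ^ DIM('a))"
  have c: "0 < c" using C by (simp add: c_def)
  assume "\<not> 0 < emeasure lborel K"
  then have K0: "emeasure lborel K = 0" by simp
  have Kb: "K \<in> sets borel" using K by (simp add: borel_compact)
  obtain U where U: "open U" "K \<subseteq> U" "emeasure lborel (U - K) < ennreal c"
    using outer_regular_lborel[OF Kb c] by blast
  have "emeasure lborel U \<le> emeasure lborel K + emeasure lborel (U - K)"
    using U(1,2) Kb emeasure_subadditive[of K lborel "U - K"] by (simp add: Un_absorb1)
  with U(3) K0 have Uc: "emeasure lborel U < ennreal c" by simp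
  have Um[measurable]: "U \<in> sets borel" using U by simp
  obtain \<epsilon> where \<epsilon>: "\<epsilon> > 0" "(\<Union>x\<in>K. cball x \<epsilon>) \<subseteq> U"
    using compact_subset_open_imp_cball_epsilon_subset[OF K(1) U(1,2)] by blast
  \<comment> \<open>The bound 1/2 makes the radius \<open>2 * r\<close> admissible in the
    correlation hypothesis.\<close>
  define r where "r = min \<epsilon> (1 / 2)"
  have r: "0 < r" "r \<le> \<epsilon>" "2 * r \<le> 1" using \<epsilon> by (auto simp: r_def)
  define V where "V = unit_ball_vol (real DIM('a)) * r ^ DIM('a)"
  have V: "0 < V" using r by (simp add: V_def)
  have ball_V: "emeasure lborel (cball x r) = ennreal V" for x :: 'a
    using r by (simp add: emeasure_cball V_def)
  define A where "A = C * (2 * r) ^ DIM('a)"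
  have A: "0 < A" using C r by (simp add: A_def)
  have VA: "V / A = c" using r C by (simp add: V_def A_def c_def power_mult_distrib)
  define h where "h u = emeasure M (cball u r)" for u
  define nr :: "'a \<Rightarrow> 'a \<Rightarrow> ennreal" where "nr x u = (if dist x u \<le> r then 1 else 0)" for x u
  have nr_measurable[measurable]: "(\<lambda>(x, u). nr x u) \<in> borel_measurable (M \<Otimes>\<^sub>M lborel)"
    unfolding nr_def by measurable
  have h_alt: "h u = (\<integral>\<^sup>+x. nr x u \<partial>M)" for u
  proof -
    have "(\<integral>\<^sup>+x. nr x u \<partial>M) = (\<integral>\<^sup>+x. indicator (cball u r) x \<partial>M)"
      by (intro nn_integral_cong) (auto simp: nr_def indicator_def dist_commute)
    then show ?thesis by (simp add: h_def sets_M)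
  qed
  have hm[measurable]: "h \<in> borel_measurable borel"
    unfolding h_def[abs_def] by (rule ball_measure_measurable[OF finM sets_M])
  have vol: "(\<integral>\<^sup>+u. nr x u \<partial>lborel) = ennreal V" for x
  proof -
    have "(\<integral>\<^sup>+u. nr x u \<partial>lborel) = (\<integral>\<^sup>+u. indicator (cball x r) u \<partial>lborel)"
      by (intro nn_integral_cong) (auto simp: nr_def indicator_def)
    then show ?thesis by (simp add: ball_V)
  qed
  have int_h: "(\<integral>\<^sup>+u. h u \<partial>lborel) = ennreal V"
  proof -
    have "(\<integral>\<^sup>+u. h u \<partial>lborel) = (\<integral>\<^sup>+x. (\<integral>\<^sup>+u. nr x u \<partial>lborel) \<partial>M)"
      unfolding h_alt using Q.Fubini'[of nr] nr_measurable by simp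
    then show ?thesis by (simp add: vol emeasure_space_1)
  qed
  \<comment> \<open>One factor \<open>h u\<close> is written as an integral over \<open>x\<close>;
    for \<open>u\<close> within \<open>r\<close> of \<open>x\<close> the other is at most the mass
    of the ball of radius \<open>2 * r\<close> around \<open>x\<close>.\<close>
  have int_h2: "(\<integral>\<^sup>+u. h u * h u \<partial>lborel) \<le> ennreal (V * A)"
  proof -
    have "(\<integral>\<^sup>+u. h u * h u \<partial>lborel) = (\<integral>\<^sup>+u. (\<integral>\<^sup>+x. h u * nr x u \<partial>M) \<partial>lborel)"
    proof (intro nn_integral_cong)
      fix u
      have "(\<lambda>x. nr x u) \<in> borel_measurable M" unfolding nr_def by measurable
      then show "h u * h u = (\<integral>\<^sup>+x. h u * nr x u \<partial>M)"
        by (subst nn_integral_cmult) (auto simp: h_alt[symmetric])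
    qed
    also have "\<dots> = (\<integral>\<^sup>+x. (\<integral>\<^sup>+u. h u * nr x u \<partial>lborel) \<partial>M)"
      using Q.Fubini'[of "\<lambda>x u. h u * nr x u"] by (simp add: nr_def)
    also have "\<dots> \<le> (\<integral>\<^sup>+x. emeasure M (cball x (2 * r)) * ennreal V \<partial>M)"
    proof (rule nn_integral_mono)
      fix x
      have "(\<integral>\<^sup>+u. h u * nr x u \<partial>lborel) \<le> (\<integral>\<^sup>+u. emeasure M (cball x (2 * r)) * nr x u \<partial>lborel)"
      proof (rule nn_integral_mono)
        fix u
        show "h u * nr x u \<le> emeasure M (cball x (2 * r)) * nr x u"
        proof (cases "dist x u \<le> r")
          case True
          have "cball u r \<subseteq> cball x (2 * r)"
          proof
            fix y assume "y \<in> cball u r"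
            then show "y \<in> cball x (2 * r)" using True dist_triangle[of x y u] by simp
          qed
          then show ?thesis unfolding h_def by (intro mult_right_mono emeasure_mono) (auto simp: sets_M)
        qed (simp add: nr_def)
      qed
      also have "\<dots> = emeasure M (cball x (2 * r)) * ennreal V"
      proof -
        have "(\<lambda>u. nr x u) \<in> borel_measurable lborel" unfolding nr_def by measurable
        then show ?thesis by (subst nn_integral_cmult) (auto simp: vol)
      qed
      finally show "(\<integral>\<^sup>+u. h u * nr x u \<partial>lborel) \<le> emeasure M (cball x (2 * r)) * ennreal V" .
    qed
    also have "\<dots> = (\<integral>\<^sup>+x. emeasure M (cball x (2 * r)) \<partial>M) * ennreal V"
      using ball_measure_measurable[OF finM sets_M] by (intro nn_integral_multc) simp
    also have "\<dots> \<le> ennreal A * ennreal V"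
      unfolding A_def using r by (intro mult_right_mono corr) auto
    also have "\<dots> = ennreal (V * A)" using A V by (simp add: mult.commute flip: ennreal_mult)
    finally show ?thesis .
  qed
  \<comment> \<open>On \<open>U\<close> this is AM-GM with \<open>A\<close> as the balancing
    parameter. Outside \<open>U\<close> the function \<open>h\<close> vanishes, because balls of
    radius \<open>r\<close> centred there miss \<open>K\<close>.\<close>
  have h_le: "ennreal 2 * h u \<le> ennreal (1 / A) * (h u * h u) + ennreal A * indicator U u" for u
  proof (cases "u \<in> U")
    case True
    define m where "m = measure M (cball u r)"
    have m: "h u = ennreal m" "0 \<le> m" by (auto simp: h_def m_def emeasure_eq_measure)
    have "0 \<le> (m - A)\<^sup>2 / A" using A by simp
    also have "(m - A)\<^sup>2 / A = 1 / A * (m * m) + A - 2 * m"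
      using A by (simp add: field_simps power2_eq_square)
    finally have "2 * m \<le> 1 / A * (m * m) + A" by simp
    then have "ennreal (2 * m) \<le> ennreal (1 / A * (m * m) + A)" by (rule ennreal_leI)
    also have "\<dots> = ennreal (1 / A * (m * m)) + ennreal A" using A m by (intro ennreal_plus) auto
    also have "ennreal (1 / A * (m * m)) = ennreal (1 / A) * (h u * h u)"
      unfolding m(1) by (rule ennreal_mult3[symmetric]) (use A m in auto)
    also have "ennreal (2 * m) = ennreal 2 * h u" unfolding m(1) using m(2) by (intro ennreal_mult) auto
    finally show ?thesis using True by simp
  next
    case False
    have "cball u r \<subseteq> - K"
    proof
      fix x assume "x \<in> cball u r"
      then have "u \<in> cball x \<epsilon>" using r by (simp add: dist_commute)
      then show "x \<in> - K" using False \<epsilon>(2) by blast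
    qed
    moreover have "emeasure M (- K) = 0"
      using emeasure_compl[of K M] K Kb emeasure_space_1 space by (simp add: Compl_eq_Diff_UNIV sets_M)
    moreover have "- K \<in> sets M" using Kb by (simp add: sets_M)
    ultimately have "h u = 0"
      unfolding h_def using emeasure_mono[of "cball u r" "- K" M] by simp
    then show ?thesis by simp
  qed
  \<comment> \<open>Integrating \<open>h_le\<close> gives \<open>2 * V\<close> at most
    \<open>V\<close> plus \<open>A\<close> times the measure of \<open>U\<close>, so that
    \<open>U\<close> has measure at least \<open>V / A = c\<close>, against its choice.\<close>
  have "ennreal 2 * ennreal V = (\<integral>\<^sup>+u. ennreal 2 * h u \<partial>lborel)"
    by (subst nn_integral_cmult) (auto simp: int_h)
  also have "\<dots> \<le> (\<integral>\<^sup>+u. ennreal (1 / A) * (h u * h u) + ennreal A * indicator U u \<partial>lborel)"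
    by (intro nn_integral_mono h_le)
  also have "\<dots> = ennreal (1 / A) * (\<integral>\<^sup>+u. h u * h u \<partial>lborel) + ennreal A * emeasure lborel U"
    by (subst nn_integral_add) (auto simp: nn_integral_cmult nn_integral_cmult_indicator)
  also have "\<dots> \<le> ennreal (1 / A) * ennreal (V * A) + ennreal A * emeasure lborel U"
    by (intro add_right_mono mult_left_mono int_h2) simp
  also have "ennreal (1 / A) * ennreal (V * A) = ennreal V" using A V by (simp flip: ennreal_mult)
  also have "ennreal 2 * ennreal V = ennreal V + ennreal V"
    by (simp add: mult_2)
  finally have "ennreal V \<le> ennreal A * emeasure lborel U"
    by (simp add: ennreal_add_left_cancel_le)
  also have "\<dots> < ennreal A * ennreal c"
    using Uc A by (intro ennreal_mult_strict_left_mono) auto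
  also have "\<dots> = ennreal V" using A c VA by (simp add: field_simps flip: ennreal_mult)
  finally show False by simp
qed

text \<open>For \<open>s < \<sigma>\<close> the correlation bound makes a sum of rescaled ball
  masses integrable, so on a set of positive measure the ball of radius \<open>1 / 2 ^ k\<close> has
  mass at most a multiple of \<open>(1 / 2 ^ k) powr s\<close> for all \<open>k\<close>. The mass
  distribution principle then excludes Hausdorff measure zero.\<close>

lemma hausdorff_dim_ge_if_correlation:
  fixes M :: "'a::euclidean_space measure"
  assumes M: "prob_space M" and sets_M[measurable_cong]: "sets M = sets borel"
    and A: "K \<subseteq> A" "K \<in> sets borel" "emeasure M K = 1" and C: "0 < C"
    and corr: "\<And>r. 0 < r \<Longrightarrow> r \<le> 1 \<Longrightarrow> (\<integral>\<^sup>+x. emeasure M (cball x r) \<partial>M) \<le> ennreal (C * r powr \<sigma>)"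
  shows "ereal \<sigma> \<le> hausdorff_dim A"
  unfolding hausdorff_dim_def
proof (rule Inf_greatest)
  interpret prob_space M by fact
  have finM: "finite_measure M" by (rule finite_measure_axioms)
  note ball_measure_measurable[OF finM sets_M, measurable]
  fix z assume "z \<in> ereal ` {s. 0 \<le> s \<and> hausdorff_measure s A = 0}"
  then obtain s where z: "z = ereal s" and s: "0 \<le> s" "hausdorff_measure s A = 0" by auto
  show "ereal \<sigma> \<le> z"
  proof (rule ccontr)
    assume "\<not> ?thesis"
    then have s\<sigma>: "s < \<sigma>" by (simp add: z)
    define F where "F x = (\<Sum>k::nat. ennreal ((2 ^ k) powr s) * emeasure M (cball x (1 / 2 ^ k)))" for x
    have Fm[measurable]: "F \<in> borel_measurable borel" unfolding F_def[abs_def] by measurable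
    have "(\<integral>\<^sup>+x. F x \<partial>M) = (\<Sum>k. \<integral>\<^sup>+x. ennreal ((2 ^ k) powr s) * emeasure M (cball x (1 / 2 ^ k)) \<partial>M)"
      unfolding F_def by (intro nn_integral_suminf) measurable
    also have "\<dots> \<le> (\<Sum>k. ennreal (C * (2 powr (s - \<sigma>)) ^ k))"
    proof (intro suminf_le allI)
      fix k
      have "(\<integral>\<^sup>+x. ennreal ((2 ^ k) powr s) * emeasure M (cball x (1 / 2 ^ k)) \<partial>M)
        = ennreal ((2 ^ k) powr s) * (\<integral>\<^sup>+x. emeasure M (cball x (1 / 2 ^ k)) \<partial>M)"
        by (rule nn_integral_cmult) measurable
      also have "\<dots> \<le> ennreal ((2 ^ k) powr s) * ennreal (C * (1 / 2 ^ k) powr \<sigma>)"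
        by (intro mult_left_mono corr) auto
      also have "\<dots> = ennreal (C * ((2 ^ k) powr s * (1 / 2 ^ k) powr \<sigma>))"
        using C by (simp add: mult_ac flip: ennreal_mult)
      also have "(2 ^ k) powr s * (1 / 2 ^ k) powr \<sigma> = (2 powr (s - \<sigma>)) ^ k"
        by (simp add: powr_divide powr_diff power_divide powr_powr powr_realpow[symmetric] mult.commute del: powr_realpow)
      finally show "(\<integral>\<^sup>+x. ennreal ((2 ^ k) powr s) * emeasure M (cball x (1 / 2 ^ k)) \<partial>M) \<le> ennreal (C * (2 powr (s - \<sigma>)) ^ k)" .
    qed auto
    also have "\<dots> < \<infinity>"
    proof -
      have "summable (\<lambda>k. C * (2 powr (s - \<sigma>)) ^ k)"
        using s\<sigma> powr_less_mono[of "s - \<sigma>" 0 2] by (intro summable_mult summable_geometric) auto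
      then have "(\<Sum>k. ennreal (C * (2 powr (s - \<sigma>)) ^ k)) = ennreal (\<Sum>k. C * (2 powr (s - \<sigma>)) ^ k)"
        using C by (intro suminf_ennreal2) auto
      then show ?thesis by simp
    qed
    finally have "(\<integral>\<^sup>+x. F x \<partial>M) \<noteq> \<infinity>" by simp
    then have AE_F: "AE x in M. F x \<noteq> \<infinity>" by (intro nn_integral_PInf_AE) auto
    \<comment> \<open>The sublevel sets of \<open>F\<close> exhaust \<open>K\<close> up to a null
      set, so one of them has positive measure.\<close>
    define G where "G n = {x \<in> K. F x \<le> ennreal (real n)}" for n :: nat
    have Gm[measurable]: "G n \<in> sets borel" for n unfolding G_def using A(2) by measurable
    have AE_K: "AE x in M. x \<in> K"
      using A by (subst AE_in_set_eq_1) (auto simp: sets_M emeasure_eq_measure)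
    obtain n where n: "emeasure M (G n) \<noteq> 0"
    proof (rule ccontr)
      assume "\<not> thesis"
      then have "\<And>n. G n \<in> null_sets M" using that by (auto simp: null_sets_def sets_M)
      then have "(\<Union>n. G n) \<in> null_sets M" by (rule null_sets_UN)
      then have "AE x in M. x \<notin> (\<Union>n. G n)" by (rule AE_not_in)
      with AE_F AE_K have "AE x in M. False"
      proof eventually_elim
        case (elim x)
        then obtain q where q: "F x = ennreal q" "0 \<le> q" by (cases "F x") auto
        then have "x \<in> G (nat \<lceil>q\<rceil>)" using elim(2) real_nat_ceiling_ge[of q] by (auto simp: G_def intro!: ennreal_leI)
        then show ?case using elim(3) by blast
      qed
      then show False by simp
    qed
    define N where "N = real n + 1"
    have N: "1 \<le> N" by (simp add: N_def)
    have G_ball: "emeasure M (cball x (1 / 2 ^ k)) \<le> ennreal (N * (1 / 2 ^ k) powr s)" if "x \<in> G n" for x k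
    proof -
      have "ennreal ((2 ^ k) powr s) * emeasure M (cball x (1 / 2 ^ k)) \<le> F x"
        unfolding F_def
        using sum_le_suminf[of "\<lambda>k. ennreal ((2 ^ k) powr s) * emeasure M (cball x (1 / 2 ^ k))" "{k}"] by simp
      also have "\<dots> \<le> ennreal N" using that by (auto simp: G_def N_def intro: order_trans ennreal_leI)
      finally have "ennreal ((2 ^ k) powr s * measure M (cball x (1 / 2 ^ k))) \<le> ennreal N"
        by (simp add: emeasure_eq_measure ennreal_mult)
      then have "(2 ^ k) powr s * measure M (cball x (1 / 2 ^ k)) \<le> N" using N by simp
      then have "measure M (cball x (1 / 2 ^ k)) \<le> N / (2 ^ k) powr s"
        by (simp add: pos_le_divide_eq mult.commute)
      also have "\<dots> = N * (1 / 2 ^ k) powr s" by (simp add: powr_divide)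
      finally show ?thesis by (simp add: emeasure_eq_measure ennreal_leI)
    qed
    \<comment> \<open>The factor \<open>2 powr s\<close> pays for enlarging the diameter of a
      covering set to a dyadic radius.\<close>
    define N' where "N' = N * 2 powr s"
    have N': "1 \<le> N'"
      using mult_mono[of 1 N 1 "2 powr s"] N s by (simp add: N'_def ge_one_powr_ge_zero)
    \<comment> \<open>Covering sets are arbitrary, so each trace on \<open>G n\<close> is enclosed
      in a Borel set. For \<open>s = 0\<close> the gauge of a nonempty set is 1. For
      \<open>s > 0\<close> a set of diameter 0 has gauge 0, and a point of \<open>G n\<close> has
      mass 0 because the masses of balls around it tend to 0.\<close>
    have cover: "\<exists>B\<in>sets borel. D \<inter> G n \<subseteq> B \<and> emeasure M B \<le> ennreal N' * diam_powr s D"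
      if D: "bounded D" "diameter D \<le> 1" for D
    proof (cases "D \<inter> G n = {}")
      case True
      then show ?thesis by (intro bexI[of _ "{}"]) auto
    next
      case False
      then obtain x where x: "x \<in> D" "x \<in> G n" by blast
      then have D0: "D \<noteq> {}" by blast
      have sub: "D \<subseteq> cball x (diameter D)"
        using diameter_bounded_bound[OF D(1) x(1)] by auto
      show ?thesis
      proof (cases "s = 0")
        case True
        have "emeasure M UNIV \<le> 1" by (rule emeasure_le_1)
        also have "1 \<le> ennreal N'" using N' by simp
        finally show ?thesis using True D0 by (intro bexI[of _ UNIV]) (auto simp: diam_powr_def)
      next
        case False
        then have s0: "0 < s" using s by simp
        have dp: "diam_powr s D = ennreal (diameter D powr s)" using D0 False by (simp add: diam_powr_def)
        show ?thesis
        proof (cases "diameter D = 0")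
          case True
          have "emeasure M {x} \<le> ennreal (N * (1 / 2 ^ k) powr s)" for k
            by (rule order_trans[OF emeasure_mono G_ball[OF x(2)]]) (auto simp: sets_M)
          moreover have "(\<lambda>k::nat. ennreal (N * (1 / 2 ^ k) powr s)) \<longlonglongrightarrow> ennreal (N * 0 powr s)"
          proof (intro tendsto_ennrealI tendsto_mult tendsto_const tendsto_powr')
            show "(\<lambda>k::nat. 1 / 2 ^ k :: real) \<longlonglongrightarrow> 0"
              using LIMSEQ_realpow_zero[of "1 / 2 :: real"] by (simp add: power_one_over)
          qed (use s0 in auto)
          ultimately have "emeasure M {x} \<le> ennreal (N * 0 powr s)"
            by (intro LIMSEQ_le_const) auto
          then show ?thesis using sub True by (intro bexI[of _ "{x}"]) (auto simp: dp)
        next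
          case False
          then have d: "0 < diameter D" using diameter_ge_0[OF D(1)] by simp
          obtain k :: nat where k: "2 ^ k \<le> 1 / diameter D" "1 / diameter D \<le> 2 * 2 ^ k"
            using dyadic_shell[of "1 / diameter D"] d D(2) by auto
          then have k': "diameter D \<le> 1 / 2 ^ k" "1 / 2 ^ k \<le> 2 * diameter D"
            using d by (auto simp: field_simps)
          have "emeasure M (cball x (1 / 2 ^ k)) \<le> ennreal (N * (1 / 2 ^ k) powr s)" by (rule G_ball[OF x(2)])
          also have "\<dots> \<le> ennreal (N * (2 * diameter D) powr s)"
            using k' N s0 by (intro ennreal_leI mult_left_mono powr_mono2) auto
          also have "\<dots> = ennreal N' * diam_powr s D"
            using d N by (simp add: dp N'_def powr_mult ennreal_mult mult.assoc)
          finally have "emeasure M (cball x (1 / 2 ^ k)) \<le> ennreal N' * diam_powr s D" .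
          moreover have "D \<inter> G n \<subseteq> cball x (1 / 2 ^ k)" using sub k'(1) by auto
          ultimately show ?thesis by (intro bexI[of _ "cball x (1 / 2 ^ k)"]) auto
        qed
      qed
    qed
    \<comment> \<open>Covers by sets of diameter at most 1 suffice, since the Hausdorff measure
      dominates every premeasure.\<close>
    have pre: "hausdorff_premeasure s 1 A = 0"
    proof -
      have "hausdorff_premeasure s 1 A \<le> hausdorff_measure s A"
        unfolding hausdorff_measure_def by (rule SUP_upper) simp
      then show ?thesis using s(2) by simp
    qed
    define g where "g = measure M (G n)"
    have g: "emeasure M (G n) = ennreal g" "0 < g"
      using n by (auto simp: g_def emeasure_eq_measure zero_less_measure_iff)
    have "hausdorff_premeasure s 1 A < ennreal (g / N')" using pre g N' by simp
    then obtain U where U: "A \<subseteq> (\<Union>i. U i)" "\<And>i. bounded (U i)" "\<And>i. diameter (U i) \<le> 1"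
      and U_sum: "(\<Sum>i. diam_powr s (U i)) < ennreal (g / N')"
      unfolding hausdorff_premeasure_def INF_less_iff by auto
    have "\<forall>i. \<exists>B\<in>sets borel. U i \<inter> G n \<subseteq> B \<and> emeasure M B \<le> ennreal N' * diam_powr s (U i)"
      using cover U(2,3) by blast
    then obtain B where B: "\<And>i. B i \<in> sets borel" "\<And>i. U i \<inter> G n \<subseteq> B i"
      "\<And>i. emeasure M (B i) \<le> ennreal N' * diam_powr s (U i)" by metis
    have "G n \<subseteq> (\<Union>i. B i)"
    proof
      fix x assume x: "x \<in> G n"
      then have "x \<in> A" using A(1) by (auto simp: G_def)
      then obtain i where "x \<in> U i" using U(1) by blast
      with x B(2)[of i] show "x \<in> (\<Union>i. B i)" by blast
    qed
    then have "emeasure M (G n) \<le> emeasure M (\<Union>i. B i)"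
      using B(1) by (intro emeasure_mono) (auto simp: sets_M)
    also have "\<dots> \<le> (\<Sum>i. emeasure M (B i))"
      using B(1) by (intro emeasure_subadditive_countably) (auto simp: sets_M)
    also have "\<dots> \<le> (\<Sum>i. ennreal N' * diam_powr s (U i))"
      by (intro suminf_le B(3) summableI)
    also have "\<dots> = ennreal N' * (\<Sum>i. diam_powr s (U i))" by simp
    also have "\<dots> < ennreal N' * ennreal (g / N')"
      using U_sum N' by (intro ennreal_mult_strict_left_mono) auto
    also have "\<dots> = ennreal g" using N' g by (simp flip: ennreal_mult)
    finally show False using g by simp
  qed
qed

section \<open>The image measure and the three conclusions\<close>

lemma dilation_image_eq: "dilation_image \<Gamma> E = (\<lambda>q. coord_dilation (fst q) (snd q)) ` (E \<times> \<Gamma>)"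
  unfolding dilation_image_def coord_dilation_def by force

text \<open>All three conclusions call for such a measure on a compact subset of the image and
  differ only in the order \<open>\<sigma>\<close> at which its Sobolev integral must
  converge.\<close>

lemma dilation_image_measure:
  fixes E :: "(real ^ 'n) set" and \<Gamma> :: "((real ^ 'n) \<times> (real ^ 'n)) set"
  assumes E: "E \<in> sets borel" "E \<noteq> {}" and \<Gamma>: "\<Gamma> \<in> sets borel" "\<Gamma> \<noteq> {}"
    and \<sigma>: "ereal (\<sigma> + 2 * real CARD('n) - 1) < hausdorff_dim E + hausdorff_dim \<Gamma>"
  obtains K M where "compact K" "K \<subseteq> dilation_image \<Gamma> E" "prob_space M" "sets M = sets borel" "emeasure M K = 1"
    "(\<integral>\<^sup>+x. ennreal ((norm (fourier_transform M x))\<^sup>2 * (1 + norm x) powr (\<sigma> - real DIM(real ^ 'n))) \<partial>lborel) < \<infinity>"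
proof -
  let ?d = "real CARD('n)"
  have nonneg: "0 \<le> hausdorff_dim X" for X :: "'b::metric_space set"
    unfolding hausdorff_dim_def by (rule Inf_greatest) auto
  \<comment> \<open>The strict inequality leaves room to lower both dimensions to real exponents. As
    dimensions are extended reals, the value \<infinity> is treated as a case.\<close>
  obtain s t where s: "ereal s < hausdorff_dim E" and t: "ereal t < hausdorff_dim \<Gamma>" and st: "\<sigma> + 2 * ?d - 1 < s + t"
  proof -
    obtain s where s: "ereal s < hausdorff_dim E" "ereal (\<sigma> + 2 * ?d - 1) < ereal s + hausdorff_dim \<Gamma>"
    proof (cases "hausdorff_dim E")
      case (real e)
      show thesis
      proof (cases "hausdorff_dim \<Gamma>")
        case (real g)
        then show thesis
          using \<sigma> \<open>hausdorff_dim E = ereal e\<close> by (intro that[of "e - (e + g - (\<sigma> + 2 * ?d - 1)) / 2"]) (auto simp: field_simps)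
      next
        case PInf
        then show thesis using \<open>hausdorff_dim E = ereal e\<close> by (intro that[of "e - 1"]) auto
      next
        case MInf
        then show thesis using nonneg[of \<Gamma>] by simp
      qed
    next
      case PInf
      moreover have "ereal (\<sigma> + 2 * ?d - 1) < ereal (\<sigma> + 2 * ?d) + hausdorff_dim \<Gamma>"
        using nonneg[of \<Gamma>] by (cases "hausdorff_dim \<Gamma>") auto
      ultimately show thesis by (intro that[of "\<sigma> + 2 * ?d"]) auto
    next
      case MInf
      then show thesis using nonneg[of E] by simp
    qed
    then have "ereal (\<sigma> + 2 * ?d - 1 - s) < hausdorff_dim \<Gamma>"
      by (cases "hausdorff_dim \<Gamma>") auto
    then obtain t where "ereal (\<sigma> + 2 * ?d - 1 - s) < ereal t" "ereal t < hausdorff_dim \<Gamma>"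
      using ereal_dense2 by blast
    with s(1) show thesis by (intro that[of s t]) auto
  qed
  obtain K1 \<mu> C1 where K1: "compact K1" "K1 \<subseteq> E" and \<mu>: "prob_space \<mu>" "sets \<mu> = sets borel" "emeasure \<mu> K1 = 1"
    and C1: "C1 > 0" "\<And>x r. 0 < r \<Longrightarrow> r \<le> 1 \<Longrightarrow> emeasure \<mu> (cball x r) \<le> ennreal (C1 * r powr s)"
    by (rule frostman[OF E s]) (rule that; blast)
  obtain K2 \<nu> C2 where K2: "compact K2" "K2 \<subseteq> \<Gamma>" and \<nu>: "prob_space \<nu>" "sets \<nu> = sets borel" "emeasure \<nu> K2 = 1"
    and C2: "C2 > 0" "\<And>x r. 0 < r \<Longrightarrow> r \<le> 1 \<Longrightarrow> emeasure \<nu> (cball x r) \<le> ennreal (C2 * r powr t)"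
    by (rule frostman[OF \<Gamma> t]) (rule that; blast)
  have AE1: "AE x in \<mu>. x \<in> K1"
    using prob_space.AE_in_set_eq_1[OF \<mu>(1), of K1] \<mu> K1 by (simp add: borel_compact measure_def)
  have AE2: "AE x in \<nu>. x \<in> K2"
    using prob_space.AE_in_set_eq_1[OF \<nu>(1), of K2] \<nu> K2 by (simp add: borel_compact measure_def)
  obtain L1 where L1: "0 < L1" "\<And>x. x \<in> K1 \<Longrightarrow> norm x \<le> L1"
    using compact_imp_bounded[OF K1(1)] unfolding bounded_pos by blast
  obtain L2 where L2: "0 < L2" "\<And>x. x \<in> K2 \<Longrightarrow> norm x \<le> L2"
    using compact_imp_bounded[OF K2(1)] unfolding bounded_pos by blast
  have fm1: "frostman_measure \<mu> C1 s"
    by (rule frostman_measure.intro) (use \<mu> C1 in \<open>auto simp: prob_space_def\<close>)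
  have fm2: "frostman_measure \<nu> C2 t"
    by (rule frostman_measure.intro) (use \<nu> C2 in \<open>auto simp: prob_space_def\<close>)
  interpret dilation_measure \<mu> \<nu> C1 s C2 t L1 L2
  proof (rule dilation_measure.intro[OF fm1 fm2 \<mu>(1) \<nu>(1)])
    show "AE x in \<mu>. norm x \<le> L1" using AE1 by eventually_elim (rule L1)
    show "AE x in \<nu>. norm x \<le> L2" using AE2 by eventually_elim (rule L2)
  qed (use L1 L2 in auto)
  define K where "K = (\<lambda>q. coord_dilation (fst q) (snd q)) ` (K1 \<times> K2)"
  have K: "compact K"
    unfolding K_def
    by (intro compact_continuous_image compact_Times K1 K2 continuous_on_subset[OF continuous_on_coord_dilation]) auto
  have "K \<subseteq> dilation_image \<Gamma> E" unfolding K_def dilation_image_eq using K1 K2 by (intro image_mono Sigma_mono) auto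
  moreover have "emeasure image_measure K = 1"
  proof -
    have "AE q in \<mu> \<Otimes>\<^sub>M \<nu>. fst q \<in> K1 \<and> snd q \<in> K2"
    proof (rule AE_pair_measure)
      show "AE x in \<mu>. AE y in \<nu>. fst (x, y) \<in> K1 \<and> snd (x, y) \<in> K2"
        using AE1 by eventually_elim (use AE2 in auto)
      have [measurable]: "K1 \<in> sets borel" "K2 \<in> sets borel" using K1 K2 by (simp_all add: borel_compact)
      show "{q \<in> space (\<mu> \<Otimes>\<^sub>M \<nu>). fst q \<in> K1 \<and> snd q \<in> K2} \<in> sets (\<mu> \<Otimes>\<^sub>M \<nu>)" by measurable
    qed
    then have "AE q in \<mu> \<Otimes>\<^sub>M \<nu>. coord_dilation (fst q) (snd q) \<in> K"
      by eventually_elim (auto simp: K_def intro!: image_eqI)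
    then have "AE x in image_measure. x \<in> K"
      unfolding image_measure_def using K by (subst AE_distr_iff) (auto simp: borel_compact)
    then show ?thesis
      using K prob_space.emeasure_eq_1_AE[OF prob_image, of K] by (simp add: borel_compact)
  qed
  moreover have "(\<integral>\<^sup>+x. ennreal ((norm (fourier_transform image_measure x))\<^sup>2 * (1 + norm x) powr (\<sigma> - real DIM(real ^ 'n))) \<partial>lborel) < \<infinity>"
  proof -
    obtain k where "k > 0" "\<And>R. 1 \<le> R \<Longrightarrow>
      (\<integral>\<^sup>+\<xi>. indicator {\<xi>. R \<le> norm \<xi> \<and> norm \<xi> \<le> 2 * R} \<xi> * ennreal ((norm (fourier_transform image_measure \<xi>))\<^sup>2) \<partial>lborel)
      \<le> ennreal (k * R powr (3 * ?d - 1 - s - t))"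
      using shell_le by blast
    \<comment> \<open>With \<open>p = \<sigma> - ?d\<close> and
      \<open>q = 3 * ?d - 1 - s - t\<close>, the condition \<open>p + q < 0\<close> is exactly
      \<open>\<sigma> + 2 * ?d - 1 < s + t\<close>.\<close>
    then show ?thesis
      using st by (intro sobolev_integral_finite[OF prob_image sets_image, of k "3 * ?d - 1 - s - t"]) auto
  qed
  ultimately show thesis using K prob_image sets_image by (intro that[of K image_measure])
qed

theorem theorem1p3:
  fixes E :: "(real ^ 'n) set"
    and \<Gamma> :: "((real ^ 'n) \<times> (real ^ 'n)) set"
  assumes "E \<in> sets borel" and "E \<noteq> {}"
    and "\<Gamma> \<in> sets borel" and "\<Gamma> \<noteq> {}"
    and "\<And>z r i. (z, r) \<in> \<Gamma> \<Longrightarrow> 0 < r $ i"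
  shows "sobolev_dim (dilation_image \<Gamma> E)
           \<ge> hausdorff_dim E + hausdorff_dim \<Gamma> - ereal (2 * real CARD('n)) + 1
    \<and> (hausdorff_dim E + hausdorff_dim \<Gamma> > ereal (3 * real CARD('n) - 1)
         \<longrightarrow> emeasure lebesgue (dilation_image \<Gamma> E) > 0)
    \<and> (\<forall>u :: real. 0 < u \<and> u < real CARD('n)
         \<and> hausdorff_dim E + hausdorff_dim \<Gamma> > ereal (2 * real CARD('n) - 1 + u)
         \<longrightarrow> hausdorff_dim (dilation_image \<Gamma> E) \<ge> ereal u)"
proof (intro conjI impI allI)
  let ?d = "real CARD('n)" and ?A = "dilation_image \<Gamma> E"
  note ex = dilation_image_measure[OF assms(1-4)]
  show "hausdorff_dim E + hausdorff_dim \<Gamma> - ereal (2 * ?d) + 1 \<le> sobolev_dim ?A"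
  proof (rule dense_le)
    fix x assume x: "x < hausdorff_dim E + hausdorff_dim \<Gamma> - ereal (2 * ?d) + 1"
    show "x \<le> sobolev_dim ?A"
    proof (cases x)
      case (real \<sigma>)
      with x have "ereal (\<sigma> + 2 * ?d - 1) < hausdorff_dim E + hausdorff_dim \<Gamma>"
        by (cases "hausdorff_dim E + hausdorff_dim \<Gamma>") (auto simp: one_ereal_def)
      then obtain K M where K: "compact K" "K \<subseteq> ?A" and M: "prob_space M" "sets M = sets borel" "emeasure M K = 1"
        and int: "(\<integral>\<^sup>+x. ennreal ((norm (fourier_transform M x))\<^sup>2 * (1 + norm x) powr (\<sigma> - real DIM(real ^ 'n))) \<partial>lborel) < \<infinity>"
        by (rule ex)
      have "ereal \<sigma> \<le> sobolev_dim_measure M"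
        unfolding sobolev_dim_measure_def by (rule Sup_upper) (use int in auto)
      also have "\<dots> \<le> sobolev_dim ?A"
        unfolding sobolev_dim_def
        by (rule SUP_upper) (use compact_radon_measuresI[OF M(1,2) K M(3)] M(1) in auto)
      finally show ?thesis using real by simp
    qed (use x in auto)
  qed
  show "0 < emeasure lebesgue ?A" if "ereal (3 * ?d - 1) < hausdorff_dim E + hausdorff_dim \<Gamma>"
  proof -
    \<comment> \<open>At the order \<open>\<sigma> = ?d\<close> the Sobolev weight is 1, and the
      correlation bound has the exponent of Lebesgue measure.\<close>
    have "ereal (?d + 2 * ?d - 1) < hausdorff_dim E + hausdorff_dim \<Gamma>" using that by simp
    then obtain K M where K: "compact K" "K \<subseteq> ?A" and M: "prob_space M" "sets M = sets borel" "emeasure M K = 1"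
      and int: "(\<integral>\<^sup>+x. ennreal ((norm (fourier_transform M x))\<^sup>2 * (1 + norm x) powr (?d - real DIM(real ^ 'n))) \<partial>lborel) < \<infinity>"
      by (rule ex)
    obtain C where "C > 0" "\<And>r. 0 < r \<Longrightarrow> r \<le> 1 \<Longrightarrow> (\<integral>\<^sup>+x. emeasure M (cball x r) \<partial>M) \<le> ennreal (C * r powr ?d)"
      using correlation_le[OF M(1,2) _ int] by auto
    then have "0 < emeasure lborel K"
      by (intro lborel_pos_if_correlation[OF M(1,2) K(1) M(3)]) (auto simp: powr_realpow)
    also have "emeasure lborel K = emeasure lebesgue K"
      using K by (simp add: borel_compact)
    also have "\<dots> \<le> emeasure lebesgue ?A"
    \<comment> \<open>By convention a non-measurable set has \<open>emeasure\<close> 0, so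
      monotonicity requires the image to be Lebesgue measurable.\<close>
    proof (rule emeasure_mono[OF K(2)])
      have "E \<times> \<Gamma> \<in> sets borel" using assms by (simp add: borel_Times)
      then show "?A \<in> sets lebesgue"
        unfolding dilation_image_eq by (rule continuous_image_Borel_lebesgue[OF _ continuous_on_coord_dilation])
    qed
    finally show ?thesis .
  qed
  fix u :: real assume u: "0 < u \<and> u < ?d \<and> ereal (2 * ?d - 1 + u) < hausdorff_dim E + hausdorff_dim \<Gamma>"
  then have "ereal (u + 2 * ?d - 1) < hausdorff_dim E + hausdorff_dim \<Gamma>" by (simp add: algebra_simps)
  then obtain K M where K: "compact K" "K \<subseteq> ?A" and M: "prob_space M" "sets M = sets borel" "emeasure M K = 1"
    and int: "(\<integral>\<^sup>+x. ennreal ((norm (fourier_transform M x))\<^sup>2 * (1 + norm x) powr (u - real DIM(real ^ 'n))) \<partial>lborel) < \<infinity>"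
    by (rule ex)
  obtain C where "C > 0" "\<And>r. 0 < r \<Longrightarrow> r \<le> 1 \<Longrightarrow> (\<integral>\<^sup>+x. emeasure M (cball x r) \<partial>M) \<le> ennreal (C * r powr u)"
    using correlation_le[OF M(1,2) _ int] u by auto
  then show "ereal u \<le> hausdorff_dim ?A"
    using K by (intro hausdorff_dim_ge_if_correlation[OF M(1,2) K(2) _ M(3)]) (auto simp: borel_compact)
qed

end
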